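(* Let $a$ be a self-adjoint Hilbert-Schmidt operator on $H$ such that $\mathrm{e}^a=1+A$ with $A$ an orthogonal projector, and let $\Omega=\{u\mathrm{e}^au^* : u\in\mathsf{B}(H)\text{ unitary}\}\subset\Sigma_1$ be the unitary orbit of $\mathrm{e}^a$. Then: (1) $\Omega$ is a Riemannian submanifold of $\Sigma_1$. (2) For every $p\in\Omega$, $T_p\Omega=\{i[x,p] : x\in\mathsf{HS}^h\}$ and $T_p\Omega^{\perp}=\{x\in\mathsf{HS}^h : [x,p]=0\}$. (3) The action of the unitary group is isometric: $\mathrm{dist}^{\Omega}(upu^*,uqu^* )=\mathrm{dist}^{\Omega}(p,q)$ for all $p,q\in\Omega$ and any unitary operator $u\in\mathsf{B}(H)$. (4) Let $p\in\Omega$ and write $p=g\mathrm{e}^ag^*$ with $g\in\mathsf{B}(H)$ unitary. For any $v=i[x,p]\in T_p\Omega$, with $x\in\mathsf{HS}^h$, the exponential map of $\Omega$ at $p$ is given by $$\exp_p^{\Omega}(v)=\mathrm{e}^{ighg^*}\,p\,\mathrm{e}^{-ighg^*},$$ where $h$ is the co-diagonal part of $g^*xg$ with respect to $A$. In particular, the exponential map is defined in the whole tangent space. (5) If $p=g\mathrm{e}^ag^*$ and $q=w\mathrm{e}^aw^*$ with $g,w\in\mathsf{B}(H)$ unitary, and $h$ is a self-adjoint operator, co-diagonal with respect to $A$, such that $w^*g\mathrm{e}^{ih}$ commutes with $\mathrm{e}^a$, then the curve $\gamma(t)=\mathrm{e}^{itghg^*}\,p\,\mathrm{e}^{-itghg^*}$,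 $t\in[0,1]$, is a geodesic of $\Omega\subset\Sigma_1$ which joins $p$ to $q$. (6) If, in the situation of (5), $h\in\mathsf{HS}^h$, then the length of $\gamma$ is $L(\gamma)=\frac{\sqrt2}{2}\|h\|_2$. (7) For every $p\in\Omega$, the exponential map $\exp_p^{\Omega}:T_p\Omega\to\Omega$ is surjective.
   Context: $H$ is a complex separable Hilbert space, $\mathsf{B}(H)$ the bounded operators on $H$, $1$ the identity operator, and $[x,y]=xy-yx$. $\mathsf{HS}^h$ is the real Hilbert space of self-adjoint Hilbert-Schmidt operators with norm $\|x\|_2=2\,\mathrm{tr}(x^*x)^{1/2}$. $\Sigma_1=\{1+x : x\in\mathsf{HS}^h,\ 1+x \text{ positive and invertible}\}$ is an open subset of the affine space $1+\mathsf{HS}^h$; its tangent space at each point is identified with $\mathsf{HS}^h$, and it carries the Riemannian metric $$\langle X,Y\rangle_p=4\,\mathrm{tr}(p^{-1}Xp^{-1}Y),\qquad p\in\Sigma_1,\ X,Y\in\mathsf{HS}^h.$$ The covariant derivative of this metric along a curve is $\nabla_{\dot\gamma}\dot\gamma=\ddot\gamma-\dot\gamma\gamma^{-1}\dot\gamma$. $\Omega$ is given the metric induced from $\Sigma_1$; thus a curve $\gamma$ in $\Omega$ is a geodesic of $\Omega\subset\Sigma_1$ when $\nabla_{\dot\gamma}\dot\gamma\perp T_{\gamma}\Omega$ at each point. $T_p\Omega^\perp$ is the orthogonal complement of $T_p\Omega$ in $\mathsf{HS}^h$ with respect to $\langle\cdot,\cdot\rangle_p$, $\mathrm{dist}^\Omega$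 is the geodesic distance of $\Omega$ (infimum of lengths of curves in $\Omega$), $L$ denotes length of curves, and $\exp_p^\Omega$ is the Riemannian exponential map of $\Omega$ at $p$. The co-diagonal part of an operator $y$ (with respect to $A$) is $Ay(1-A)+(1-A)yA$, and $h$ is co-diagonal if it equals its co-diagonal part, i.e. $AhA=0=(1-A)h(1-A)$. *)

theory Defs
  imports "HOL-Analysis.Analysis"
begin

section \<open>Complex Hilbert spaces\<close>

class complex_vector = real_vector +
  fixes scaleC :: "complex \<Rightarrow> 'a \<Rightarrow> 'a"  (infixr "*\<^sub>C" 75)
  assumes scaleC_add_right: "c *\<^sub>C (x + y) = c *\<^sub>C x + c *\<^sub>C y"
    and scaleC_add_left: "(c + d) *\<^sub>C x = c *\<^sub>C x + d *\<^sub>C x"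
    and scaleC_scaleC: "c *\<^sub>C (d *\<^sub>C x) = (c * d) *\<^sub>C x"
    and scaleC_of_real: "complex_of_real r *\<^sub>C x = r *\<^sub>R x"

text \<open>The complex inner product is linear in its second argument.  Its real part is the real inner
  product of the superclass, hence \<open>\<parallel>x\<parallel>\<^sup>2 = cinner x x\<close>; completeness is
  \<^class>\<open>complete_space\<close>.\<close>

class complex_hilbert = complex_vector + real_inner + complete_space +
  fixes cinner :: "'a \<Rightarrow> 'a \<Rightarrow> complex"
  assumes cinner_commute: "cinner x y = cnj (cinner y x)"
    and cinner_add_right: "cinner x (y + z) = cinner x y + cinner x z"
    and cinner_scaleC_right: "cinner x (c *\<^sub>C y) = c * cinner x y"
    and Re_cinner: "Re (cinner x y) = inner x y"

lemma cinner_add_left: "cinner (x + y) z = cinner x z + cinner y (z::'a::complex_hilbert)"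
  by (metis cinner_commute cinner_add_right complex_cnj_add)

lemma cinner_scaleC_left: "cinner (c *\<^sub>C x) y = cnj c * cinner x (y::'a::complex_hilbert)"
  by (metis cinner_commute cinner_scaleC_right complex_cnj_mult)

lemma cinner_scaleR:
  "cinner (r *\<^sub>R x) y = of_real r * cinner x y"
  "cinner x (r *\<^sub>R y) = of_real r * cinner x (y::'a::complex_hilbert)"
  by (simp_all add: scaleC_of_real[symmetric] cinner_scaleC_left cinner_scaleC_right)

lemma norm_cinner_le: "cmod (cinner x y) \<le> norm x * norm (y::'a::complex_hilbert)"
proof (cases "cinner x y = 0")
  case False
  define c where "c = cnj (cinner x y) / cmod (cinner x y)"
  have c1: "cmod c = 1" using False by (simp add: c_def norm_divide)
  have n: "norm (c *\<^sub>C y) = norm y"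
  proof -
    have "inner (c *\<^sub>C y) (c *\<^sub>C y) = Re ((cnj c * c) * cinner y y)"
      by (simp add: Re_cinner[symmetric] cinner_scaleC_left cinner_scaleC_right mult.assoc mult.left_commute)
    also have "cnj c * c = 1"
      using c1 by (metis complex_norm_square mult.commute of_real_1 one_power2)
    finally show ?thesis by (simp add: Re_cinner norm_eq_sqrt_inner)
  qed
  have "c * cinner x y = complex_of_real (cmod (cinner x y))"
    using False by (simp add: c_def complex_norm_square[symmetric] power2_eq_square mult.commute field_simps)
  then have "cmod (cinner x y) = Re (cinner x (c *\<^sub>C y))"
    by (simp add: cinner_scaleC_right)
  also have "\<dots> \<le> norm x * norm (c *\<^sub>C y)"
    by (simp add: Re_cinner norm_cauchy_schwarz)
  finally show ?thesis by (simp add: n)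
qed simp

subsection \<open>Orthonormal bases\<close>

definition orthonormal :: "'a::complex_hilbert set \<Rightarrow> bool" where
  "orthonormal E \<longleftrightarrow> (\<forall>e\<in>E. \<forall>f\<in>E. cinner e f = (if e = f then 1 else 0))"

text \<open>\<^const>\<open>span\<close> is the real span; the real span of all complex multiples is the complex span.\<close>

definition is_onb :: "'a::complex_hilbert set \<Rightarrow> bool" where
  "is_onb E \<longleftrightarrow> orthonormal E \<and> closure (span {c *\<^sub>C e | c e. e \<in> E}) = UNIV"

definition onb :: "'a::complex_hilbert set" where
  "onb = (SOME E. is_onb E)"

lemma orthogonal_vector_exists:
  fixes M :: "'a::complex_hilbert set"
  assumes sub: "subspace M" and cl: "closed M" and v: "v \<notin> M"
  obtains w where "w \<noteq> 0" "\<And>m. m \<in> M \<Longrightarrow> inner m w = 0"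
proof -
  have ne: "M \<noteq> {}" and zero: "0 \<in> M" using sub subspace_0 by auto
  define d where "d = infdist v M"
  have d0: "d \<ge> 0" by (simp add: d_def infdist_nonneg)
  have dle: "d \<le> dist v m" if "m \<in> M" for m using that by (simp add: d_def infdist_le)
  have "\<exists>m\<in>M. dist v m < d + 1 / real (Suc n)" for n
  proof (rule ccontr)
    assume "\<not> ?thesis"
    then have "\<And>m. m \<in> M \<Longrightarrow> d + 1 / real (Suc n) \<le> dist v m" by force
    then have "d + 1 / real (Suc n) \<le> infdist v M"
      using ne by (auto simp: infdist_notempty intro!: cINF_greatest)
    then show False by (simp add: d_def)
  qed
  then obtain X where X: "\<And>n. X n \<in> M" "\<And>n. dist v (X n) < d + 1 / real (Suc n)" by metis
  have key: "(dist (X m) (X n))\<^sup>2 \<le> 4 * (2 * d + 1) / real (Suc k)" if "m \<ge> k" "n \<ge> k" for m n k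
  proof -
    define e where "e = 1 / real (Suc k)"
    have e: "0 < e" "e \<le> 1" by (auto simp: e_def)
    have b: "dist v (X j) \<le> d + e" if "j \<ge> k" for j
    proof -
      have "1 / real (Suc j) \<le> e" using that by (simp add: e_def frac_le)
      then show ?thesis using X(2)[of j] by linarith
    qed
    have sq: "(norm (v - X j))\<^sup>2 \<le> (d + e)\<^sup>2" if "j \<ge> k" for j
      using b[OF that] by (intro power_mono) (auto simp: dist_norm)
    have par: "(norm (X m - X n))\<^sup>2 + (norm ((v - X m) + (v - X n)))\<^sup>2
        = 2 * (norm (v - X m))\<^sup>2 + 2 * (norm (v - X n))\<^sup>2"
      by (simp add: power2_norm_eq_inner inner_diff_left inner_diff_right inner_add_left inner_add_right inner_commute algebra_simps)
    have mid: "(1/2) *\<^sub>R (X m + X n) \<in> M"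
      by (intro subspace_scale[OF sub] subspace_add[OF sub] X)
    have "(v - X m) + (v - X n) = 2 *\<^sub>R (v - (1/2) *\<^sub>R (X m + X n))"
      by (simp add: algebra_simps scaleR_2)
    then have "norm ((v - X m) + (v - X n)) = 2 * dist v ((1/2) *\<^sub>R (X m + X n))"
      by (simp add: dist_norm)
    with dle[OF mid] have "norm ((v - X m) + (v - X n)) \<ge> 2 * d" by linarith
    then have "(norm ((v - X m) + (v - X n)))\<^sup>2 \<ge> (2 * d)\<^sup>2" using d0 by (intro power_mono) auto
    with par sq[OF that(1)] sq[OF that(2)]
    have "(norm (X m - X n))\<^sup>2 \<le> 4 * (d + e)\<^sup>2 - 4 * d\<^sup>2" by (simp add: power2_eq_square)
    also have "\<dots> = 4 * ((2 * d + e) * e)" by (simp add: power2_eq_square algebra_simps)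
    also have "\<dots> \<le> 4 * ((2 * d + 1) * e)" using e d0 by (intro mult_left_mono mult_right_mono) auto
    finally show ?thesis by (simp add: dist_norm e_def)
  qed
  have "Cauchy X"
  proof (rule metric_CauchyI)
    fix \<epsilon> :: real assume "\<epsilon> > 0"
    have "4 * (2 * d + 1) > 0" using d0 by simp
    obtain k where k: "4 * (2 * d + 1) / \<epsilon>\<^sup>2 < real k" using reals_Archimedean2 by blast
    have "4 * (2 * d + 1) / real (Suc k) < \<epsilon>\<^sup>2"
    proof -
      have "4 * (2 * d + 1) < real k * \<epsilon>\<^sup>2" using k \<open>\<epsilon> > 0\<close> by (simp only: pos_divide_less_eq zero_less_power)
      also have "\<dots> \<le> real (Suc k) * \<epsilon>\<^sup>2" by (intro mult_right_mono) auto
      finally show ?thesis by (simp only: pos_divide_less_eq of_nat_0_less_iff zero_less_Suc mult.commute)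
    qed
    then have "dist (X m) (X n) < \<epsilon>" if "m \<ge> k" "n \<ge> k" for m n
      using key[OF that] \<open>\<epsilon> > 0\<close> by (meson le_less_trans not_less power_mono less_imp_le)
    then show "\<exists>M. \<forall>m\<ge>M. \<forall>n\<ge>M. dist (X m) (X n) < \<epsilon>" by blast
  qed
  then obtain p where p: "X \<longlonglongrightarrow> p" using Cauchy_convergent convergent_def by blast
  have pM: "p \<in> M" using closed_sequentially[OF cl _ p] X(1) by blast
  have dp: "dist v p \<le> d"
  proof (rule LIMSEQ_le)
    show "(\<lambda>n. dist v (X n)) \<longlonglongrightarrow> dist v p" by (intro tendsto_intros p)
    have "(\<lambda>n. d + 1 / real (Suc n)) \<longlonglongrightarrow> d + 0"
      by (intro tendsto_intros LIMSEQ_Suc[OF lim_1_over_n])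
    then show "(\<lambda>n. d + 1 / real (Suc n)) \<longlonglongrightarrow> d" by simp
    show "\<exists>N. \<forall>n\<ge>N. dist v (X n) \<le> d + 1 / real (Suc n)" using X(2) less_imp_le by blast
  qed
  define w where "w = v - p"
  have "w \<noteq> 0" using v pM by (auto simp: w_def)
  moreover have "inner m w = 0" if m: "m \<in> M" for m
  proof (cases "m = 0")
    case False
    define t where "t = inner m w / (norm m)\<^sup>2"
    have "p + t *\<^sub>R m \<in> M" by (intro subspace_add[OF sub] subspace_scale[OF sub] pM m)
    from dle[OF this] dp have "norm w \<le> norm (w - t *\<^sub>R m)"
      by (simp add: dist_norm w_def algebra_simps)
    then have "(norm w)\<^sup>2 \<le> (norm (w - t *\<^sub>R m))\<^sup>2" by (intro power_mono) auto
    also have "\<dots> = (norm w)\<^sup>2 - 2 * t * inner m w + t\<^sup>2 * (norm m)\<^sup>2"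
      unfolding power2_norm_eq_inner
      by (simp add: inner_diff_left inner_diff_right inner_commute power2_eq_square algebra_simps)
    also have "\<dots> = (norm w)\<^sup>2 - (inner m w)\<^sup>2 / (norm m)\<^sup>2"
      using False by (simp add: t_def power2_eq_square field_simps)
    finally have "(inner m w)\<^sup>2 / (norm m)\<^sup>2 \<le> 0" by simp
    then show ?thesis using False by (simp add: divide_le_0_iff)
  qed simp
  ultimately show ?thesis using that by blast
qed

lemma subspace_closure:
  assumes "subspace (S::'a::real_normed_vector set)" shows "subspace (closure S)"
proof (rule subspaceI)
  show "0 \<in> closure S" using subspace_0[OF assms] by (rule subsetD[OF closure_subset])
next
  fix x y assume "x \<in> closure S" "y \<in> closure S"
  then obtain f g where fg: "\<forall>n. f n \<in> S" "f \<longlonglongrightarrow> x" "\<forall>n. g n \<in> S" "g \<longlonglongrightarrow> y"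
    by (auto simp: closure_sequential)
  then have "\<forall>n. f n + g n \<in> S" using assms by (simp add: subspace_add)
  with tendsto_add[OF fg(2,4)] show "x + y \<in> closure S"
    unfolding closure_sequential by (intro exI[of _ "\<lambda>n. f n + g n"] conjI)
next
  fix r x assume "x \<in> closure S"
  then obtain f where f: "\<forall>n. f n \<in> S" "f \<longlonglongrightarrow> x"
    by (auto simp: closure_sequential)
  then have "\<forall>n. r *\<^sub>R f n \<in> S" using assms by (simp add: subspace_scale)
  with tendsto_scaleR[OF tendsto_const f(2)] show "r *\<^sub>R x \<in> closure S"
    unfolding closure_sequential by (intro exI[of _ "\<lambda>n. r *\<^sub>R f n"] conjI)
qed

lemma bounded_linear_scaleC: "bounded_linear (\<lambda>x::'a::complex_hilbert. c *\<^sub>C x)"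
proof (rule bounded_linear_intro[where K="cmod c"])
  fix x :: 'a and r
  show "c *\<^sub>C (r *\<^sub>R x) = r *\<^sub>R (c *\<^sub>C x)"
    by (simp add: scaleC_of_real[symmetric] scaleC_scaleC mult.commute)
  have "inner (c *\<^sub>C x) (c *\<^sub>C x) = Re ((cnj c * c) * cinner x x)"
    by (simp add: Re_cinner[symmetric] cinner_scaleC_left cinner_scaleC_right mult.assoc mult.left_commute)
  also have "cnj c * c = complex_of_real ((cmod c)\<^sup>2)"
    by (simp only: complex_norm_square mult.commute)
  finally have "inner (c *\<^sub>C x) (c *\<^sub>C x) = (cmod c)\<^sup>2 * inner x x" by (simp add: Re_cinner)
  then show "norm (c *\<^sub>C x) \<le> norm x * cmod c"
    by (simp add: norm_eq_sqrt_inner real_sqrt_mult)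
qed (rule scaleC_add_right)

lemma is_onb_exists: "\<exists>E::'a::complex_hilbert set. is_onb E"
proof -
  have "\<exists>E\<in>Collect orthonormal. \<forall>F\<in>Collect orthonormal. E \<subseteq> F \<longrightarrow> F = (E::'a set)"
  proof (rule subset_Zorn')
    fix C :: "'a set set" assume C: "subset.chain (Collect orthonormal) C"
    show "\<Union>C \<in> Collect orthonormal"
      unfolding orthonormal_def mem_Collect_eq
    proof (intro ballI)
      fix e f assume "e \<in> \<Union>C" "f \<in> \<Union>C"
      then obtain A B where "A \<in> C" "B \<in> C" "e \<in> A" "f \<in> B" by blast
      moreover have "A \<subseteq> B \<or> B \<subseteq> A" using C \<open>A \<in> C\<close> \<open>B \<in> C\<close>
        by (auto simp: subset_chain_def)
      ultimately obtain D where "D \<in> C" "e \<in> D" "f \<in> D" by blast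
      then show "cinner e f = (if e = f then 1 else 0)"
        using C by (auto simp: subset_chain_def orthonormal_def)
    qed
  qed
  then obtain E :: "'a set" where E: "orthonormal E"
    and max: "\<And>F. orthonormal F \<Longrightarrow> E \<subseteq> F \<Longrightarrow> F = E" by blast
  define M where "M = closure (span {c *\<^sub>C e | c e. e \<in> E})"
  have "v \<in> M" for v
  proof (rule ccontr)
    assume "v \<notin> M"
    moreover have "subspace M" "closed M" by (auto simp: M_def intro: subspace_closure)
    ultimately obtain w where w: "w \<noteq> 0" "\<And>m. m \<in> M \<Longrightarrow> inner m w = 0"
      using orthogonal_vector_exists by blast
    have inM: "c *\<^sub>C e \<in> M" if "e \<in> E" for c e
      unfolding M_def
      by (rule subsetD[OF closure_subset], rule span_base) (use that in blast)
    have perp: "cinner e w = 0" if "e \<in> E" for e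
    proof (rule complex_eqI)
      have "e = 1 *\<^sub>C e" using scaleC_of_real[of 1 e] by simp
      then show "Re (cinner e w) = Re 0" using w(2)[OF inM[OF that, of 1]] by (simp add: Re_cinner)
      show "Im (cinner e w) = Im 0"
        using w(2)[OF inM[OF that, of \<i>]] by (simp add: Re_cinner[symmetric] cinner_scaleC_left)
    qed
    define u where "u = (1 / norm w) *\<^sub>R w"
    have u: "u = complex_of_real (1 / norm w) *\<^sub>C w" by (simp only: u_def scaleC_of_real)
    have eu: "cinner e u = 0" "cinner u e = 0" if "e \<in> E" for e
      using perp[OF that] cinner_commute[of w e]
      by (simp_all add: u cinner_scaleC_right cinner_scaleC_left)
    have uu: "cinner u u = 1"
    proof (rule complex_eqI)
      show "Im (cinner u u) = Im 1"
        using arg_cong[OF cinner_commute[of u u], of Im] by simp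
      have "norm u = 1" using w(1) by (simp add: u_def)
      then show "Re (cinner u u) = Re 1" by (simp add: Re_cinner norm_eq_sqrt_inner)
    qed
    have "orthonormal (insert u E)"
      using E eu uu unfolding orthonormal_def by (metis insert_iff zero_neq_one)
    then have "u \<in> E" using max by blast
    then show False using eu(1)[of u] uu by simp
  qed
  then have "is_onb E" using E by (auto simp: is_onb_def M_def)
  then show ?thesis by blast
qed

lemma is_onb_onb: "is_onb onb"
  unfolding onb_def by (rule someI_ex) (rule is_onb_exists)


section \<open>Bounded operators\<close>

typedef (overloaded) 'a bop =
  "{T :: 'a::complex_hilbert \<Rightarrow>\<^sub>L 'a. \<forall>c x. blinfun_apply T (c *\<^sub>C x) = c *\<^sub>C blinfun_apply T x}"
  morphisms blinfun_of_bop Bop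
  by (rule exI[of _ id_blinfun]) simp

setup_lifting type_definition_bop

lift_definition bapp :: "'a::complex_hilbert bop \<Rightarrow> 'a \<Rightarrow> 'a" is blinfun_apply .

lemma bapp_scaleC: "bapp T (c *\<^sub>C x) = c *\<^sub>C bapp T x"
  by transfer simp

lemma bounded_linear_bapp: "bounded_linear (bapp T)"
  by transfer (rule blinfun.bounded_linear_right)

lemma bop_eqI: "(\<And>x. bapp S x = bapp T x) \<Longrightarrow> S = T"
  by transfer (rule blinfun_eqI)

lemma scaleC_real_commute: "c *\<^sub>C (r *\<^sub>R x) = r *\<^sub>R (c *\<^sub>C (x::'a::complex_vector))"
  by (simp add: scaleC_of_real[symmetric] scaleC_scaleC mult.commute)

instantiation bop :: (complex_hilbert) complex_vector
begin

lift_definition zero_bop :: "'a bop" is 0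
  by (simp add: linear_0[OF bounded_linear.linear[OF bounded_linear_scaleC]])
lift_definition plus_bop :: "'a bop \<Rightarrow> 'a bop \<Rightarrow> 'a bop" is "(+)"
  by (simp add: plus_blinfun.rep_eq scaleC_add_right)
lift_definition uminus_bop :: "'a bop \<Rightarrow> 'a bop" is uminus
  by (simp add: uminus_blinfun.rep_eq linear_neg[OF bounded_linear.linear[OF bounded_linear_scaleC]])
lift_definition minus_bop :: "'a bop \<Rightarrow> 'a bop \<Rightarrow> 'a bop" is "(-)"
  by (simp add: minus_blinfun.rep_eq linear_diff[OF bounded_linear.linear[OF bounded_linear_scaleC]])
lift_definition scaleR_bop :: "real \<Rightarrow> 'a bop \<Rightarrow> 'a bop" is scaleR
  by (simp add: scaleR_blinfun.rep_eq scaleC_real_commute)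
lift_definition scaleC_bop :: "complex \<Rightarrow> 'a bop \<Rightarrow> 'a bop"
  is "\<lambda>c T. Blinfun (\<lambda>x. c *\<^sub>C blinfun_apply T x)"
  by (simp add: bounded_linear_Blinfun_apply scaleC_scaleC mult.commute[of _ "_::complex"]
      bounded_linear_compose[OF bounded_linear_scaleC blinfun.bounded_linear_right])

lemma bapp_scaleC_bop: "bapp (c *\<^sub>C T) x = c *\<^sub>C bapp T (x::'a)"
  by transfer (simp add: bounded_linear_Blinfun_apply
      bounded_linear_compose[OF bounded_linear_scaleC blinfun.bounded_linear_right])

lemma bapp_linear_simps:
  "bapp (S + T) x = bapp S x + bapp T (x::'a)"  "bapp (S - T) x = bapp S x - bapp T x"
  "bapp (- S) x = - bapp S x"  "bapp 0 x = 0"  "bapp (r *\<^sub>R S) x = r *\<^sub>R bapp S x"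
  by (transfer, simp add: blinfun.bilinear_simps)+

instance
  by standard
    (rule bop_eqI, simp add: bapp_linear_simps bapp_scaleC_bop algebra_simps
      scaleC_add_right scaleC_add_left scaleC_scaleC scaleC_of_real)+

end

instantiation bop :: (complex_hilbert) "{monoid_mult, real_normed_algebra}"
begin

lift_definition one_bop :: "'a bop" is id_blinfun by simp
lift_definition times_bop :: "'a bop \<Rightarrow> 'a bop \<Rightarrow> 'a bop" is "(o\<^sub>L)" by simp
lift_definition norm_bop :: "'a bop \<Rightarrow> real" is norm .
definition dist_bop :: "'a bop \<Rightarrow> 'a bop \<Rightarrow> real" where "dist_bop S T = norm (S - T)"
definition sgn_bop :: "'a bop \<Rightarrow> 'a bop" where "sgn_bop T = T /\<^sub>R norm T"
definition [code del]: "(uniformity :: ('a bop \<times> 'a bop) filter)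
  = (INF e\<in>{0 <..}. principal {(S, T). dist S T < e})"
definition open_bop :: "'a bop set \<Rightarrow> bool" where
  "open_bop U \<longleftrightarrow> (\<forall>S\<in>U. \<forall>\<^sub>F (S', T) in uniformity. S' = S \<longrightarrow> T \<in> U)"

lemma bapp_mult: "bapp (S * T) x = bapp S (bapp T (x::'a))"
  by transfer simp

lemma bapp_one: "bapp 1 x = (x::'a)"
  by transfer simp

instance
proof
  fix S T U :: "'a bop" and r :: real
  show "S * T * U = S * (T * U)" "(S + T) * U = S * U + T * U" "S * (T + U) = S * T + S * U"
    "1 * S = S" "S * 1 = S" "r *\<^sub>R S * T = r *\<^sub>R (S * T)" "S * r *\<^sub>R T = r *\<^sub>R (S * T)"
    by (rule bop_eqI, simp add: bapp_mult bapp_one bapp_linear_simps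
        linear_add[OF bounded_linear.linear[OF bounded_linear_bapp]]
        linear_scale[OF bounded_linear.linear[OF bounded_linear_bapp]])+
  show "norm (S * T) \<le> norm S * norm T" by transfer (rule norm_blinfun_compose)
  show "norm S = 0 \<longleftrightarrow> S = 0" by transfer simp
  show "norm (S + T) \<le> norm S + norm T" by transfer (rule norm_triangle_ineq)
  show "norm (r *\<^sub>R S) = \<bar>r\<bar> * norm S" by transfer simp
qed (simp_all add: dist_bop_def sgn_bop_def uniformity_bop_def open_bop_def)

end

text \<open>The exponential is written as a series because \<^const>\<open>exp\<close> requires
  \<^class>\<open>real_normed_algebra_1\<close>, which would exclude the zero Hilbert space.\<close>

definition bexp :: "'a::complex_hilbert bop \<Rightarrow> 'a bop" where
  "bexp T = (\<Sum>n. T ^ n /\<^sub>R fact n)"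

definition commutator :: "'a::complex_hilbert bop \<Rightarrow> 'a bop \<Rightarrow> 'a bop" where
  "commutator S T = S * T - T * S"

definition adj :: "'a::complex_hilbert bop \<Rightarrow> 'a bop" where
  "adj T = (THE S. \<forall>x y. cinner (bapp S x) y = cinner x (bapp T y))"

definition selfadjoint :: "'a::complex_hilbert bop \<Rightarrow> bool" where
  "selfadjoint T \<longleftrightarrow> (\<forall>x y. cinner (bapp T x) y = cinner x (bapp T y))"

definition unitary_op :: "'a::complex_hilbert bop \<Rightarrow> bool" where
  "unitary_op u \<longleftrightarrow> adj u * u = 1 \<and> u * adj u = 1"

definition orth_projector :: "'a::complex_hilbert bop \<Rightarrow> bool" where
  "orth_projector P \<longleftrightarrow> selfadjoint P \<and> P * P = P"

definition positive_op :: "'a::complex_hilbert bop \<Rightarrow> bool" where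
  "positive_op T \<longleftrightarrow> selfadjoint T \<and> (\<forall>x. 0 \<le> Re (cinner x (bapp T x)))"

definition invertible_op :: "'a::complex_hilbert bop \<Rightarrow> bool" where
  "invertible_op T \<longleftrightarrow> (\<exists>S. S * T = 1 \<and> T * S = 1)"

definition inv_op :: "'a::complex_hilbert bop \<Rightarrow> 'a bop" where
  "inv_op T = (THE S. S * T = 1 \<and> T * S = 1)"

definition codiag :: "'a::complex_hilbert bop \<Rightarrow> 'a bop \<Rightarrow> 'a bop" where
  "codiag A y = A * y * (1 - A) + (1 - A) * y * A"

lemma adj_selfadjoint:
  assumes "selfadjoint T" shows "adj T = T"
  unfolding adj_def
proof (rule the_equality)
  fix S assume S: "\<forall>x y. cinner (bapp S x) y = cinner x (bapp T y)"
  show "S = T"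
  proof (rule bop_eqI)
    fix x
    have "cinner (bapp S x) y = cinner (bapp T x) y" for y
      using S assms by (simp add: selfadjoint_def)
    then have "inner (bapp S x) y = inner (bapp T x) y" for y
      by (metis Re_cinner)
    then show "bapp S x = bapp T x" by (metis vector_eq_rdot)
  qed
qed (use assms in \<open>simp add: selfadjoint_def\<close>)


section \<open>Trace and Hilbert-Schmidt operators\<close>

text \<open>For trace class operators, and for the Hilbert-Schmidt condition, the choice of the orthonormal
  basis is irrelevant.\<close>

definition tr :: "'a::complex_hilbert bop \<Rightarrow> complex" where
  "tr T = (\<Sum>\<^sub>\<infinity>e\<in>onb. cinner e (bapp T e))"

definition hilbert_schmidt :: "'a::complex_hilbert bop \<Rightarrow> bool" where
  "hilbert_schmidt T \<longleftrightarrow> (\<lambda>e. (norm (bapp T e))\<^sup>2) summable_on onb"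

lemma hilbert_schmidt_add:
  assumes "hilbert_schmidt S" "hilbert_schmidt T" shows "hilbert_schmidt (S + T)"
  unfolding hilbert_schmidt_def
proof (rule summable_on_comparison_test)
  show "(\<lambda>e. 2 * (norm (bapp S e))\<^sup>2 + 2 * (norm (bapp T e))\<^sup>2) summable_on onb"
    using assms unfolding hilbert_schmidt_def by (intro summable_on_add summable_on_cmult_right)
  fix e :: 'a
  have "(norm (bapp S e + bapp T e))\<^sup>2 \<le> (norm (bapp S e) + norm (bapp T e))\<^sup>2"
    by (intro power_mono norm_triangle_ineq) simp
  also have "\<dots> \<le> 2 * (norm (bapp S e))\<^sup>2 + 2 * (norm (bapp T e))\<^sup>2"
    using sum_squares_bound[of "norm (bapp S e)" "norm (bapp T e)"]
    by (simp add: power2_eq_square algebra_simps)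
  finally show "(norm (bapp (S + T) e))\<^sup>2 \<le> 2 * (norm (bapp S e))\<^sup>2 + 2 * (norm (bapp T e))\<^sup>2"
    by (simp add: bapp_linear_simps)
qed simp

lemma hilbert_schmidt_scaleR:
  assumes "hilbert_schmidt T" shows "hilbert_schmidt (r *\<^sub>R T)"
  using summable_on_cmult_right[OF assms[unfolded hilbert_schmidt_def], of "r\<^sup>2"]
  by (simp add: hilbert_schmidt_def bapp_linear_simps power_mult_distrib)

lemma selfadjoint_add: "selfadjoint S \<Longrightarrow> selfadjoint T \<Longrightarrow> selfadjoint (S + T)"
  by (simp add: selfadjoint_def bapp_linear_simps cinner_add_left cinner_add_right)

lemma selfadjoint_scaleR: "selfadjoint T \<Longrightarrow> selfadjoint (r *\<^sub>R T)"
  by (simp add: selfadjoint_def bapp_linear_simps cinner_scaleR)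

text \<open>The real Hilbert space of self-adjoint Hilbert-Schmidt operators.\<close>

typedef (overloaded) 'a hsh = "{T :: 'a::complex_hilbert bop. selfadjoint T \<and> hilbert_schmidt T}"
  morphisms op_of hsh_of
proof (rule exI[of _ 0])
  have "cinner x (0::'a) = 0" "cinner (0::'a) x = 0" for x :: 'a
    using cinner_add_right[of x 0 0] cinner_add_left[of 0 0 x] by simp_all
  then show "0 \<in> {T::'a bop. selfadjoint T \<and> hilbert_schmidt T}"
    by (simp add: selfadjoint_def hilbert_schmidt_def bapp_linear_simps)
qed

setup_lifting type_definition_hsh

lemma selfadjoint_op_of: "selfadjoint (op_of x)" and hilbert_schmidt_op_of: "hilbert_schmidt (op_of x)"
  using op_of by auto

lemma trace_mult_summable: "(\<lambda>e. cinner e (bapp (op_of x * op_of y) e)) summable_on onb"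
proof (rule abs_summable_summable, rule summable_on_comparison_test)
  show "(\<lambda>e. (norm (bapp (op_of x) e))\<^sup>2 + (norm (bapp (op_of y) e))\<^sup>2) summable_on onb"
    using hilbert_schmidt_op_of unfolding hilbert_schmidt_def by (intro summable_on_add)
  fix e :: 'a
  have "cinner e (bapp (op_of x * op_of y) e) = cinner (bapp (op_of x) e) (bapp (op_of y) e)"
    using selfadjoint_op_of[of x] unfolding selfadjoint_def by (simp add: bapp_mult)
  also have "cmod \<dots> \<le> norm (bapp (op_of x) e) * norm (bapp (op_of y) e)" by (rule norm_cinner_le)
  also have "\<dots> \<le> (norm (bapp (op_of x) e))\<^sup>2 + (norm (bapp (op_of y) e))\<^sup>2"
  proof -
    have "2 * norm (bapp (op_of x) e) * norm (bapp (op_of y) e)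
        \<le> (norm (bapp (op_of x) e))\<^sup>2 + (norm (bapp (op_of y) e))\<^sup>2"
      by (rule sum_squares_bound)
    moreover have "0 \<le> norm (bapp (op_of x) e) * norm (bapp (op_of y) e)" by simp
    ultimately show ?thesis by linarith
  qed
  finally show "norm (cinner e (bapp (op_of x * op_of y) e))
    \<le> (norm (bapp (op_of x) e))\<^sup>2 + (norm (bapp (op_of y) e))\<^sup>2" .
qed simp

lemma Re_tr_mult:
  "Re (tr (op_of x * op_of y)) = (\<Sum>\<^sub>\<infinity>e\<in>onb. inner (bapp (op_of x) e) (bapp (op_of y) e))"
  "(\<lambda>e. inner (bapp (op_of x) e) (bapp (op_of y) e)) summable_on onb"
proof -
  have eq: "Re (cinner e (bapp (op_of x * op_of y) e)) = inner (bapp (op_of x) e) (bapp (op_of y) e)" for e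
    using selfadjoint_op_of[of x] unfolding selfadjoint_def by (metis bapp_mult Re_cinner)
  show "Re (tr (op_of x * op_of y)) = (\<Sum>\<^sub>\<infinity>e\<in>onb. inner (bapp (op_of x) e) (bapp (op_of y) e))"
    by (simp add: tr_def infsum_Re[OF trace_mult_summable, symmetric] eq)
  show "(\<lambda>e. inner (bapp (op_of x) e) (bapp (op_of y) e)) summable_on onb"
    using summable_on_Re[OF trace_mult_summable, of x y] by (simp add: eq)
qed

instantiation hsh :: (complex_hilbert) real_vector
begin

lift_definition zero_hsh :: "'a hsh" is 0
  using op_of[where 'a='a] selfadjoint_scaleR[of _ 0] hilbert_schmidt_scaleR[of _ 0] by fastforce
lift_definition plus_hsh :: "'a hsh \<Rightarrow> 'a hsh \<Rightarrow> 'a hsh" is "(+)"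
  by (simp add: selfadjoint_add hilbert_schmidt_add)
lift_definition uminus_hsh :: "'a hsh \<Rightarrow> 'a hsh" is uminus
  using selfadjoint_scaleR[of _ "-1"] hilbert_schmidt_scaleR[of _ "-1"] by fastforce
lift_definition minus_hsh :: "'a hsh \<Rightarrow> 'a hsh \<Rightarrow> 'a hsh" is "(-)"
proof -
  fix S T :: "'a bop"
  assume "selfadjoint S \<and> hilbert_schmidt S" "selfadjoint T \<and> hilbert_schmidt T"
  then show "selfadjoint (S - T) \<and> hilbert_schmidt (S - T)"
    using selfadjoint_add[of S "(-1) *\<^sub>R T"] hilbert_schmidt_add[of S "(-1) *\<^sub>R T"]
    by (simp add: selfadjoint_scaleR[of T "-1", simplified] hilbert_schmidt_scaleR[of T "-1", simplified])
qed
lift_definition scaleR_hsh :: "real \<Rightarrow> 'a hsh \<Rightarrow> 'a hsh" is scaleR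
  by (simp add: selfadjoint_scaleR hilbert_schmidt_scaleR)

instance
  by standard (transfer, simp add: algebra_simps)+

end

instantiation hsh :: (complex_hilbert) real_inner
begin

definition norm_hsh :: "'a hsh \<Rightarrow> real" where
  "norm_hsh x = 2 * sqrt (Re (tr (adj (op_of x) * op_of x)))"
definition inner_hsh :: "'a hsh \<Rightarrow> 'a hsh \<Rightarrow> real" where
  "inner_hsh x y = 4 * Re (tr (op_of x * op_of y))"
definition dist_hsh :: "'a hsh \<Rightarrow> 'a hsh \<Rightarrow> real" where "dist_hsh x y = norm (x - y)"
definition sgn_hsh :: "'a hsh \<Rightarrow> 'a hsh" where "sgn_hsh x = x /\<^sub>R norm x"
definition [code del]: "(uniformity :: ('a hsh \<times> 'a hsh) filter)
  = (INF e\<in>{0 <..}. principal {(x, y). dist x y < e})"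
definition open_hsh :: "'a hsh set \<Rightarrow> bool" where
  "open_hsh U \<longleftrightarrow> (\<forall>x\<in>U. \<forall>\<^sub>F (x', y) in uniformity. x' = x \<longrightarrow> y \<in> U)"

instance
proof
  fix x y z :: "'a hsh" and r :: real
  show "inner x y = inner y x"
    by (simp add: inner_hsh_def Re_tr_mult(1) inner_commute)
  show "inner (x + y) z = inner x z + inner y z"
    unfolding inner_hsh_def Re_tr_mult(1)
    by (simp add: plus_hsh.rep_eq bapp_linear_simps inner_add_left infsum_add Re_tr_mult(2))
  show "inner (r *\<^sub>R x) y = r * inner x y"
    unfolding inner_hsh_def Re_tr_mult(1)
    by (simp add: scaleR_hsh.rep_eq bapp_linear_simps infsum_cmult_right')
  show pos: "0 \<le> inner x x"
    by (simp add: inner_hsh_def Re_tr_mult(1) infsum_nonneg)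
  show "norm x = sqrt (inner x x)"
    by (simp add: norm_hsh_def inner_hsh_def adj_selfadjoint selfadjoint_op_of real_sqrt_mult)
  show "inner x x = 0 \<longleftrightarrow> x = 0"
  proof
    assume "inner x x = 0"
    then have 0: "(\<Sum>\<^sub>\<infinity>e\<in>onb. inner (bapp (op_of x) e) (bapp (op_of x) e)) = 0"
      by (simp add: inner_hsh_def Re_tr_mult(1))
    have ze: "bapp (op_of x) e = 0" if "e \<in> onb" for e
      using nonneg_infsum_le_0D[OF _ Re_tr_mult(2) _ that, of x x] 0 by simp
    interpret bl: bounded_linear "bapp (op_of x)" by (rule bounded_linear_bapp)
    have "span {c *\<^sub>C e | c e. e \<in> onb} \<subseteq> {v. bapp (op_of x) v = 0}"
    proof (rule span_minimal)
      have "c *\<^sub>C (0::'a) = 0" for c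
        by (rule linear_0[OF bounded_linear.linear[OF bounded_linear_scaleC]])
      then show "{c *\<^sub>C e | c e. e \<in> onb} \<subseteq> {v. bapp (op_of x) v = 0}"
        using ze by (auto simp: bapp_scaleC)
      show "subspace {v. bapp (op_of x) v = 0}"
        by (simp add: subspace_def bl.zero bl.add bl.scale)
    qed
    moreover have "closed {v. bapp (op_of x) v = 0}"
      by (intro closed_Collect_eq continuous_intros linear_continuous_on bounded_linear_bapp)
    ultimately have "closure (span {c *\<^sub>C e | c e. e \<in> onb}) \<subseteq> {v. bapp (op_of x) v = 0}"
      by (rule closure_minimal)
    then have "bapp (op_of x) v = 0" for v
      using is_onb_onb by (auto simp: is_onb_def)
    then have "op_of x = 0" by (intro bop_eqI) (simp add: bapp_linear_simps)
    then show "x = 0" by transfer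
  next
    assume "x = 0"
    then show "inner x x = 0"
      unfolding inner_hsh_def Re_tr_mult(1) by (simp add: zero_hsh.rep_eq bapp_linear_simps)
  qed
qed (simp_all add: dist_hsh_def sgn_hsh_def uniformity_hsh_def open_hsh_def)

end


section \<open>Smooth maps and submanifolds\<close>

definition bounded_multilinear :: "nat \<Rightarrow> ('e::real_normed_vector list \<Rightarrow> 'f::real_normed_vector) \<Rightarrow> bool"
  where "bounded_multilinear k M \<longleftrightarrow>
    (\<forall>vs i. length vs = k \<and> i < k \<longrightarrow> linear (\<lambda>v. M (vs[i := v]))) \<and>
    (\<exists>K. \<forall>vs. length vs = k \<longrightarrow> norm (M vs) \<le> K * prod_list (map norm vs))"

text \<open>Frechet \<open>C\<^sup>\<infinity>\<close> maps between normed spaces.  \<open>D k x\<close> is the \<open>k\<close>-th derivative at \<open>x\<close>, a bounded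
  \<open>k\<close>-linear map whose arguments form a list of length \<open>k\<close>; the last condition says that \<open>D (Suc k) x\<close>
  is the Frechet derivative of \<open>D k\<close> at \<open>x\<close> for the operator norm on \<open>k\<close>-linear maps.\<close>

definition smooth_on :: "'e::real_normed_vector set \<Rightarrow> ('e \<Rightarrow> 'f::real_normed_vector) \<Rightarrow> bool" where
  "smooth_on U f \<longleftrightarrow> open U \<and>
    (\<exists>D :: nat \<Rightarrow> 'e \<Rightarrow> 'e list \<Rightarrow> 'f.
      (\<forall>x\<in>U. D 0 x [] = f x) \<and>
      (\<forall>k. \<forall>x\<in>U. bounded_multilinear k (D k x)) \<and>
      (\<forall>k. \<forall>x\<in>U. \<forall>\<epsilon>>0. \<exists>\<delta>>0. \<forall>h. norm h < \<delta> \<and> x + h \<in> U \<longrightarrow>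
        (\<forall>vs. length vs = k \<longrightarrow>
          norm (D k (x + h) vs - D k x vs - D (Suc k) x (h # vs))
            \<le> \<epsilon> * norm h * prod_list (map norm vs))))"

text \<open>\<open>S\<close> is an embedded submanifold of the open set \<open>M\<close>: near each of its points it is straightened
  to a closed subspace by a diffeomorphism of open sets.  Closed subspaces of a Hilbert space are
  complemented, so no splitting condition is needed there.\<close>

definition embedded_submanifold :: "'e::real_inner set \<Rightarrow> 'e set \<Rightarrow> bool" where
  "embedded_submanifold S M \<longleftrightarrow> open M \<and> S \<subseteq> M \<and>
    (\<forall>x\<in>S. \<exists>U V E \<phi> \<psi>. x \<in> U \<and> U \<subseteq> M \<and> smooth_on U \<phi> \<and> smooth_on V \<psi> \<and>
      \<phi> ` U = V \<and> \<psi> ` V = U \<and> (\<forall>y\<in>U. \<psi> (\<phi> y) = y) \<and> (\<forall>z\<in>V. \<phi> (\<psi> z) = z) \<and>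
      subspace E \<and> closed E \<and> \<phi> ` (U \<inter> S) = V \<inter> (E::'e set))"


section \<open>The manifold of positive invertible operators\<close>

definition Sigma1 :: "'a::complex_hilbert bop set" where
  "Sigma1 = {1 + op_of x | x. positive_op (1 + op_of x) \<and> invertible_op (1 + op_of x)}"

text \<open>The global affine chart \<open>1 + x \<mapsto> x\<close>, through which topology and differentiation on
  the affine space \<open>1 + HS\<^sup>h\<close> are those of \<^typ>\<open>'a hsh\<close>.\<close>

definition coord :: "'a::complex_hilbert bop \<Rightarrow> 'a hsh" where
  "coord p = hsh_of (p - 1)"

text \<open>The trace below is real, since \<open>p\<close>, \<open>X\<close> and \<open>Y\<close> are self-adjoint.\<close>

definition riem_metric :: "'a::complex_hilbert bop \<Rightarrow> 'a hsh \<Rightarrow> 'a hsh \<Rightarrow> real" where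
  "riem_metric p X Y = 4 * Re (tr (inv_op p * op_of X * inv_op p * op_of Y))"

definition tangent_space :: "'a::complex_hilbert bop set \<Rightarrow> 'a bop \<Rightarrow> 'a hsh set" where
  "tangent_space S p = {v. \<exists>\<gamma> \<epsilon>. \<epsilon> > 0 \<and> (\<forall>t\<in>{-\<epsilon><..<\<epsilon>}. \<gamma> t \<in> S) \<and> \<gamma> 0 = p \<and>
    smooth_on {-\<epsilon><..<\<epsilon>} (\<lambda>t::real. coord (\<gamma> t)) \<and>
    ((\<lambda>t. coord (\<gamma> t)) has_vector_derivative v) (at 0)}"

definition tangent_perp :: "'a::complex_hilbert bop set \<Rightarrow> 'a bop \<Rightarrow> 'a hsh set" where
  "tangent_perp S p = {x. \<forall>v\<in>tangent_space S p. riem_metric p x v = 0}"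

text \<open>A submanifold with the induced metric; the last condition says that the latter is positive
  definite and defines the topology of each tangent space (it is symmetric, bilinear and smooth as a
  restriction of the metric of \<open>\<Sigma>\<^sub>1\<close>).\<close>

definition riemannian_submanifold :: "'a::complex_hilbert bop set \<Rightarrow> bool" where
  "riemannian_submanifold S \<longleftrightarrow> S \<subseteq> Sigma1 \<and> embedded_submanifold (coord ` S) (coord ` Sigma1) \<and>
    (\<forall>p\<in>S. subspace (tangent_space S p) \<and> closed (tangent_space S p) \<and>
      (\<exists>c>0. \<exists>C. \<forall>v\<in>tangent_space S p.
        c * (norm v)\<^sup>2 \<le> riem_metric p v v \<and> riem_metric p v v \<le> C * (norm v)\<^sup>2))"

text \<open>Velocity of a curve with parameter interval \<open>[0,1]\<close> (one-sided at the end points).\<close>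

definition velocity :: "(real \<Rightarrow> 'a::complex_hilbert bop) \<Rightarrow> real \<Rightarrow> 'a hsh" where
  "velocity \<gamma> t = vector_derivative (\<lambda>s. coord (\<gamma> s)) (at t within {0..1})"

definition C1_curve :: "'a::complex_hilbert bop set \<Rightarrow> (real \<Rightarrow> 'a bop) \<Rightarrow> bool" where
  "C1_curve S \<gamma> \<longleftrightarrow> (\<forall>t\<in>{0..1}. \<gamma> t \<in> S) \<and>
    (\<forall>t\<in>{0..1}. (\<lambda>s. coord (\<gamma> s)) differentiable (at t within {0..1})) \<and>
    continuous_on {0..1} (velocity \<gamma>)"

definition curve_length :: "(real \<Rightarrow> 'a::complex_hilbert bop) \<Rightarrow> real" where
  "curve_length \<gamma> = integral {0..1} (\<lambda>t. sqrt (riem_metric (\<gamma> t) (velocity \<gamma> t) (velocity \<gamma> t)))"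

text \<open>Velocities of the curves below may vanish, so admitting piecewise \<open>C\<^sup>1\<close> curves would give the
  same infimum.\<close>

definition geod_dist :: "'a::complex_hilbert bop set \<Rightarrow> 'a bop \<Rightarrow> 'a bop \<Rightarrow> ereal" where
  "geod_dist S p q = Inf {ereal (curve_length \<gamma>) | \<gamma>. C1_curve S \<gamma> \<and> \<gamma> 0 = p \<and> \<gamma> 1 = q}"

text \<open>The covariant derivative \<open>Z - X p\<^sup>-\<^sup>1 X\<close> along a curve with position \<open>p\<close>, velocity \<open>X\<close> and second
  derivative \<open>Z\<close>.\<close>

definition cov_deriv :: "'a::complex_hilbert bop \<Rightarrow> 'a hsh \<Rightarrow> 'a hsh \<Rightarrow> 'a hsh" where
  "cov_deriv p X Z = hsh_of (op_of Z - op_of X * inv_op p * op_of X)"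

definition geodesic :: "'a::complex_hilbert bop set \<Rightarrow> (real \<Rightarrow> 'a bop) \<Rightarrow> bool" where
  "geodesic S \<gamma> \<longleftrightarrow> C1_curve S \<gamma> \<and>
    (\<exists>acc. continuous_on {0..1} acc \<and>
      (\<forall>t\<in>{0..1}. (velocity \<gamma> has_vector_derivative acc t) (at t within {0..1}) \<and>
        cov_deriv (\<gamma> t) (velocity \<gamma> t) (acc t) \<in> tangent_perp S (\<gamma> t)))"

text \<open>\<open>exp\<^sub>p v = \<gamma> 1\<close>, where \<open>\<gamma>\<close> is the geodesic starting at \<open>p\<close> with velocity \<open>v\<close>.\<close>

definition exp_domain :: "'a::complex_hilbert bop set \<Rightarrow> 'a bop \<Rightarrow> 'a hsh set" where
  "exp_domain S p = {v \<in> tangent_space S p. \<exists>\<gamma>. geodesic S \<gamma> \<and> \<gamma> 0 = p \<and> velocity \<gamma> 0 = v}"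

definition exp_map :: "'a::complex_hilbert bop set \<Rightarrow> 'a bop \<Rightarrow> 'a hsh \<Rightarrow> 'a bop" where
  "exp_map S p v = (THE q. \<exists>\<gamma>. geodesic S \<gamma> \<and> \<gamma> 0 = p \<and> velocity \<gamma> 0 = v \<and> \<gamma> 1 = q)"

definition unitary_orbit :: "'a::complex_hilbert bop \<Rightarrow> 'a bop set" where
  "unitary_orbit T = {u * T * adj u | u. unitary_op u}"

end

theory Submission
  imports Defs
begin

text \<open>The orbit is \<open>1 + P\<close> for the projections \<open>P = u A u\<^sup>*\<close>, which are Hilbert-Schmidt because \<open>A\<close> is.
  Tangent vectors at \<open>P\<close> are the \<open>V\<close> with \<open>P V + V P = V\<close>; there \<open>(1 + P)\<^sup>-\<^sup>1 V (1 + P)\<^sup>-\<^sup>1 = V / 2\<close>, so the metric is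
  half of the inner product and the normal vectors are those that commute with \<open>P\<close>.  The geodesic
  equation says that \<open>P''\<close> is diagonal with respect to \<open>P\<close> up to \<open>P' (1 + P)\<^sup>-\<^sup>1 P'\<close>, which is diagonal
  itself; hence \<open>[P', P]\<close> is constant and the geodesics are the conjugates of \<open>P\<close> by one-parameter groups.
  Any two points of the orbit are joined by one, since two projections of the same finite rank
  are rotated into each other through their principal angles.  Charts of the orbit come from the
  block (Schur) decomposition with respect to \<open>P\<close>, which is rational.\<close>

section \<open>Algebra and completeness of the bounded operators\<close>

text \<open>Two norms shape the proof. The manifold lives in the Hilbert-Schmidt space, while
  inverses and exponentials exist only among the bounded operators and are smooth for the operator
  norm. The bridge is that the charts and curves are sums of products with a Hilbert-Schmidt factor
  in the middle, apart from terms that are affine in the point. Smoothness then needs only the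
  Leibniz rule and inversion of affine expressions. The inverse chart calls for the inverse of a
  quadratic expression, which is read off as a corner of the inverse of an affine block matrix. The
  exponential map is a definite description, so its value requires uniqueness of geodesics; the
  conserved commutator replaces the existence and uniqueness theory of differential equations.
  Finite rank enters without dimension theory: \<open>hs2\<close> of a projection drops by exactly 1
  when a unit vector of its range is split off. This drives the inductions behind compactness and
  principal angles, and continuity of the norm keeps the rank constant among nearby
  projections.\<close>

instance complex_hilbert \<subseteq> banach ..

section \<open>Rules for the complex inner product and for complex scalars\<close>

lemma cinner_diff_right: "cinner x (y - z) = cinner x y - cinner x (z::'a::complex_hilbert)"
  by (metis cinner_add_right add_diff_cancel_right' diff_add_cancel)

lemma cinner_diff_left: "cinner (x - y) z = cinner x z - cinner y (z::'a::complex_hilbert)"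
  by (metis cinner_add_left add_diff_cancel_right' diff_add_cancel)

lemma cinner_zero [simp]: "cinner x 0 = 0" "cinner 0 (x::'a::complex_hilbert) = 0"
  using cinner_diff_right[of x 0 0] cinner_diff_left[of 0 0 x] by simp_all

lemma cinner_minus_right: "cinner x (- y) = - cinner x (y::'a::complex_hilbert)"
  using cinner_diff_right[of x 0 y] by simp

lemma cinner_minus_left: "cinner (- x) y = - cinner x (y::'a::complex_hilbert)"
  using cinner_diff_left[of 0 x y] by simp

lemma cinner_self: "cinner x x = complex_of_real ((norm x)\<^sup>2)" for x :: "'a::complex_hilbert"
proof (rule complex_eqI)
  show "Im (cinner x x) = Im (complex_of_real ((norm x)\<^sup>2))"
    using arg_cong[OF cinner_commute[of x x], of Im] by simp
qed (simp add: Re_cinner power2_norm_eq_inner)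

lemma cinner_eqI:
  assumes "\<And>y. cinner x y = cinner x' y" shows "x = (x'::'a::complex_hilbert)"
proof -
  have "inner x y = inner x' y" for y using assms[of y] by (simp add: Re_cinner[symmetric])
  then show ?thesis using vector_eq_rdot by blast
qed

lemma Im_cinner: "Im (cinner x y) = - inner x (\<i> *\<^sub>C (y::'a::complex_hilbert))"
  by (simp add: Re_cinner[symmetric] cinner_scaleC_right)

lemma scaleC_simps [simp]:
  fixes x :: "'a::complex_hilbert"
  shows "1 *\<^sub>C x = x" "0 *\<^sub>C x = 0" "c *\<^sub>C (0::'a) = 0" "(- c) *\<^sub>C x = - (c *\<^sub>C x)" "c *\<^sub>C (- x) = - (c *\<^sub>C x)"
proof -
  interpret L: bounded_linear "\<lambda>x::'a. c *\<^sub>C x" by (rule bounded_linear_scaleC)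
  show "1 *\<^sub>C x = x" "0 *\<^sub>C x = 0" using scaleC_of_real[of 1 x] scaleC_of_real[of 0 x] by simp_all
  then show "(- c) *\<^sub>C x = - (c *\<^sub>C x)"
    using scaleC_add_left[of c "-c" x] by (simp add: eq_neg_iff_add_eq_0 add.commute)
  show "c *\<^sub>C (0::'a) = 0" "c *\<^sub>C (- x) = - (c *\<^sub>C x)" by (rule L.zero L.neg)+
qed

lemma scaleC_diff_right: "c *\<^sub>C (x - y) = c *\<^sub>C x - c *\<^sub>C (y::'a::complex_hilbert)"
  by (rule linear_diff[OF bounded_linear.linear[OF bounded_linear_scaleC]])

lemma norm_scaleC [simp]: "norm (c *\<^sub>C x) = cmod c * norm (x::'a::complex_hilbert)"
proof -
  have "complex_of_real ((norm (c *\<^sub>C x))\<^sup>2) = (cnj c * c) * cinner x x"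
    by (simp only: cinner_self[symmetric] cinner_scaleC_left cinner_scaleC_right mult.assoc mult.left_commute)
  also have "\<dots> = complex_of_real ((cmod c * norm x)\<^sup>2)"
    by (simp add: cinner_self complex_norm_square[symmetric] power_mult_distrib mult.commute)
  finally show ?thesis by (simp only: of_real_eq_iff power2_eq_iff_nonneg norm_ge_zero zero_le_mult_iff) simp
qed

lemma bapp_vec_simps:
  "bapp T (x + y) = bapp T x + bapp T y" "bapp T (x - y) = bapp T x - bapp T y"
  "bapp T (- x) = - bapp T x" "bapp T 0 = 0" "bapp T (r *\<^sub>R x) = r *\<^sub>R bapp T x"
proof -
  interpret bounded_linear "bapp T" by (rule bounded_linear_bapp)
  show "bapp T (x + y) = bapp T x + bapp T y" "bapp T (x - y) = bapp T x - bapp T y"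
    "bapp T (- x) = - bapp T x" "bapp T 0 = 0" "bapp T (r *\<^sub>R x) = r *\<^sub>R bapp T x"
    by (rule add diff neg zero scale)+
qed

lemma norm_bapp: "norm (bapp T x) \<le> norm T * norm x"
  by transfer (rule norm_blinfun)

lemma norm_bop_le: "0 \<le> K \<Longrightarrow> (\<And>x. norm (bapp T x) \<le> K * norm x) \<Longrightarrow> norm T \<le> K"
  by transfer (rule norm_blinfun_bound)

lemma bop_scaleC_simps [simp]:
  fixes S T :: "'a::complex_hilbert bop"
  shows "(c *\<^sub>C S) * T = c *\<^sub>C (S * T)" "S * (c *\<^sub>C T) = c *\<^sub>C (S * T)"
    "1 *\<^sub>C S = S" "0 *\<^sub>C S = 0" "c *\<^sub>C (0::'a bop) = 0" "(- c) *\<^sub>C S = - (c *\<^sub>C S)" "c *\<^sub>C (- S) = - (c *\<^sub>C S)"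
  by (rule bop_eqI, simp add: bapp_mult bapp_scaleC_bop bapp_scaleC bapp_linear_simps)+

lemma bop_scaleC_diff: "c *\<^sub>C (S - T) = c *\<^sub>C S - c *\<^sub>C (T::'a::complex_hilbert bop)"
  by (rule bop_eqI) (simp add: bapp_scaleC_bop bapp_linear_simps scaleC_diff_right)

lemma norm_one_bop_le: "norm (1 :: 'a::complex_hilbert bop) \<le> 1"
  by (rule norm_bop_le) (auto simp: bapp_one)

lemma bop_of_linear:
  fixes f :: "'a::complex_hilbert \<Rightarrow> 'a"
  assumes "\<And>x y. f (x + y) = f x + f y" "\<And>c x. f (c *\<^sub>C x) = c *\<^sub>C f x" "\<And>x. norm (f x) \<le> K * norm x"
  shows "\<exists>T. \<forall>x. bapp T x = f x"
proof -
  have "bounded_linear f"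
  proof (rule bounded_linear_intro[where K=K])
    show "f (r *\<^sub>R x) = r *\<^sub>R f x" for r x
      using assms(2)[of "complex_of_real r" x] by (simp only: scaleC_of_real)
    show "norm (f x) \<le> norm x * K" for x using assms(3)[of x] by (simp only: mult.commute)
  qed (rule assms(1))
  then have "bapp (Bop (Blinfun f)) x = f x" for x
    unfolding bapp.rep_eq
    by (subst Bop_inverse) (simp_all only: mem_Collect_eq bounded_linear_Blinfun_apply assms(2) simp_thms)
  then show ?thesis by blast
qed

text \<open>The limit exists among the real-linear operators, and complex linearity survives
  pointwise limits.\<close>

instance bop :: (complex_hilbert) banach
proof
  fix X :: "nat \<Rightarrow> 'a bop" assume X: "Cauchy X"
  have nd: "dist (blinfun_of_bop S) (blinfun_of_bop T) = dist S T" for S T :: "'a bop"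
    by (simp add: dist_norm norm_bop.rep_eq minus_bop.rep_eq)
  have "Cauchy (\<lambda>n. blinfun_of_bop (X n))" using X by (simp add: Cauchy_def nd)
  then obtain L where L: "(\<lambda>n. blinfun_of_bop (X n)) \<longlonglongrightarrow> L" using Cauchy_convergent convergent_def by blast
  have ap: "(\<lambda>n. bapp (X n) x) \<longlonglongrightarrow> blinfun_apply L x" for x
    unfolding bapp.rep_eq by (intro blinfun.tendsto L tendsto_const)
  have "blinfun_apply L (c *\<^sub>C x) = c *\<^sub>C blinfun_apply L x" for c x
  proof (rule LIMSEQ_unique)
    show "(\<lambda>n. bapp (X n) (c *\<^sub>C x)) \<longlonglongrightarrow> blinfun_apply L (c *\<^sub>C x)" by (rule ap)
    show "(\<lambda>n. bapp (X n) (c *\<^sub>C x)) \<longlonglongrightarrow> c *\<^sub>C blinfun_apply L x"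
      unfolding bapp_scaleC by (intro bounded_linear.tendsto[OF bounded_linear_scaleC] ap)
  qed
  then have inv: "blinfun_of_bop (Bop L) = L" by (simp add: Bop_inverse)
  have "X \<longlonglongrightarrow> Bop L"
    using L unfolding tendsto_dist_iff[of _ L] tendsto_dist_iff[of _ "Bop L"] nd[symmetric] inv .
  then show "convergent X" by (auto simp: convergent_def)
qed

lemma bounded_bilinear_bapp: "bounded_bilinear (bapp :: 'a::complex_hilbert bop \<Rightarrow> 'a \<Rightarrow> 'a)"
proof
  show "\<exists>K. \<forall>T x. norm (bapp (T::'a bop) x) \<le> norm T * norm x * K"
    using norm_bapp by (intro exI[of _ 1]) auto
qed (simp_all add: bapp_linear_simps bapp_vec_simps)

subsection \<open>Adjoints\<close>

text \<open>The kernel is a closed hyperplane; a nonzero vector orthogonal to it represents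
  \<open>f\<close> up to a scalar.\<close>

lemma riesz:
  fixes f :: "'a::complex_hilbert \<Rightarrow> real"
  assumes "bounded_linear f"
  obtains z where "\<And>y. f y = inner z y"
proof (cases "\<forall>y. f y = 0")
  case True
  then show ?thesis using that[of 0] by simp
next
  case False
  interpret f: bounded_linear f by fact
  obtain v where v: "f v \<noteq> 0" using False by blast
  have "subspace {y. f y = 0}" by (simp add: subspace_def f.zero f.add f.scale)
  moreover have "closed {y. f y = 0}"
    by (intro closed_Collect_eq continuous_intros linear_continuous_on assms)
  ultimately obtain w where w: "w \<noteq> 0" "\<And>m. f m = 0 \<Longrightarrow> inner m w = 0"
    using orthogonal_vector_exists[of "{y. f y = 0}" v] v by auto
  have fw: "f w \<noteq> 0" using w(2)[of w] w(1) by auto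
  have "f y = inner ((f w / inner w w) *\<^sub>R w) y" for y
  proof -
    have "f (y - (f y / f w) *\<^sub>R w) = 0" using fw by (simp add: f.diff f.scale)
    from w(2)[OF this] have "inner y w = (f y / f w) * inner w w" by (simp add: inner_diff_left)
    then show ?thesis using w(1) fw by (simp add: inner_commute field_simps)
  qed
  then show ?thesis using that by blast
qed

text \<open>\<open>adj\<close> is a definite description, so a witness must be built. The real Riesz
  theorem yields the vector, and testing with \<open>\<i> *\<^sub>C y\<close> upgrades the identity
  to the complex inner product.\<close>

lemma cinner_adj: "cinner (bapp (adj T) x) y = cinner x (bapp T (y::'a::complex_hilbert))"
proof -
  have "\<exists>z. \<forall>y. cinner z y = cinner x (bapp T y)" for x
  proof -
    have "bounded_linear (\<lambda>y. inner x (bapp T y))"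
      by (intro bounded_linear_compose[OF bounded_linear_inner_right bounded_linear_bapp])
    then obtain z where z: "\<And>y. inner x (bapp T y) = inner z y" using riesz by blast
    have "cinner z y = cinner x (bapp T y)" for y
      by (rule complex_eqI) (simp_all add: Re_cinner Im_cinner z[symmetric] bapp_scaleC)
    then show ?thesis by blast
  qed
  then obtain f where f: "\<And>x y. cinner (f x) y = cinner x (bapp T y)" by metis
  have "norm (f x) \<le> norm T * norm x" for x
  proof (cases "f x = 0")
    case False
    have "(norm (f x))\<^sup>2 = cmod (cinner (f x) (f x))" by (simp add: cinner_self norm_power)
    also have "\<dots> \<le> norm x * norm (bapp T (f x))" by (simp add: f norm_cinner_le)
    also have "\<dots> \<le> norm x * (norm T * norm (f x))" by (intro mult_left_mono norm_bapp) simp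
    finally show ?thesis using False by (simp add: power2_eq_square mult_ac)
  qed simp
  moreover have "f (x + y) = f x + f y" "f (c *\<^sub>C x) = c *\<^sub>C f x" for x y c
    by (rule cinner_eqI, simp add: f cinner_add_left cinner_scaleC_left)+
  ultimately obtain S where S: "\<And>x. bapp S x = f x" using bop_of_linear[of f] by metis
  have "adj T = S"
    unfolding adj_def
  proof (rule the_equality)
    fix S' assume "\<forall>x y. cinner (bapp S' x) y = cinner x (bapp T y)"
    then show "S' = S" by (intro bop_eqI cinner_eqI) (simp add: S f)
  qed (simp add: S f)
  then show ?thesis by (simp add: S f)
qed

lemma cinner_adj': "cinner x (bapp (adj T) y) = cinner (bapp T x) (y::'a::complex_hilbert)"
  by (metis cinner_adj cinner_commute)

lemma adj_eqI: "(\<And>x y. cinner (bapp S x) y = cinner x (bapp T y)) \<Longrightarrow> adj T = S"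
  by (intro bop_eqI cinner_eqI) (simp add: cinner_adj)

lemma adj_simps [simp]:
  fixes S T :: "'a::complex_hilbert bop"
  shows "adj (adj S) = S" "adj (S * T) = adj T * adj S" "adj (S + T) = adj S + adj T"
    "adj (S - T) = adj S - adj T" "adj (- S) = - adj S" "adj (c *\<^sub>C S) = cnj c *\<^sub>C adj S"
    "adj (r *\<^sub>R S) = r *\<^sub>R adj S" "adj (1::'a bop) = 1" "adj (0::'a bop) = 0"
  by (rule adj_eqI, simp add: bapp_mult bapp_one bapp_linear_simps bapp_scaleC_bop cinner_adj cinner_adj'
      cinner_add_left cinner_add_right cinner_diff_left cinner_diff_right cinner_minus_left
      cinner_minus_right cinner_scaleC_left cinner_scaleC_right cinner_scaleR)+

lemma norm_adj [simp]: "norm (adj T) = norm (T :: 'a::complex_hilbert bop)"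
proof -
  have "norm (adj T) \<le> norm T" for T :: "'a bop"
  proof (rule norm_bop_le)
    fix x
    show "norm (bapp (adj T) x) \<le> norm T * norm x"
    proof (cases "bapp (adj T) x = 0")
      case False
      have "(norm (bapp (adj T) x))\<^sup>2 = cmod (cinner (bapp (adj T) x) (bapp (adj T) x))" by (simp add: cinner_self norm_power)
      also have "\<dots> \<le> norm x * norm (bapp T (bapp (adj T) x))" by (simp only: cinner_adj norm_cinner_le)
      also have "\<dots> \<le> norm x * (norm T * norm (bapp (adj T) x))" by (intro mult_left_mono norm_bapp) simp
      finally show ?thesis using False by (simp add: power2_eq_square mult_ac)
    qed simp
  qed simp
  from this[of T] this[of "adj T"] show ?thesis by simp
qed

lemma bounded_linear_adj: "bounded_linear (adj :: 'a::complex_hilbert bop \<Rightarrow> 'a bop)"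
  by (rule bounded_linear_intro[where K=1]) auto

lemma selfadjoint_iff: "selfadjoint T \<longleftrightarrow> adj T = T"
  using adj_selfadjoint[of T] cinner_adj[of T] by (auto simp: selfadjoint_def)

lemma orth_projector_iff: "orth_projector P \<longleftrightarrow> adj P = P \<and> P * P = P"
  by (simp add: orth_projector_def selfadjoint_iff)

lemma adj_op_of [simp]: "adj (op_of x) = op_of x"
  using selfadjoint_op_of selfadjoint_iff by blast

section \<open>Unitary and invertible operators\<close>

lemma unitary_op_simps:
  assumes "unitary_op u"
  shows "adj u * u = 1" "u * adj u = 1" "adj u * (u * T) = T" "u * (adj u * T) = T"
  using assms by (simp_all add: unitary_op_def mult.assoc[symmetric])

lemma unitary_op_mult: "unitary_op u \<Longrightarrow> unitary_op w \<Longrightarrow> unitary_op (u * w)"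
  by (subst unitary_op_def) (simp add: unitary_op_simps mult.assoc)

lemma unitary_op_adj: "unitary_op u \<Longrightarrow> unitary_op (adj u)"
  by (simp add: unitary_op_def)

lemma inv_op_eqI:
  assumes "S * T = 1" "T * S = 1" shows "inv_op T = S"
  unfolding inv_op_def
proof (rule the_equality)
  fix S' assume S': "S' * T = 1 \<and> T * S' = 1"
  have "S' = S' * (T * S)" using assms by simp
  also have "\<dots> = (S' * T) * S" by (simp only: mult.assoc)
  finally show "S' = S" using S' by simp
qed (use assms in simp)

lemma inv_op_simps:
  assumes "invertible_op T"
  shows "inv_op T * T = 1" "T * inv_op T = 1" "inv_op T * (T * S) = S" "T * (inv_op T * S) = S"
proof -
  obtain R where R: "R * T = 1" "T * R = 1" using assms by (auto simp: invertible_op_def)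
  then have "inv_op T = R" by (rule inv_op_eqI)
  with R show *: "inv_op T * T = 1" "T * inv_op T = 1" by simp_all
  show "inv_op T * (T * S) = S" "T * (inv_op T * S) = S"
    by (simp_all add: mult.assoc[symmetric] *)
qed

section \<open>Hilbert-Schmidt operators\<close>

subsection \<open>Parseval's identity\<close>

lemma cinner_sum_right: "cinner x (\<Sum>i\<in>I. f i) = (\<Sum>i\<in>I. cinner x (f i :: 'a::complex_hilbert))"
  by (induct I rule: infinite_finite_induct) (simp_all add: cinner_add_right)

text \<open>Pythagoras for the orthogonal projection of \<open>x\<close> onto the complex span of
  \<open>F\<close>.\<close>

lemma bessel_identity:
  fixes x :: "'a::complex_hilbert"
  assumes "orthonormal E" "finite F" "F \<subseteq> E"
  shows "(norm x)\<^sup>2 = (\<Sum>e\<in>F. (cmod (cinner e x))\<^sup>2) + (norm (x - (\<Sum>e\<in>F. cinner e x *\<^sub>C e)))\<^sup>2"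
proof -
  define y where "y = (\<Sum>e\<in>F. cinner e x *\<^sub>C e)"
  have ey: "cinner e y = cinner e x" if "e \<in> F" for e
  proof -
    have "cinner e y = (\<Sum>f\<in>F. if f = e then cinner e x else 0)"
      unfolding y_def cinner_sum_right cinner_scaleC_right using assms that
      by (intro sum.cong refl) (auto simp: orthonormal_def subset_iff)
    then show ?thesis using assms that by simp
  qed
  have "cinner y y = (\<Sum>e\<in>F. cinner e x * cinner y e)"
    by (subst (2) y_def) (simp add: cinner_sum_right cinner_scaleC_right)
  also have "\<dots> = (\<Sum>e\<in>F. complex_of_real ((cmod (cinner e x))\<^sup>2))"
  proof (intro sum.cong refl)
    fix e assume "e \<in> F"
    then show "cinner e x * cinner y e = complex_of_real ((cmod (cinner e x))\<^sup>2)"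
      using ey[of e] cinner_commute[of y e] by (simp add: complex_norm_square del: of_real_power)
  qed
  finally have yy: "(norm y)\<^sup>2 = (\<Sum>e\<in>F. (cmod (cinner e x))\<^sup>2)"
    unfolding cinner_self by (simp only: of_real_sum[symmetric] of_real_eq_iff)
  have "cinner (x - y) y = (\<Sum>e\<in>F. cinner e x * cinner (x - y) e)"
    by (subst (2) y_def) (simp add: cinner_sum_right cinner_scaleC_right)
  also have "\<dots> = 0"
  proof (intro sum.neutral ballI)
    fix e assume "e \<in> F"
    then show "cinner e x * cinner (x - y) e = 0"
      using ey[of e] cinner_commute[of "x - y" e] by (simp add: cinner_diff_right)
  qed
  finally have "inner (x - y) y = 0" by (simp add: Re_cinner[symmetric])
  then have "(norm x)\<^sup>2 = (norm y)\<^sup>2 + (norm (x - y))\<^sup>2"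
    by (simp add: power2_norm_eq_inner inner_diff_left inner_diff_right inner_commute)
  then have "(norm x)\<^sup>2 = (\<Sum>e\<in>F. (cmod (cinner e x))\<^sup>2) + (norm (x - y))\<^sup>2" by (simp only: yy)
  then show ?thesis by (simp only: y_def)
qed

lemma parseval:
  fixes x :: "'a::complex_hilbert"
  assumes "is_onb E"
  shows "((\<lambda>e. (cmod (cinner e x))\<^sup>2) has_sum (norm x)\<^sup>2) E"
proof -
  have on: "orthonormal E" and dense: "closure (span {c *\<^sub>C e | c e. e \<in> E}) = UNIV"
    using assms by (auto simp: is_onb_def)
  define pr where "pr F z = (\<Sum>e\<in>F. cinner e z *\<^sub>C e)" for F and z :: 'a
  have pr_add: "pr F (y + z) = pr F y + pr F z" for F y z
    by (simp add: pr_def cinner_add_right scaleC_add_left sum.distrib)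
  have pr_scale: "pr F (r *\<^sub>R z) = r *\<^sub>R pr F z" for F r z
    unfolding pr_def cinner_scaleR scaleC_scaleC[symmetric] scaleC_of_real scaleR_sum_right ..
  have pr_diff: "pr F (y - z) = pr F y - pr F z" for F y z
    using pr_add[of F "y - z" z] by (simp add: algebra_simps)
  \<comment> \<open>Quantifying over all larger \<open>G\<close> lets two witnesses be merged into
    their union, which makes \<open>M\<close> a subspace.\<close>
  define M where "M = {y. \<exists>F. finite F \<and> F \<subseteq> E \<and> (\<forall>G. finite G \<longrightarrow> F \<subseteq> G \<longrightarrow> G \<subseteq> E \<longrightarrow> pr G y = y)}"
  have "span {c *\<^sub>C e | c e. e \<in> E} \<subseteq> M"
  proof (rule span_minimal)
    show "{c *\<^sub>C e | c e. e \<in> E} \<subseteq> M"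
    proof clarify
      fix c e assume e: "e \<in> E"
      have "pr G (c *\<^sub>C e) = c *\<^sub>C e" if "finite G" "{e} \<subseteq> G" "G \<subseteq> E" for G
      proof -
        have "pr G (c *\<^sub>C e) = (\<Sum>f\<in>G. if f = e then c *\<^sub>C e else 0)"
          unfolding pr_def cinner_scaleC_right using on e that
          by (intro sum.cong refl) (auto simp: orthonormal_def subset_iff)
        then show ?thesis using that by simp
      qed
      then show "c *\<^sub>C e \<in> M" unfolding M_def using e by (intro CollectI exI[of _ "{e}"]) auto
    qed
    show "subspace M"
    proof (rule subspaceI)
      show "0 \<in> M" by (auto simp: M_def pr_def intro!: exI[of _ "{}"])
      fix y z assume "y \<in> M" "z \<in> M"
      then obtain F F' where "finite F" "F \<subseteq> E" "\<forall>G. finite G \<longrightarrow> F \<subseteq> G \<longrightarrow> G \<subseteq> E \<longrightarrow> pr G y = y"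
        "finite F'" "F' \<subseteq> E" "\<forall>G. finite G \<longrightarrow> F' \<subseteq> G \<longrightarrow> G \<subseteq> E \<longrightarrow> pr G z = z"
        by (auto simp: M_def)
      then show "y + z \<in> M" unfolding M_def
        by (intro CollectI exI[of _ "F \<union> F'"] conjI allI impI) (simp_all add: pr_add)
    next
      fix r y assume "y \<in> M"
      then obtain F where "finite F" "F \<subseteq> E" "\<forall>G. finite G \<longrightarrow> F \<subseteq> G \<longrightarrow> G \<subseteq> E \<longrightarrow> pr G y = y"
        by (auto simp: M_def)
      then show "r *\<^sub>R y \<in> M" unfolding M_def
        by (intro CollectI exI[of _ F] conjI allI impI) (simp_all only: pr_scale)
    qed
  qed
  have bess: "(\<Sum>e\<in>F. (cmod (cinner e z))\<^sup>2) \<le> (norm z)\<^sup>2" "(norm (z - pr F z))\<^sup>2 \<le> (norm z)\<^sup>2"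
    if "finite F" "F \<subseteq> E" for F z
  proof -
    have "0 \<le> (\<Sum>e\<in>F. (cmod (cinner e z))\<^sup>2)" by (simp add: sum_nonneg)
    moreover have "0 \<le> (norm (z - pr F z))\<^sup>2" by simp
    ultimately show "(\<Sum>e\<in>F. (cmod (cinner e z))\<^sup>2) \<le> (norm z)\<^sup>2" "(norm (z - pr F z))\<^sup>2 \<le> (norm z)\<^sup>2"
      using bessel_identity[OF on that, of z] unfolding pr_def by linarith+
  qed
  have sm: "(\<lambda>e. (cmod (cinner e x))\<^sup>2) summable_on E"
    by (rule nonneg_bdd_above_summable_on) (auto intro!: bdd_aboveI2[of _ _ "(norm x)\<^sup>2"] bess)
  have "infsum (\<lambda>e. (cmod (cinner e x))\<^sup>2) E = (norm x)\<^sup>2"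
  proof (rule antisym)
    show "infsum (\<lambda>e. (cmod (cinner e x))\<^sup>2) E \<le> (norm x)\<^sup>2"
      by (rule infsum_le_finite_sums[OF sm]) (rule bess)
    show "(norm x)\<^sup>2 \<le> infsum (\<lambda>e. (cmod (cinner e x))\<^sup>2) E"
    proof (rule field_le_epsilon)
      fix \<epsilon> :: real assume "\<epsilon> > 0"
      have "x \<in> closure (span {c *\<^sub>C e | c e. e \<in> E})" unfolding dense ..
      from closure_approachableD[OF this, of "sqrt \<epsilon>"] \<open>\<epsilon> > 0\<close>
      obtain y where "y \<in> span {c *\<^sub>C e | c e. e \<in> E}" and y: "dist y x < sqrt \<epsilon>"
        by (auto simp: dist_commute)
      then have "y \<in> M" using \<open>span _ \<subseteq> M\<close> by blast
      then obtain F where F: "finite F" "F \<subseteq> E" "pr F y = y" by (auto simp: M_def)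
      \<comment> \<open>Since \<open>pr F\<close> fixes \<open>y\<close>, the error at
        \<open>x\<close> is the error at \<open>x - y\<close>, which is at most the distance from
        \<open>x\<close> to \<open>y\<close>.\<close>
      have "(norm (x - pr F x))\<^sup>2 = (norm ((x - y) - pr F (x - y)))\<^sup>2"
        by (simp add: pr_diff F)
      also have "\<dots> \<le> (norm (x - y))\<^sup>2" using bess F by blast
      also have "\<dots> \<le> (sqrt \<epsilon>)\<^sup>2" using y by (intro power_mono) (auto simp: dist_norm norm_minus_commute)
      finally have "(norm (x - pr F x))\<^sup>2 \<le> \<epsilon>" using \<open>\<epsilon> > 0\<close> by simp
      moreover have "(\<Sum>e\<in>F. (cmod (cinner e x))\<^sup>2) \<le> infsum (\<lambda>e. (cmod (cinner e x))\<^sup>2) E"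
        by (rule finite_sum_le_infsum[OF sm]) (use F in auto)
      ultimately show "(norm x)\<^sup>2 \<le> infsum (\<lambda>e. (cmod (cinner e x))\<^sup>2) E + \<epsilon>"
        using bessel_identity[OF on F(1,2), of x] by (simp add: pr_def)
    qed
  qed
  then show ?thesis using has_sum_infsum[OF sm] by simp
qed

lemma parseval':
  "((\<lambda>e. (cmod (cinner x e))\<^sup>2) has_sum (norm x)\<^sup>2) (onb :: 'a::complex_hilbert set)"
proof -
  have "cmod (cinner x e) = cmod (cinner e x)" for e :: 'a
    using cinner_commute[of x e] by simp
  then show ?thesis using parseval[OF is_onb_onb, of x] by simp
qed

subsection \<open>The Hilbert-Schmidt norm\<close>

definition hs2 :: "'a::complex_hilbert bop \<Rightarrow> real" where
  "hs2 T = (\<Sum>\<^sub>\<infinity>e\<in>onb. (norm (bapp T e))\<^sup>2)"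

lemma has_sum_hs2: "hilbert_schmidt T \<Longrightarrow> ((\<lambda>e. (norm (bapp T e))\<^sup>2) has_sum hs2 T) onb"
  by (simp add: hs2_def hilbert_schmidt_def)

lemma hs2_nonneg: "hs2 T \<ge> 0"
  by (simp add: hs2_def infsum_nonneg)

text \<open>By Parseval both sides are the double sum of the squared matrix entries, taken in either
  order.\<close>

lemma hs_adj:
  assumes "hilbert_schmidt T"
  shows "hilbert_schmidt (adj T)" "hs2 (adj T) = hs2 T"
proof -
  let ?f = "\<lambda>(e,f). (cmod (cinner f (bapp T e)))\<^sup>2"
  have inn: "((\<lambda>f. ?f (e, f)) has_sum (norm (bapp T e))\<^sup>2) onb" for e
    using parseval[OF is_onb_onb, of "bapp T e"] by simp
  have "?f summable_on (onb \<times> onb)"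
    by (rule summable_on_SigmaI[OF inn]) (use assms in \<open>auto simp: hilbert_schmidt_def\<close>)
  then have "(?f has_sum hs2 T) (onb \<times> onb)"
    by (intro has_sum_SigmaI[OF inn has_sum_hs2[OF assms]])
  then have sw: "((\<lambda>(f,e). (cmod (cinner f (bapp T e)))\<^sup>2) has_sum hs2 T) (onb \<times> onb)"
    by (subst has_sum_swap) simp
  have "((\<lambda>f. (norm (bapp (adj T) f))\<^sup>2) has_sum hs2 T) onb"
    by (rule has_sum_SigmaD[OF sw]) (use parseval'[of "bapp (adj T) _"] in \<open>simp add: cinner_adj\<close>)
  then show "hilbert_schmidt (adj T)" "hs2 (adj T) = hs2 T"
    by (auto simp: hilbert_schmidt_def hs2_def infsumI summable_on_def)
qed

lemma hs_mult_left:
  assumes "hilbert_schmidt T"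
  shows "hilbert_schmidt (S * T)" "hs2 (S * T) \<le> (norm S)\<^sup>2 * hs2 T"
proof -
  have le: "(norm (bapp (S * T) e))\<^sup>2 \<le> (norm S)\<^sup>2 * (norm (bapp T e))\<^sup>2" for e
    unfolding bapp_mult power_mult_distrib[symmetric] by (intro power_mono norm_bapp) simp
  have s: "((\<lambda>e. (norm S)\<^sup>2 * (norm (bapp T e))\<^sup>2) has_sum ((norm S)\<^sup>2 * hs2 T)) onb"
    by (intro has_sum_cmult_right has_sum_hs2 assms)
  have h: "(\<lambda>e. (norm (bapp (S * T) e))\<^sup>2) summable_on onb"
    by (rule summable_on_comparison_test[OF has_sum_imp_summable[OF s]]) (use le in auto)
  then show "hilbert_schmidt (S * T)" by (simp add: hilbert_schmidt_def)
  show "hs2 (S * T) \<le> (norm S)\<^sup>2 * hs2 T"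
    unfolding hs2_def infsumI[OF s, symmetric, unfolded hs2_def]
    by (rule infsum_mono[OF h has_sum_imp_summable[OF s]]) (use le in auto)
qed

lemma hs_mult_right:
  assumes "hilbert_schmidt T"
  shows "hilbert_schmidt (T * S)" "hs2 (T * S) \<le> (norm S)\<^sup>2 * hs2 T"
  using hs_adj[OF hs_mult_left(1)[OF hs_adj(1)[OF assms], of "adj S"]]
    hs_mult_left(2)[OF hs_adj(1)[OF assms], of "adj S"] hs_adj(2)[OF assms] by simp_all

lemma hs_uminus: "hilbert_schmidt T \<Longrightarrow> hilbert_schmidt (- T)"
  using hilbert_schmidt_scaleR[of T "-1"] by simp

lemma hs_diff: "hilbert_schmidt S \<Longrightarrow> hilbert_schmidt T \<Longrightarrow> hilbert_schmidt (S - T)"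
  using hilbert_schmidt_add[of S "- T"] hs_uminus[of T] by simp

lemma hs_zero: "hilbert_schmidt 0"
  by (simp add: hilbert_schmidt_def bapp_linear_simps)

lemma hs_scaleC: "hilbert_schmidt T \<Longrightarrow> hilbert_schmidt (c *\<^sub>C T)"
  using hs_mult_left(1)[of T "c *\<^sub>C 1"] by simp

lemmas hs_intros = hilbert_schmidt_add hs_diff hs_uminus hs_zero hs_scaleC hilbert_schmidt_scaleR
  hilbert_schmidt_op_of

lemma hs2_uminus: "hs2 (- T) = hs2 T"
  by (simp add: hs2_def bapp_linear_simps)

lemma hs2_scaleR: "hs2 (r *\<^sub>R T) = r\<^sup>2 * hs2 T"
  by (simp add: hs2_def bapp_linear_simps power_mult_distrib infsum_cmult_right')

lemma hs2_parallelogram: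
  assumes "hilbert_schmidt S" "hilbert_schmidt T"
  shows "hs2 (S + T) + hs2 (S - T) = 2 * hs2 S + 2 * hs2 T"
proof -
  have "((\<lambda>e. (norm (bapp (S + T) e))\<^sup>2 + (norm (bapp (S - T) e))\<^sup>2) has_sum (hs2 (S + T) + hs2 (S - T))) onb"
    by (intro has_sum_add has_sum_hs2 hs_intros assms)
  moreover have "((\<lambda>e. 2 * (norm (bapp S e))\<^sup>2 + 2 * (norm (bapp T e))\<^sup>2) has_sum (2 * hs2 S + 2 * hs2 T)) onb"
    by (intro has_sum_add has_sum_cmult_right has_sum_hs2 assms)
  moreover have "(norm (bapp (S + T) e))\<^sup>2 + (norm (bapp (S - T) e))\<^sup>2
      = 2 * (norm (bapp S e))\<^sup>2 + 2 * (norm (bapp T e))\<^sup>2" for e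
    by (simp add: power2_norm_eq_inner inner_diff_left inner_diff_right inner_add_left inner_add_right
        inner_commute bapp_linear_simps)
  ultimately show ?thesis by (simp add: has_sum_unique)
qed

lemma hs2_add_le:
  "hilbert_schmidt S \<Longrightarrow> hilbert_schmidt T \<Longrightarrow> hs2 (S + T) \<le> 2 * hs2 S + 2 * hs2 T"
  using hs2_parallelogram[of S T] hs2_nonneg[of "S - T"] by simp

text \<open>The coefficients of \<open>T x\<close> are bounded by Cauchy-Schwarz after moving
  \<open>T\<close> to the basis vector as its adjoint, and the adjoint has the same
  \<open>hs2\<close>.\<close>

lemma norm_power2_le_hs2:
  assumes "hilbert_schmidt T" shows "(norm T)\<^sup>2 \<le> hs2 T"
proof -
  have "norm (bapp T x) \<le> sqrt (hs2 T) * norm x" for x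
  proof -
    have "((\<lambda>e. (norm (bapp (adj T) e))\<^sup>2 * (norm x)\<^sup>2) has_sum (hs2 T * (norm x)\<^sup>2)) onb"
      using has_sum_cmult_left[OF has_sum_hs2[OF hs_adj(1)[OF assms]]] hs_adj(2)[OF assms] by metis
    moreover have "((\<lambda>e. (cmod (cinner e (bapp T x)))\<^sup>2) has_sum (norm (bapp T x))\<^sup>2) onb"
      by (rule parseval[OF is_onb_onb])
    moreover have "(cmod (cinner e (bapp T x)))\<^sup>2 \<le> (norm (bapp (adj T) e))\<^sup>2 * (norm x)\<^sup>2" for e
      unfolding cinner_adj[symmetric] power_mult_distrib[symmetric] by (intro power_mono norm_cinner_le) simp
    ultimately have "(norm (bapp T x))\<^sup>2 \<le> hs2 T * (norm x)\<^sup>2"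
      by (meson has_sum_mono)
    then have "(norm (bapp T x))\<^sup>2 \<le> (sqrt (hs2 T) * norm x)\<^sup>2"
      by (simp add: power_mult_distrib hs2_nonneg)
    then show ?thesis by (rule power2_le_imp_le) (simp add: hs2_nonneg)
  qed
  then have "norm T \<le> sqrt (hs2 T)" by (intro norm_bop_le) (auto simp: hs2_nonneg)
  then have "(norm T)\<^sup>2 \<le> (sqrt (hs2 T))\<^sup>2" by (intro power_mono) auto
  then show ?thesis by (simp add: hs2_nonneg)
qed

subsection \<open>Cyclicity of the trace\<close>

abbreviation rtr :: "'a::complex_hilbert bop \<Rightarrow> real" where
  "rtr T \<equiv> Re (tr T)"

text \<open>Polarization. It reduces facts about the trace of a product to facts about
  \<open>hs2\<close>, in particular its invariance under the adjoint.\<close>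

lemma rtr_mult_eq_hs2:
  assumes "hilbert_schmidt S" "hilbert_schmidt T"
  shows "rtr (S * T) = (hs2 (adj S + T) - hs2 (adj S - T)) / 4"
proof -
  have S': "hilbert_schmidt (adj S)" by (rule hs_adj[OF assms(1)])
  have "(\<lambda>e. cinner e (bapp (S * T) e)) summable_on onb"
  proof (rule abs_summable_summable, rule summable_on_comparison_test)
    show "(\<lambda>e. (norm (bapp (adj S) e))\<^sup>2 + (norm (bapp T e))\<^sup>2) summable_on onb"
      using S' assms(2) unfolding hilbert_schmidt_def by (intro summable_on_add)
    fix e :: 'a
    have "cmod (cinner e (bapp (S * T) e)) \<le> norm (bapp (adj S) e) * norm (bapp T e)"
      using norm_cinner_le[of "bapp (adj S) e" "bapp T e"] by (simp add: bapp_mult cinner_adj)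
    also have "\<dots> \<le> (norm (bapp (adj S) e))\<^sup>2 + (norm (bapp T e))\<^sup>2"
      using sum_squares_bound[of "norm (bapp (adj S) e)" "norm (bapp T e)"]
        mult_nonneg_nonneg[OF norm_ge_zero[of "bapp (adj S) e"] norm_ge_zero[of "bapp T e"]] by linarith
    finally show "cmod (cinner e (bapp (S * T) e)) \<le> (norm (bapp (adj S) e))\<^sup>2 + (norm (bapp T e))\<^sup>2" .
  qed simp
  then have "((\<lambda>e. Re (cinner e (bapp (S * T) e))) has_sum rtr (S * T)) onb"
    unfolding tr_def by (intro has_sum_Re) simp
  then have a: "((\<lambda>e. 4 * Re (cinner e (bapp (S * T) e))) has_sum (4 * rtr (S * T))) onb"
    by (rule has_sum_cmult_right)
  have "((\<lambda>e. (norm (bapp (adj S + T) e))\<^sup>2 + - (norm (bapp (adj S - T) e))\<^sup>2)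
      has_sum (hs2 (adj S + T) + - hs2 (adj S - T))) onb"
    using has_sum_hs2[OF hs_diff[OF S' assms(2)]] has_sum_hs2[OF hilbert_schmidt_add[OF S' assms(2)]]
    by (intro has_sum_add) (simp_all add: has_sum_uminus)
  moreover have "4 * Re (cinner e (bapp (S * T) e))
      = (norm (bapp (adj S + T) e))\<^sup>2 + - (norm (bapp (adj S - T) e))\<^sup>2" for e
    using arg_cong[OF cinner_adj[of S e "bapp T e"], of Re]
    by (simp add: power2_norm_eq_inner inner_diff_left inner_diff_right inner_add_left inner_add_right
        inner_commute bapp_linear_simps bapp_mult Re_cinner)
  ultimately have "4 * rtr (S * T) = hs2 (adj S + T) + - hs2 (adj S - T)"
    using a by (simp add: has_sum_unique)
  then show ?thesis by simp
qed

text \<open>Exchanging the factors replaces \<open>adj S + T\<close> and \<open>adj S - T\<close> by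
  their adjoints up to sign.\<close>

lemma rtr_swap:
  assumes "hilbert_schmidt S" "hilbert_schmidt T"
  shows "rtr (S * T) = rtr (T * S)"
proof -
  note S' = hs_adj(1)[OF assms(1)] and T' = hs_adj(1)[OF assms(2)]
  have "hs2 (adj S + T) = hs2 (adj T + S)"
    using hs_adj(2)[OF hilbert_schmidt_add[OF S' assms(2)]] by (simp add: add.commute)
  moreover have "hs2 (adj S - T) = hs2 (adj T - S)"
    using hs_adj(2)[OF hs_diff[OF S' assms(2)]] hs2_uminus[of "S - adj T"] by simp
  ultimately show ?thesis by (simp add: rtr_mult_eq_hs2 assms)
qed

lemma rtr_self:
  assumes "hilbert_schmidt T" "adj T = T"
  shows "rtr (T * T) = hs2 T"
proof -
  have "hs2 (T + T) = 4 * hs2 T" using hs2_scaleR[of 2 T] by (simp add: scaleR_2)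
  moreover have "hs2 (T - T) = 0" by (simp add: hs2_def bapp_linear_simps)
  ultimately show ?thesis by (simp add: rtr_mult_eq_hs2 assms)
qed

text \<open>A unitary on the left is an isometry on every basis vector; one on the right is moved to
  the left by the adjoint.\<close>

lemma hs2_unitary:
  assumes "hilbert_schmidt T" "unitary_op u"
  shows "hs2 (u * T * adj u) = hs2 T"
proof -
  have iso: "norm (bapp u x) = norm x" for x
  proof -
    have "cinner (bapp u x) (bapp u x) = cinner x x"
      by (simp add: cinner_adj'[symmetric] bapp_mult[symmetric] unitary_op_simps assms bapp_one)
    then show ?thesis by (simp add: cinner_self power2_eq_iff_nonneg flip: of_real_power)
  qed
  have left: "hs2 (u * S) = hs2 S" for S by (simp add: hs2_def bapp_mult iso)
  have "hs2 (u * T * adj u) = hs2 (T * adj u)" by (simp only: left mult.assoc)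
  also have "\<dots> = hs2 (u * adj T)"
    using hs_adj(2)[OF hs_mult_right(1)[OF assms(1), of "adj u"]] by simp
  also have "\<dots> = hs2 T" by (simp add: left hs_adj assms)
  finally show ?thesis .
qed

subsection \<open>The space of self-adjoint Hilbert-Schmidt operators\<close>

lemma norm_hsh_hs2: "norm x = 2 * sqrt (hs2 (op_of x))"
  by (simp add: norm_hsh_def rtr_self hilbert_schmidt_op_of)

lemma norm_hsh_power2: "(norm x)\<^sup>2 = 4 * hs2 (op_of x)"
  by (simp add: norm_hsh_hs2 power_mult_distrib hs2_nonneg)

lemma op_of_simps [simp]:
  "op_of (x + y) = op_of x + op_of y" "op_of (x - y) = op_of x - op_of y" "op_of (- x) = - op_of x"
  "op_of 0 = 0" "op_of (r *\<^sub>R x) = r *\<^sub>R op_of x"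
  by (simp_all add: plus_hsh.rep_eq minus_hsh.rep_eq uminus_hsh.rep_eq zero_hsh.rep_eq scaleR_hsh.rep_eq)

lemma op_of_hsh_of: "adj T = T \<Longrightarrow> hilbert_schmidt T \<Longrightarrow> op_of (hsh_of T) = T"
  by (simp add: hsh_of_inverse selfadjoint_iff)

lemma norm_op_of_le: "norm (op_of x) \<le> norm x"
proof -
  have "(norm (op_of x))\<^sup>2 \<le> (norm x)\<^sup>2"
    using norm_power2_le_hs2[OF hilbert_schmidt_op_of[of x]] hs2_nonneg[of "op_of x"]
    unfolding norm_hsh_power2 by linarith
  then show ?thesis by (rule power2_le_imp_le) simp
qed

lemma bounded_linear_op_of: "bounded_linear (op_of :: 'a::complex_hilbert hsh \<Rightarrow> 'a bop)"
  by (rule bounded_linear_intro[where K=1]) (simp_all add: norm_op_of_le)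

text \<open>Every real-linear expression in Hilbert-Schmidt operators is turned into an element of the real
  Hilbert space by taking its self-adjoint part.\<close>

definition sa_part :: "'a::complex_hilbert bop \<Rightarrow> 'a hsh" where
  "sa_part T = hsh_of ((1/2) *\<^sub>R (T + adj T))"

lemma op_of_sa_part:
  "hilbert_schmidt T \<Longrightarrow> op_of (sa_part T) = (1/2) *\<^sub>R (T + adj T)"
  unfolding sa_part_def
  by (rule op_of_hsh_of) (simp_all add: add.commute hilbert_schmidt_scaleR hilbert_schmidt_add hs_adj(1) del: scaleR_add_right)

lemma op_of_sa_part_self:
  "hilbert_schmidt T \<Longrightarrow> adj T = T \<Longrightarrow> op_of (sa_part T) = T"
  by (simp add: op_of_sa_part scaleR_2[symmetric])

lemma norm_sa_part:
  assumes "hilbert_schmidt T" shows "norm (sa_part T) \<le> 2 * sqrt (hs2 T)"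
proof -
  have "hs2 (op_of (sa_part T)) = (1/4) * hs2 (T + adj T)"
    by (simp add: op_of_sa_part[OF assms] hs2_scaleR power2_eq_square del: scaleR_add_right)
  also have "\<dots> \<le> hs2 T"
    using hs2_add_le[OF assms hs_adj(1)[OF assms]] by (simp add: hs_adj assms)
  finally show ?thesis by (simp add: norm_hsh_hs2)
qed

text \<open>A Hilbert-Schmidt factor in the middle makes the product of bounded operators continuous for the
  Hilbert-Schmidt norm.\<close>

lemma bounded_bilinear_sandwich:
  assumes P: "hilbert_schmidt (P::'a::complex_hilbert bop)"
  shows "bounded_bilinear (\<lambda>S T. sa_part (S * P * T))"
proof
  have hs: "hilbert_schmidt (S * P * T)" for S T by (intro hs_mult_right hs_mult_left P)
  show "sa_part ((S + S') * P * T) = sa_part (S * P * T) + sa_part (S' * P * T)" for S S' T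
    unfolding op_of_inject[symmetric] by (simp add: op_of_sa_part hs) (simp add: algebra_simps)
  show "sa_part (S * P * (T + T')) = sa_part (S * P * T) + sa_part (S * P * T')" for S T T'
    unfolding op_of_inject[symmetric] by (simp add: op_of_sa_part hs) (simp add: algebra_simps)
  show "sa_part (r *\<^sub>R S * P * T) = r *\<^sub>R sa_part (S * P * T)" for r S T
    unfolding op_of_inject[symmetric] using hs[of "r *\<^sub>R S" T] by (simp add: op_of_sa_part hs) (simp add: algebra_simps)
  show "sa_part (S * P * (r *\<^sub>R T)) = r *\<^sub>R sa_part (S * P * T)" for r S T
    unfolding op_of_inject[symmetric] using hs[of S "r *\<^sub>R T"] by (simp add: op_of_sa_part hs) (simp add: algebra_simps)
  have "norm (sa_part (S * P * T)) \<le> norm S * norm T * (2 * sqrt (hs2 P))" for S T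
  proof -
    have "hs2 (S * P * T) \<le> (norm T)\<^sup>2 * ((norm S)\<^sup>2 * hs2 P)"
      by (rule order_trans[OF hs_mult_right(2)[OF hs_mult_left(1)[OF P]]])
        (intro mult_left_mono hs_mult_left(2) P, simp)
    also have "\<dots> = (norm S * norm T * sqrt (hs2 P))\<^sup>2"
      by (simp add: power_mult_distrib hs2_nonneg)
    finally have "sqrt (hs2 (S * P * T)) \<le> norm S * norm T * sqrt (hs2 P)"
      by (simp add: real_le_rsqrt real_sqrt_le_iff hs2_nonneg real_sqrt_le_mono[THEN order_trans])
    then show ?thesis using norm_sa_part[OF hs[of S T]] by simp
  qed
  then show "\<exists>K. \<forall>S T. norm (sa_part (S * P * T)) \<le> norm S * norm T * K" by blast
qed

section \<open>The operator exponential\<close>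

lemma norm_bop_power: "norm (T ^ n) \<le> norm (T::'a::complex_hilbert bop) ^ n"
proof (induction n)
  case (Suc n)
  have "norm (T ^ Suc n) \<le> norm T * norm (T ^ n)" by (simp add: norm_mult_ineq)
  also have "\<dots> \<le> norm T * norm T ^ n" by (intro mult_left_mono Suc) simp
  finally show ?case by simp
qed (simp add: norm_one_bop_le)

lemma bop_power_scaleR: "(r *\<^sub>R T) ^ n = r ^ n *\<^sub>R (T::'a::complex_hilbert bop) ^ n"
  by (induction n) simp_all

lemma bexp_summable: "summable (\<lambda>n. (T::'a::complex_hilbert bop) ^ n /\<^sub>R fact n)"
proof (rule summable_norm_cancel, rule summable_comparison_test')
  show "summable (\<lambda>n. inverse (fact n) * norm T ^ n)" by (rule summable_exp)
  fix n
  show "norm (norm (T ^ n /\<^sub>R fact n)) \<le> inverse (fact n) * norm T ^ n"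
    by (simp add: norm_bop_power)
qed

lemma bexp_sums: "(\<lambda>n. (T::'a::complex_hilbert bop) ^ n /\<^sub>R fact n) sums bexp T"
  unfolding bexp_def by (rule summable_sums[OF bexp_summable])

lemma bounded_linear_bexp:
  assumes "bounded_linear f" "\<And>n. f (T ^ n) = S ^ n"
  shows "f (bexp T) = bexp (S::'a::complex_hilbert bop)"
proof -
  have "(\<lambda>n. f (T ^ n /\<^sub>R fact n)) sums f (bexp T)"
    by (rule bounded_linear.sums[OF assms(1) bexp_sums])
  then have "(\<lambda>n. S ^ n /\<^sub>R fact n) sums f (bexp T)"
    by (simp add: linear_scale[OF bounded_linear.linear[OF assms(1)]] assms(2))
  then show ?thesis using bexp_sums sums_unique2 by blast
qed

lemma bexp_zero [simp]: "bexp 0 = (1::'a::complex_hilbert bop)"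
proof -
  have "(0::'a bop) ^ n /\<^sub>R fact n = (if n = 0 then 1 else 0)" for n
    by (cases n) simp_all
  then have "(\<lambda>n. if n = 0 then 1 else 0) sums bexp (0::'a bop)"
    using bexp_sums[of "0::'a bop"] by simp
  moreover have "(\<lambda>n. if n = 0 then 1 else 0) sums (1::'a bop)" by (rule sums_single)
  ultimately show ?thesis by (rule sums_unique2)
qed

lemma bexp_commute:
  assumes "S * T = T * (S::'a::complex_hilbert bop)" shows "S * bexp T = bexp T * S"
proof -
  have p: "S * T ^ n = T ^ n * S" for n
    by (induction n) (simp_all add: mult.assoc[symmetric] assms, simp add: mult.assoc assms)
  have "(\<lambda>n. S * (T ^ n /\<^sub>R fact n)) sums (S * bexp T)"
    by (rule bounded_linear.sums[OF bounded_linear_mult_right bexp_sums])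
  moreover have "(\<lambda>n. (T ^ n /\<^sub>R fact n) * S) sums (bexp T * S)"
    by (rule bounded_linear.sums[OF bounded_linear_mult_left bexp_sums])
  ultimately show ?thesis by (simp add: p sums_unique2)
qed

lemma adj_bexp: "adj (bexp T) = bexp (adj T)"
proof (rule bounded_linear_bexp[OF bounded_linear_adj])
  show "adj (T ^ n) = adj T ^ n" for n by (induction n) (simp_all add: power_commutes)
qed

lemma bexp_unitary_conj:
  assumes "unitary_op u" shows "u * bexp T * adj u = bexp (u * T * adj u)"
proof (rule bounded_linear_bexp[of "\<lambda>T. u * T * adj u"])
  show "bounded_linear (\<lambda>T. u * T * adj u)"
    by (intro bounded_linear_compose[OF bounded_linear_mult_left bounded_linear_mult_right])
  show "u * T ^ n * adj u = (u * T * adj u) ^ n" for n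
  proof (induction n)
    case (Suc n)
    have "u * T ^ Suc n * adj u = (u * T * adj u) * (u * T ^ n * adj u)"
      by (simp add: unitary_op_simps assms mult.assoc)
    then show ?case by (simp add: Suc)
  qed (simp add: unitary_op_simps assms)
qed

lemma bexp_has_vector_derivative:
  fixes T :: "'a::complex_hilbert bop"
  shows "((\<lambda>t. bexp (t *\<^sub>R T)) has_vector_derivative T * bexp (t *\<^sub>R T)) (at t within A)"
proof -
  \<comment> \<open>Any radius beyond the absolute value of \<open>t\<close> would do; termwise
    differentiation takes place on this bounded interval.\<close>
  define R where "R = \<bar>t\<bar> + 1"
  define I where "I = {-R<..<R}"
  define f where "f n s = (s ^ n / fact n) *\<^sub>R T ^ n" for n and s :: real
  define f' where "f' n s h = (h * (of_nat n * s ^ (n - 1) / fact n)) *\<^sub>R T ^ n" for n and s h :: real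
  have fs: "f n s = (s *\<^sub>R T) ^ n /\<^sub>R fact n" for n s
    by (simp add: f_def bop_power_scaleR divide_inverse mult.commute)
  have sums: "(\<lambda>n. f n s) sums bexp (s *\<^sub>R T)" for s
    unfolding fs by (rule bexp_sums)
  have ul: "uniform_limit I (\<lambda>n s. \<Sum>i<n. f i s) (\<lambda>s. \<Sum>i. f i s) sequentially"
  proof (rule Weierstrass_m_test)
    show "summable (\<lambda>n. inverse (fact n) * (R * norm T) ^ n)" by (rule summable_exp)
    fix n s assume "s \<in> I"
    then have "\<bar>s\<bar> ^ n \<le> R ^ n" by (intro power_mono) (auto simp: I_def)
    then have "\<bar>s\<bar> ^ n * norm (T ^ n) \<le> R ^ n * norm T ^ n"
      by (intro mult_mono norm_bop_power) (auto simp: R_def)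
    then show "norm (f n s) \<le> inverse (fact n) * (R * norm T) ^ n"
      by (simp add: f_def power_mult_distrib power_abs divide_simps mult.commute)
  qed
  have S: "(\<Sum>i. f i s) = bexp (s *\<^sub>R T)" for s using sums sums_unique by metis
  \<comment> \<open>Differentiation shifts the series by one place: the first \<open>n + 1\<close>
    terms differentiate to \<open>T\<close> times the first \<open>n\<close>. Uniform convergence of
    the series itself therefore controls the derivatives too.\<close>
  have step: "(\<Sum>i<Suc n. f' i s h) = h *\<^sub>R (T * (\<Sum>i<n. f i s))" for n s h
  proof -
    have f'Suc: "f' (Suc i) s h = h *\<^sub>R (T * f i s)" for i
    proof -
      have "of_nat (Suc i) * s ^ i / fact (Suc i) = s ^ i / fact i"
        by (simp only: fact_Suc of_nat_mult) (simp add: divide_simps del: of_nat_Suc)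
      then show ?thesis by (simp add: f'_def f_def del: of_nat_Suc fact_Suc)
    qed
    have "(\<Sum>i<Suc n. f' i s h) = f' 0 s h + (\<Sum>i<n. f' (Suc i) s h)"
      by (rule sum.lessThan_Suc_shift)
    also have "f' 0 s h = 0" by (simp add: f'_def)
    finally show ?thesis by (simp add: f'Suc sum_distrib_left scaleR_sum_right)
  qed
  have "\<exists>g. \<forall>x\<in>I. (\<lambda>n. f n x) sums g x \<and>
      (g has_derivative (\<lambda>h. h *\<^sub>R (T * bexp (x *\<^sub>R T)))) (at x within I)"
  proof (rule has_derivative_series[where f = f and f' = f'])
    show "convex I" by (simp add: I_def)
    show "t \<in> I" by (auto simp: I_def R_def)
    show "(\<lambda>n. f n t) sums bexp (t *\<^sub>R T)" by (rule sums)
    show "(f n has_derivative f' n x) (at x within I)" for n x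
      unfolding f_def f'_def by (auto intro!: derivative_eq_intros simp: fun_eq_iff divide_simps)
    fix e :: real assume e: "e > 0"
    define e' where "e' = e / (norm T + 1)"
    have "norm T + 1 > 0" by (simp add: add_nonneg_pos)
    then have e': "e' > 0" "norm T * e' \<le> e"
      using e by (auto simp: e'_def pos_divide_le_eq mult.commute intro!: mult_left_mono)
    from uniform_limitD[OF ul e'(1)] obtain N where
      N: "\<And>n s. n \<ge> N \<Longrightarrow> s \<in> I \<Longrightarrow> norm ((\<Sum>i<n. f i s) - bexp (s *\<^sub>R T)) < e'"
      unfolding S eventually_sequentially dist_norm by blast
    have "norm ((\<Sum>i<n. f' i x h) - h *\<^sub>R (T * bexp (x *\<^sub>R T))) \<le> e * norm h"
      if n: "n \<ge> Suc N" and x: "x \<in> I" for n x h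
    proof -
      obtain m where m: "n = Suc m" "m \<ge> N" using n by (cases n) auto
      have "(\<Sum>i<n. f' i x h) - h *\<^sub>R (T * bexp (x *\<^sub>R T)) = h *\<^sub>R (T * ((\<Sum>i<m. f i x) - bexp (x *\<^sub>R T)))"
        unfolding m step by (simp add: algebra_simps)
      also have "norm \<dots> \<le> \<bar>h\<bar> * (norm T * norm ((\<Sum>i<m. f i x) - bexp (x *\<^sub>R T)))"
        by (simp add: mult_left_mono norm_mult_ineq)
      also have "\<dots> \<le> \<bar>h\<bar> * (norm T * e')"
        using N[OF m(2) x] by (intro mult_left_mono) auto
      also have "\<dots> \<le> \<bar>h\<bar> * e" by (intro mult_left_mono e') auto
      finally show ?thesis by (simp add: mult.commute)
    qed
    then show "\<forall>\<^sub>F n in sequentially. \<forall>x\<in>I. \<forall>h. norm ((\<Sum>i<n. f' i x h) - h *\<^sub>R (T * bexp (x *\<^sub>R T))) \<le> e * norm h"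
      unfolding eventually_sequentially by blast
  qed
  then obtain g where g: "\<And>x. x \<in> I \<Longrightarrow> (\<lambda>n. f n x) sums g x"
    "\<And>x. x \<in> I \<Longrightarrow> (g has_derivative (\<lambda>h. h *\<^sub>R (T * bexp (x *\<^sub>R T)))) (at x within I)" by blast
  have t: "t \<in> I" by (auto simp: I_def R_def)
  have "open I" by (simp add: I_def)
  have "(g has_derivative (\<lambda>h. h *\<^sub>R (T * bexp (t *\<^sub>R T)))) (at t)"
    using g(2)[OF t] at_within_open[OF t \<open>open I\<close>] by simp
  then have "((\<lambda>s. bexp (s *\<^sub>R T)) has_derivative (\<lambda>h. h *\<^sub>R (T * bexp (t *\<^sub>R T)))) (at t)"
    by (rule has_derivative_transform_within_open[OF _ \<open>open I\<close> t]) (use g(1) sums sums_unique2 in blast)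
  then show ?thesis by (simp add: has_vector_derivative_def has_derivative_at_withinI)
qed

section \<open>Linear differential equations and the exponential law\<close>

lemmas bop_mult_has_vector_derivative =
  bounded_bilinear.has_vector_derivative[OF bounded_bilinear_mult]

text \<open>This stands in for uniqueness of solutions of linear differential equations: a candidate
  is multiplied by the inverse exponential and the product is shown to be constant.\<close>

lemma const_if_has_vector_derivative_0:
  fixes f :: "real \<Rightarrow> 'b::real_normed_vector"
  assumes "\<And>t. t \<in> {0..1} \<Longrightarrow> (f has_vector_derivative 0) (at t within {0..1})" "t \<in> {0..1}"
  shows "f t = f 0"
  using has_vector_derivative_zero_constant[of "{0..1}" f] assms
  by (metis atLeastAtMost_iff convex_real_interval(5) le_numeral_extra(3) zero_le_one)

lemma bexp_minus_mult: "bexp T * bexp (- T) = (1::'a::complex_hilbert bop)"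
proof -
  have c: "bexp (t *\<^sub>R T) * T = T * bexp (t *\<^sub>R T)" for t by (rule bexp_commute[symmetric]) simp
  have "(\<lambda>t. bexp (t *\<^sub>R T) * bexp (t *\<^sub>R (- T))) 1 = (\<lambda>t. bexp (t *\<^sub>R T) * bexp (t *\<^sub>R (- T))) 0"
  proof (rule const_if_has_vector_derivative_0)
    fix t
    have "bexp (t *\<^sub>R T) * (- T * bexp (t *\<^sub>R (- T))) + T * bexp (t *\<^sub>R T) * bexp (t *\<^sub>R (- T)) = 0"
      using c[of t] by (simp add: mult.assoc[symmetric])
    with bop_mult_has_vector_derivative[OF bexp_has_vector_derivative[of T t "{0..1}"] bexp_has_vector_derivative[of "- T" t]]
    show "((\<lambda>t. bexp (t *\<^sub>R T) * bexp (t *\<^sub>R (- T))) has_vector_derivative 0) (at t within {0..1})" by simp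
  qed simp
  then show ?thesis by simp
qed

text \<open>The product of the exponentials of \<open>t S\<close>, \<open>t T\<close> and
  \<open>- t (S + T)\<close> has derivative zero.\<close>

lemma bexp_add:
  assumes "S * T = T * (S::'a::complex_hilbert bop)"
  shows "bexp (S + T) = bexp S * bexp T"
proof -
  let ?E = "\<lambda>t. bexp (t *\<^sub>R S)" and ?F = "\<lambda>t. bexp (t *\<^sub>R T)" and ?G = "\<lambda>t. bexp (t *\<^sub>R (- (S + T)))"
  have c: "?E t * S = S * ?E t" "?F t * T = T * ?F t" "?F t * S = S * ?F t" "?E t * T = T * ?E t" for t
    by (rule bexp_commute[symmetric], simp add: assms)+
  have "(\<lambda>t. ?E t * (?F t * ?G t)) 1 = (\<lambda>t. ?E t * (?F t * ?G t)) 0"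
  proof (rule const_if_has_vector_derivative_0)
    fix t
    have c': "?E t * (S * X) = S * (?E t * X)" "?F t * (T * X) = T * (?F t * X)"
      "?F t * (S * X) = S * (?F t * X)" "?E t * (T * X) = T * (?E t * X)" for X
      by (simp_all only: mult.assoc[symmetric] c)
    have "?E t * (?F t * (- (S + T) * X) + T * ?F t * X) + S * ?E t * (?F t * X) = 0" for X
      by (simp add: algebra_simps c')
    with bop_mult_has_vector_derivative[OF bexp_has_vector_derivative[of S t "{0..1}"]
        bop_mult_has_vector_derivative[OF bexp_has_vector_derivative[of T t] bexp_has_vector_derivative[of "- (S + T)" t]]]
    show "((\<lambda>t. ?E t * (?F t * ?G t)) has_vector_derivative 0) (at t within {0..1})" by simp
  qed simp
  then have 1: "bexp S * (bexp T * bexp (- (S + T))) = 1" by simp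
  have "bexp S * bexp T = bexp S * bexp T * (bexp (- (S + T)) * bexp (S + T))"
    using bexp_minus_mult[of "- (S + T)"] by (simp only: minus_minus mult.right_neutral)
  also have "\<dots> = bexp S * (bexp T * bexp (- (S + T))) * bexp (S + T)" by (simp only: mult.assoc)
  finally show ?thesis by (simp only: 1 mult_1_left)
qed

lemma unitary_bexp:
  assumes "adj T = - T" shows "unitary_op (bexp T)"
  using bexp_minus_mult[of T] bexp_minus_mult[of "- T"] by (simp add: unitary_op_def adj_bexp assms)

section \<open>Calculus of smooth maps\<close>

text \<open>Differentiability at \<open>x\<close> of a family of maps, uniformly in the parameter \<open>p\<close> with respect to the
  weight \<open>N p\<close>.  For parameters \<open>vs\<close> weighted by the product of the norms this is the condition on
  consecutive derivatives in \<^const>\<open>smooth_on\<close>.\<close>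

definition udiff ::
  "'e::real_normed_vector set \<Rightarrow> 'e \<Rightarrow> 'p set \<Rightarrow> ('p \<Rightarrow> real) \<Rightarrow> ('e \<Rightarrow> 'p \<Rightarrow> 'f::real_normed_vector) \<Rightarrow> ('e \<Rightarrow> 'p \<Rightarrow> 'f) \<Rightarrow> bool"
  where "udiff U x A N F dF \<longleftrightarrow> (\<forall>p\<in>A. 0 \<le> N p) \<and>
    (\<exists>K\<ge>0. \<forall>p\<in>A. norm (F x p) \<le> K * N p \<and> (\<forall>h. norm (dF h p) \<le> K * norm h * N p)) \<and>
    (\<forall>\<epsilon>>0. \<exists>\<delta>>0. \<forall>h. norm h < \<delta> \<and> x + h \<in> U \<longrightarrow>
      (\<forall>p\<in>A. norm (F (x + h) p - F x p - dF h p) \<le> \<epsilon> * norm h * N p))"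

lemma udiffI:
  assumes "\<And>p. p \<in> A \<Longrightarrow> 0 \<le> N p" "0 \<le> K"
    "\<And>p. p \<in> A \<Longrightarrow> norm (F x p) \<le> K * N p" "\<And>p h. p \<in> A \<Longrightarrow> norm (dF h p) \<le> K * norm h * N p"
    "\<And>\<epsilon>. \<epsilon> > 0 \<Longrightarrow> \<exists>\<delta>>0. \<forall>h. norm h < \<delta> \<and> x + h \<in> U \<longrightarrow>
      (\<forall>p\<in>A. norm (F (x + h) p - F x p - dF h p) \<le> \<epsilon> * norm h * N p)"
  shows "udiff U x A N F dF"
  unfolding udiff_def using assms by blast

lemma udiffE:
  assumes "udiff U x A N F dF"
  obtains K where "\<And>p. p \<in> A \<Longrightarrow> 0 \<le> N p" "0 \<le> K"
    "\<And>p. p \<in> A \<Longrightarrow> norm (F x p) \<le> K * N p" "\<And>p h. p \<in> A \<Longrightarrow> norm (dF h p) \<le> K * norm h * N p"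
  using assms unfolding udiff_def by blast

lemma udiffD:
  assumes "udiff U x A N F dF" "\<epsilon> > 0"
  obtains \<delta> where "\<delta> > 0" "\<And>h p. norm h < \<delta> \<Longrightarrow> x + h \<in> U \<Longrightarrow> p \<in> A \<Longrightarrow>
      norm (F (x + h) p - F x p - dF h p) \<le> \<epsilon> * norm h * N p"
  using assms unfolding udiff_def by blast

text \<open>Serves to reshape the parameters, for instance to split a list into head and
  tail.\<close>

lemma udiff_reindex:
  assumes F: "udiff U x A N F dF" and g: "\<And>p. p \<in> A' \<Longrightarrow> g p \<in> A" "\<And>p. p \<in> A' \<Longrightarrow> N' p = N (g p)"
    and eq: "x \<in> U" "\<And>y p. y \<in> U \<Longrightarrow> p \<in> A' \<Longrightarrow> F' y p = F y (g p)" "\<And>h p. p \<in> A' \<Longrightarrow> dF' h p = dF h (g p)"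
  shows "udiff U x A' N' F' dF'"
proof -
  obtain K where K: "\<And>p. p \<in> A \<Longrightarrow> 0 \<le> N p" "0 \<le> K"
    "\<And>p. p \<in> A \<Longrightarrow> norm (F x p) \<le> K * N p" "\<And>p h. p \<in> A \<Longrightarrow> norm (dF h p) \<le> K * norm h * N p"
    by (rule udiffE[OF F]) (rule that, assumption+)
  show ?thesis
  proof (rule udiffI)
    fix \<epsilon> :: real assume "\<epsilon> > 0"
    with udiffD[OF F] obtain \<delta> where "\<delta> > 0" "\<And>h p. norm h < \<delta> \<Longrightarrow> x + h \<in> U \<Longrightarrow> p \<in> A \<Longrightarrow>
      norm (F (x + h) p - F x p - dF h p) \<le> \<epsilon> * norm h * N p" by blast
    then show "\<exists>\<delta>>0. \<forall>h. norm h < \<delta> \<and> x + h \<in> U \<longrightarrow>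
      (\<forall>p\<in>A'. norm (F' (x + h) p - F' x p - dF' h p) \<le> \<epsilon> * norm h * N' p)"
      using g eq by (intro exI[of _ \<delta>]) auto
  qed (use K g eq in auto)
qed

lemma udiff_add:
  assumes F: "udiff U x A N F dF" and G: "udiff U x A N G dG"
  shows "udiff U x A N (\<lambda>y p. F y p + G y p) (\<lambda>h p. dF h p + dG h p)"
proof -
  obtain K where K: "\<And>p. p \<in> A \<Longrightarrow> 0 \<le> N p" "0 \<le> K"
    "\<And>p. p \<in> A \<Longrightarrow> norm (F x p) \<le> K * N p" "\<And>p h. p \<in> A \<Longrightarrow> norm (dF h p) \<le> K * norm h * N p"
    by (rule udiffE[OF F]) (rule that, assumption+)
  obtain L where L: "0 \<le> L"
    "\<And>p. p \<in> A \<Longrightarrow> norm (G x p) \<le> L * N p" "\<And>p h. p \<in> A \<Longrightarrow> norm (dG h p) \<le> L * norm h * N p"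
    by (rule udiffE[OF G]) (rule that, assumption+)
  show ?thesis
  proof (rule udiffI[where K="K + L"])
    fix p h assume p: "p \<in> A"
    show "norm (F x p + G x p) \<le> (K + L) * N p"
      using norm_triangle_ineq[of "F x p" "G x p"] K(3)[OF p] L(2)[OF p] by (simp add: distrib_right)
    show "norm (dF h p + dG h p) \<le> (K + L) * norm h * N p"
      using norm_triangle_ineq[of "dF h p" "dG h p"] K(4)[OF p, of h] L(3)[OF p, of h] by (simp add: distrib_right)
  next
    fix \<epsilon> :: real assume "\<epsilon> > 0"
    then have e: "\<epsilon> / 2 > 0" by simp
    obtain \<delta> where \<delta>: "\<delta> > 0" "\<And>h p. norm h < \<delta> \<Longrightarrow> x + h \<in> U \<Longrightarrow> p \<in> A \<Longrightarrow>
      norm (F (x + h) p - F x p - dF h p) \<le> \<epsilon> / 2 * norm h * N p" by (rule udiffD[OF F e]) (rule that, assumption+)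
    obtain \<delta>' where \<delta>': "\<delta>' > 0" "\<And>h p. norm h < \<delta>' \<Longrightarrow> x + h \<in> U \<Longrightarrow> p \<in> A \<Longrightarrow>
      norm (G (x + h) p - G x p - dG h p) \<le> \<epsilon> / 2 * norm h * N p" by (rule udiffD[OF G e]) (rule that, assumption+)
    have "norm (F (x + h) p + G (x + h) p - (F x p + G x p) - (dF h p + dG h p)) \<le> \<epsilon> * norm h * N p"
      if "norm h < min \<delta> \<delta>'" "x + h \<in> U" "p \<in> A" for h p
    proof -
      have eq: "F (x + h) p + G (x + h) p - (F x p + G x p) - (dF h p + dG h p)
          = (F (x + h) p - F x p - dF h p) + (G (x + h) p - G x p - dG h p)" by simp
      have "norm (F (x + h) p - F x p - dF h p) \<le> \<epsilon> / 2 * norm h * N p"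
        "norm (G (x + h) p - G x p - dG h p) \<le> \<epsilon> / 2 * norm h * N p"
        using \<delta>(2)[of h p] \<delta>'(2)[of h p] that by simp_all
      then show ?thesis unfolding eq
        using norm_triangle_ineq[of "F (x + h) p - F x p - dF h p" "G (x + h) p - G x p - dG h p"] by linarith
    qed
    then show "\<exists>\<delta>>0. \<forall>h. norm h < \<delta> \<and> x + h \<in> U \<longrightarrow> (\<forall>p\<in>A.
        norm (F (x + h) p + G (x + h) p - (F x p + G x p) - (dF h p + dG h p)) \<le> \<epsilon> * norm h * N p)"
      using \<delta>(1) \<delta>'(1) by (intro exI[of _ "min \<delta> \<delta>'"]) auto
  qed (use K L in auto)
qed

text \<open>Product rule with independent parameters for the two factors; the weights
  multiply.\<close>

lemma udiff_bilinear:
  assumes B: "bounded_bilinear B"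
    and F: "udiff U x A N F dF" and G: "udiff U x A' N' G dG"
  shows "udiff U x (A \<times> A') (\<lambda>(p,q). N p * N' q) (\<lambda>y (p,q). B (F y p) (G y q))
    (\<lambda>h (p,q). B (dF h p) (G x q) + B (F x p) (dG h q))"
proof -
  interpret B: bounded_bilinear B by (rule B)
  obtain K where K: "\<And>p. p \<in> A \<Longrightarrow> 0 \<le> N p" "0 \<le> K"
    "\<And>p. p \<in> A \<Longrightarrow> norm (F x p) \<le> K * N p" "\<And>p h. p \<in> A \<Longrightarrow> norm (dF h p) \<le> K * norm h * N p"
    by (rule udiffE[OF F]) (rule that, assumption+)
  obtain L where L: "\<And>q. q \<in> A' \<Longrightarrow> 0 \<le> N' q" "0 \<le> L"
    "\<And>p. p \<in> A' \<Longrightarrow> norm (G x p) \<le> L * N' p" "\<And>p h. p \<in> A' \<Longrightarrow> norm (dG h p) \<le> L * norm h * N' p"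
    by (rule udiffE[OF G]) (rule that, assumption+)
  obtain b where b: "0 < b" "\<And>u v. norm (B u v) \<le> norm u * norm v * b" using B.pos_bounded by blast
  have bb: "norm (B u v) \<le> s * t * b" if "norm u \<le> s" "norm v \<le> t" for u v s t
  proof -
    have "norm (B u v) \<le> norm u * norm v * b" by (rule b)
    also have "\<dots> \<le> s * t * b"
      using that b(1) norm_ge_zero[of u] norm_ge_zero[of v] by (intro mult_right_mono mult_mono) linarith+
    finally show ?thesis .
  qed
  show ?thesis
  proof (rule udiffI[where K="2 * K * L * b"])
    fix pq assume pq: "pq \<in> A \<times> A'"
    then obtain p q where [simp]: "pq = (p, q)" and p: "p \<in> A" and q: "q \<in> A'" by auto
    show "0 \<le> (\<lambda>(p,q). N p * N' q) pq" using K(1)[OF p] L(1)[OF q] by simp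
    have nn: "0 \<le> K * N p * (L * N' q) * b" using K(1,2) L(1,2) p q b by simp
    show "norm ((\<lambda>(p,q). B (F x p) (G x q)) pq) \<le> 2 * K * L * b * (\<lambda>(p,q). N p * N' q) pq"
      using bb[OF K(3)[OF p] L(3)[OF q]] nn by (simp add: algebra_simps)
    fix h
    show "norm ((\<lambda>(p,q). B (dF h p) (G x q) + B (F x p) (dG h q)) pq) \<le> 2 * K * L * b * norm h * (\<lambda>(p,q). N p * N' q) pq"
      using bb[OF K(4)[OF p, of h] L(3)[OF q]] bb[OF K(3)[OF p] L(4)[OF q, of h]]
        norm_triangle_ineq[of "B (dF h p) (G x q)" "B (F x p) (dG h q)"] by (simp add: algebra_simps)
  next
    fix \<epsilon> :: real assume "\<epsilon> > 0"
    \<comment> \<open>The sum of the coefficients of the three error terms below; the added 1 makes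
      it positive.\<close>
    define C where "C = b * ((2 * L + 1) + K + K * (L + 1)) + 1"
    have C: "C > 0" using K(2) L(2) b(1) by (auto simp: C_def intro!: add_nonneg_pos mult_nonneg_nonneg)
    define \<eta> where "\<eta> = min 1 (\<epsilon> / C)"
    have \<eta>: "0 < \<eta>" "\<eta> \<le> 1" "C * \<eta> \<le> \<epsilon>"
      using C \<open>\<epsilon> > 0\<close> by (auto simp: \<eta>_def min_def field_simps)
    obtain \<delta> where \<delta>: "\<delta> > 0" "\<And>h p. norm h < \<delta> \<Longrightarrow> x + h \<in> U \<Longrightarrow> p \<in> A \<Longrightarrow>
      norm (F (x + h) p - F x p - dF h p) \<le> \<eta> * norm h * N p" by (rule udiffD[OF F \<eta>(1)]) (rule that, assumption+)
    obtain \<delta>' where \<delta>': "\<delta>' > 0" "\<And>h p. norm h < \<delta>' \<Longrightarrow> x + h \<in> U \<Longrightarrow> p \<in> A' \<Longrightarrow>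
      norm (G (x + h) p - G x p - dG h p) \<le> \<eta> * norm h * N' p" by (rule udiffD[OF G \<eta>(1)]) (rule that, assumption+)
    define \<delta>0 where "\<delta>0 = min \<eta> (min \<delta> \<delta>')"
    have "norm (B (F (x + h) p) (G (x + h) q) - B (F x p) (G x q) - (B (dF h p) (G x q) + B (F x p) (dG h q)))
        \<le> \<epsilon> * norm h * (N p * N' q)" if h: "norm h < \<delta>0" "x + h \<in> U" and p: "p \<in> A" and q: "q \<in> A'" for h p q
    proof -
      define rF where "rF = F (x + h) p - F x p - dF h p"
      define rG where "rG = G (x + h) q - G x q - dG h q"
      have h1: "norm h < \<eta>" "norm h < \<delta>" "norm h < \<delta>'" "norm h \<le> 1" using h \<eta>(2) by (auto simp: \<delta>0_def)
      have rF: "norm rF \<le> \<eta> * norm h * N p" unfolding rF_def using \<delta>(2) h1 h(2) p by blast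
      have rG: "norm rG \<le> \<eta> * norm h * N' q" unfolding rG_def using \<delta>'(2) h1 h(2) q by blast
      have "norm (rG + dG h q) \<le> \<eta> * norm h * N' q + L * norm h * N' q"
        using norm_triangle_ineq[of rG "dG h q"] rG L(4)[OF q, of h] by linarith
      also have "\<dots> \<le> 1 * norm h * N' q + L * norm h * N' q"
        using \<eta> L(1)[OF q] by (intro add_right_mono mult_right_mono) auto
      finally have dG: "norm (rG + dG h q) \<le> (L + 1) * norm h * N' q" by (simp add: algebra_simps)
      have "norm (G x q + (rG + dG h q)) \<le> L * N' q + (L + 1) * norm h * N' q"
        using norm_triangle_ineq[of "G x q" "rG + dG h q"] dG L(3)[OF q] by linarith
      also have "\<dots> \<le> L * N' q + (L + 1) * 1 * N' q"
        using L(1)[OF q] L(2) h1(4) by (intro add_left_mono mult_right_mono mult_left_mono) auto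
      finally have G': "norm (G x q + (rG + dG h q)) \<le> (2 * L + 1) * N' q" by (simp add: algebra_simps)
      \<comment> \<open>The first two terms carry a remainder and are small relative to
        \<open>h\<close>; the third is of second order in \<open>h\<close>.\<close>
      have "B (F (x + h) p) (G (x + h) q) - B (F x p) (G x q) - (B (dF h p) (G x q) + B (F x p) (dG h q))
          = B rF (G x q + (rG + dG h q)) + B (F x p) rG + B (dF h p) (rG + dG h q)"
      proof -
        have "F (x + h) p = F x p + dF h p + rF" "G (x + h) q = G x q + dG h q + rG"
          by (simp_all add: rF_def rG_def)
        then show ?thesis by (simp add: B.add_left B.add_right algebra_simps)
      qed
      also have "norm \<dots> \<le> norm (B rF (G x q + (rG + dG h q))) + norm (B (F x p) rG) + norm (B (dF h p) (rG + dG h q))"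
        by (intro order_trans[OF norm_triangle_ineq] add_right_mono norm_triangle_ineq)
      also have "\<dots> \<le> (\<eta> * norm h * N p) * ((2 * L + 1) * N' q) * b + (K * N p) * (\<eta> * norm h * N' q) * b
          + (K * norm h * N p) * ((L + 1) * norm h * N' q) * b"
        by (intro add_mono bb rF rG G' dG K(3)[OF p] K(4)[OF p])
      also have "(K * norm h * N p) * ((L + 1) * norm h * N' q) * b \<le> (K * norm h * N p) * ((L + 1) * \<eta> * N' q) * b"
        using K(1)[OF p] K(2) L(1)[OF q] L(2) h1(1) b(1) by (intro mult_right_mono mult_left_mono) auto
      also have "(\<eta> * norm h * N p) * ((2 * L + 1) * N' q) * b + (K * N p) * (\<eta> * norm h * N' q) * b
          + (K * norm h * N p) * ((L + 1) * \<eta> * N' q) * b = ((C - 1) * \<eta>) * (norm h * (N p * N' q))"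
        by (simp add: C_def algebra_simps)
      also have "\<dots> \<le> \<epsilon> * (norm h * (N p * N' q))"
        using \<eta> K(1)[OF p] L(1)[OF q] by (intro mult_right_mono) (auto simp: algebra_simps)
      finally show ?thesis by (simp add: mult.assoc)
    qed
    then show "\<exists>\<delta>>0. \<forall>h. norm h < \<delta> \<and> x + h \<in> U \<longrightarrow> (\<forall>pq\<in>A \<times> A'.
        norm ((\<lambda>(p,q). B (F (x + h) p) (G (x + h) q)) pq - (\<lambda>(p,q). B (F x p) (G x q)) pq
          - (\<lambda>(p,q). B (dF h p) (G x q) + B (F x p) (dG h q)) pq) \<le> \<epsilon> * norm h * (\<lambda>(p,q). N p * N' q) pq)"
      using \<eta>(1) \<delta>(1) \<delta>'(1) by (intro exI[of _ \<delta>0]) (auto simp: \<delta>0_def)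
  qed (use K L b in simp)
qed

section \<open>Towers of higher derivatives\<close>

definition np :: "'e::real_normed_vector list \<Rightarrow> real" where
  "np vs = prod_list (map norm vs)"

lemma np_simps [simp]: "np [] = 1" "np (v # vs) = norm v * np vs" "np (us @ vs) = np us * np vs"
  by (simp_all add: np_def)

lemma np_nonneg: "0 \<le> np vs"
  by (induction vs) simp_all

text \<open>All derivatives are packed into one function on lists whose length is the order of
  differentiation. Consing a direction onto the list is then differentiation, and
  \<open>udiff\<close> also supplies the bounds of both neighbouring orders.\<close>

definition tower ::
  "'e::real_normed_vector set \<Rightarrow> ('e \<Rightarrow> 'e list \<Rightarrow> 'f::real_normed_vector) \<Rightarrow> ('e \<Rightarrow> 'f) \<Rightarrow> bool" where
  "tower U D f \<longleftrightarrow> open U \<and> (\<forall>x\<in>U. D x [] = f x \<and>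
    (\<forall>vs i. i < length vs \<longrightarrow> linear (\<lambda>v. D x (vs[i := v]))) \<and>
    (\<forall>k. udiff U x {vs. length vs = k} np D (\<lambda>h vs. D x (h # vs))))"

lemma smooth_on_tower: "smooth_on U f \<longleftrightarrow> (\<exists>D. tower U D f)"
proof
  assume "smooth_on U f"
  then have sm: "open U \<and> (\<exists>D. (\<forall>x\<in>U. D 0 x [] = f x) \<and>
      (\<forall>k. \<forall>x\<in>U. bounded_multilinear k (D k x)) \<and>
      (\<forall>k. \<forall>x\<in>U. \<forall>\<epsilon>>0. \<exists>\<delta>>0. \<forall>h. norm h < \<delta> \<and> x + h \<in> U \<longrightarrow>
        (\<forall>vs. length vs = k \<longrightarrow>
          norm (D k (x + h) vs - D k x vs - D (Suc k) x (h # vs)) \<le> \<epsilon> * norm h * np vs)))"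
    unfolding smooth_on_def np_def .
  note U = conjunct1[OF sm]
  from conjunct2[OF sm] obtain D where D: "(\<forall>x\<in>U. D 0 x [] = f x) \<and>
      (\<forall>k. \<forall>x\<in>U. bounded_multilinear k (D k x)) \<and>
      (\<forall>k. \<forall>x\<in>U. \<forall>\<epsilon>>0. \<exists>\<delta>>0. \<forall>h. norm h < \<delta> \<and> x + h \<in> U \<longrightarrow>
        (\<forall>vs. length vs = k \<longrightarrow>
          norm (D k (x + h) vs - D k x vs - D (Suc k) x (h # vs)) \<le> \<epsilon> * norm h * np vs))" ..
  have D0: "D 0 x [] = f x" if "x \<in> U" for x using conjunct1[OF D] that by (rule bspec)
  have ml: "bounded_multilinear k (D k x)" if "x \<in> U" for x k
    using conjunct1[OF conjunct2[OF D]] that by simp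
  have df: "\<exists>\<delta>>0. \<forall>h. norm h < \<delta> \<and> x + h \<in> U \<longrightarrow> (\<forall>vs. length vs = k \<longrightarrow>
      norm (D k (x + h) vs - D k x vs - D (Suc k) x (h # vs)) \<le> \<epsilon> * norm h * np vs)"
    if "x \<in> U" "\<epsilon> > 0" for k x \<epsilon>
    using conjunct2[OF conjunct2[OF D], rule_format, OF that, of k] by simp
  define E where "E x vs = D (length vs) x vs" for x vs
  have "udiff U x {vs. length vs = k} np E (\<lambda>h vs. E x (h # vs))" if x: "x \<in> U" for x k
  proof -
    obtain K where K: "\<And>vs. length vs = k \<Longrightarrow> norm (D k x vs) \<le> K * np vs"
      using ml[OF x, of k] unfolding bounded_multilinear_def np_def by blast
    obtain L where L: "\<And>vs. length vs = Suc k \<Longrightarrow> norm (D (Suc k) x vs) \<le> L * np vs"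
      using ml[OF x, of "Suc k"] unfolding bounded_multilinear_def np_def by blast
    show ?thesis
    \<comment> \<open>The constants in \<open>bounded_multilinear\<close> carry no sign, hence the
      maximum with 0.\<close>
    proof (rule udiffI[where K="max 0 (max K L)"])
      fix vs :: "'a list" and h assume "vs \<in> {vs. length vs = k}"
      then have vs: "length vs = k" by simp
      have "norm (E x vs) \<le> K * np vs" using K[OF vs] by (simp add: E_def vs)
      also have "\<dots> \<le> max 0 (max K L) * np vs" by (intro mult_right_mono np_nonneg) simp
      finally show "norm (E x vs) \<le> max 0 (max K L) * np vs" .
      have "norm (E x (h # vs)) \<le> L * (norm h * np vs)" using L[of "h # vs"] vs by (simp add: E_def)
      also have "\<dots> \<le> max 0 (max K L) * (norm h * np vs)"
        by (intro mult_right_mono mult_nonneg_nonneg np_nonneg norm_ge_zero) simp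
      finally show "norm (E x (h # vs)) \<le> max 0 (max K L) * norm h * np vs" by (simp add: mult.assoc)
    next
      fix \<epsilon> :: real assume "\<epsilon> > 0"
      then show "\<exists>\<delta>>0. \<forall>h. norm h < \<delta> \<and> x + h \<in> U \<longrightarrow> (\<forall>vs\<in>{vs. length vs = k}.
          norm (E (x + h) vs - E x vs - E x (h # vs)) \<le> \<epsilon> * norm h * np vs)"
        using df[OF x, of \<epsilon> k] by (auto simp: E_def)
    qed (simp_all add: np_nonneg)
  qed
  moreover have "linear (\<lambda>v. E x (vs[i := v]))" if "x \<in> U" "i < length vs" for x vs i
    using ml[OF that(1), of "length vs"] that(2) unfolding bounded_multilinear_def E_def by simp
  ultimately have "tower U E f" unfolding tower_def using U D0 by (simp add: E_def)
  then show "\<exists>D. tower U D f" by blast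
next
  assume "\<exists>D. tower U D f"
  then obtain D where U: "open U" and D0: "\<And>x. x \<in> U \<Longrightarrow> D x [] = f x"
    and lin: "\<And>x vs i. x \<in> U \<Longrightarrow> i < length vs \<Longrightarrow> linear (\<lambda>v. D x (vs[i := v]))"
    and ud: "\<And>x k. x \<in> U \<Longrightarrow> udiff U x {vs. length vs = k} np D (\<lambda>h vs. D x (h # vs))"
    unfolding tower_def by blast
  show "smooth_on U f"
    unfolding smooth_on_def
  proof (intro conjI exI[of _ "\<lambda>_. D"] ballI allI impI)
    show "bounded_multilinear k (D x)" if x: "x \<in> U" for k x
    proof -
      obtain K where "\<And>vs. vs \<in> {vs. length vs = k} \<Longrightarrow> norm (D x vs) \<le> K * np vs"
        using udiffE[OF ud[OF x, of k]] by metis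
      then show ?thesis unfolding bounded_multilinear_def np_def[symmetric] using lin[OF x] by auto
    qed
    fix k x and \<epsilon> :: real assume x: "x \<in> U" and "\<epsilon> > 0"
    then obtain \<delta> where "\<delta> > 0" "\<And>h p. norm h < \<delta> \<Longrightarrow> x + h \<in> U \<Longrightarrow> p \<in> {vs. length vs = k} \<Longrightarrow>
      norm (D (x + h) p - D x p - D x (h # p)) \<le> \<epsilon> * norm h * np p" using udiffD[OF ud[OF x]] by metis
    then show "\<exists>\<delta>>0. \<forall>h. norm h < \<delta> \<and> x + h \<in> U \<longrightarrow> (\<forall>vs. length vs = k \<longrightarrow>
        norm (D (x + h) vs - D x vs - D x (h # vs)) \<le> \<epsilon> * norm h * prod_list (map norm vs))"
      unfolding np_def[symmetric] by auto
  qed (use U D0 in auto)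
qed

lemma smooth_on_open: "smooth_on U f \<Longrightarrow> open U"
  by (simp add: smooth_on_def)

lemma smooth_on_subset:
  assumes "smooth_on U f" "open V" "V \<subseteq> U" shows "smooth_on V f"
proof -
  obtain D where D: "tower U D f" using assms(1) by (auto simp: smooth_on_tower)
  have "udiff V x A N F dF" if "udiff U x A N F dF" for x A N and F dF :: "'a \<Rightarrow> 'c list \<Rightarrow> 'b"
    using that assms(3) unfolding udiff_def by (metis subsetD)
  then have "udiff V x {vs. length vs = k} np D (\<lambda>h vs. D x (h # vs))" if "x \<in> V" for x k
    using D that assms(3) unfolding tower_def by blast
  then have "tower V D f" using D assms unfolding tower_def by auto
  then show ?thesis by (auto simp: smooth_on_tower)
qed

lemma smooth_on_imp_continuous_on:
  assumes "smooth_on U f" shows "continuous_on U f"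
proof (rule continuous_at_imp_continuous_on, rule ballI)
  fix x assume x: "x \<in> U"
  obtain D where D: "tower U D f" using assms by (auto simp: smooth_on_tower)
  then have U: "open U" and f: "\<And>x. x \<in> U \<Longrightarrow> D x [] = f x"
    and ud: "udiff U x {vs. length vs = 0} np D (\<lambda>h vs. D x (h # vs))" using x unfolding tower_def by blast+
  obtain K where K: "0 \<le> K" "\<And>p h. p \<in> {vs. length vs = 0} \<Longrightarrow> norm (D x (h # p)) \<le> K * norm h * np p"
    using udiffE[OF ud] by metis
  obtain \<delta> where \<delta>: "\<delta> > 0" "\<And>h p. norm h < \<delta> \<Longrightarrow> x + h \<in> U \<Longrightarrow> p \<in> {vs. length vs = 0} \<Longrightarrow>
      norm (D (x + h) p - D x p - D x (h # p)) \<le> 1 * norm h * np p"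
    using udiffD[OF ud, of 1] by (metis zero_less_one)
  obtain r where r: "r > 0" "ball x r \<subseteq> U" using U x by (meson open_contains_ball)
  show "isCont f x"
    unfolding isCont_def
  proof (rule LIM_zero_cancel, rule Lim_transform_bound)
    show "((\<lambda>y. (K + 1) * norm (y - x)) \<longlongrightarrow> 0) (at x)"
      by (rule tendsto_eq_intros refl | simp)+
    show "\<forall>\<^sub>F y in at x. norm (f y - f x) \<le> norm ((K + 1) * norm (y - x))"
      unfolding eventually_at
    proof (intro exI[of _ "min \<delta> r"] conjI ballI impI)
      fix y assume "y \<noteq> x \<and> dist y x < min \<delta> r"
      then have y: "norm (y - x) < \<delta>" "x + (y - x) \<in> U" using r(2) by (auto simp: dist_norm norm_minus_commute mem_ball)
      then have "norm (f y - f x - D x [y - x]) \<le> norm (y - x)"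
        using \<delta>(2)[of "y - x" "[]"] f x by simp
      moreover have "norm (D x [y - x]) \<le> K * norm (y - x)" using K(2)[of "[]"] by simp
      ultimately have "norm (f y - f x) \<le> (K + 1) * norm (y - x)"
        using norm_triangle_ineq[of "f y - f x - D x [y - x]" "D x [y - x]"] by (simp add: distrib_right)
      then show "norm (f y - f x) \<le> norm ((K + 1) * norm (y - x))" using K(1) by simp
    qed (use \<delta> r in auto)
  qed
qed

lemma smooth_on_affine:
  assumes "open U" "bounded_linear L" shows "smooth_on U (\<lambda>x. c + L x)"
proof -
  interpret L: bounded_linear L by fact
  define D where "D x vs = (case vs of [] \<Rightarrow> c + L x | [v] \<Rightarrow> L v | _ \<Rightarrow> 0)" for x vs
  obtain M where M: "0 \<le> M" "\<And>x. norm (L x) \<le> norm x * M" using L.nonneg_bounded by blast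
  have Mle: "norm (L v) \<le> (norm (c + L x) + M) * norm v" for v x
  proof -
    have "0 \<le> norm (c + L x) * norm v" by simp
    then show ?thesis using M(2)[of v] unfolding distrib_right mult.commute[of "norm v" M] by linarith
  qed
  have "udiff U x {vs. length vs = k} np D (\<lambda>h vs. D x (h # vs))" if "x \<in> U" for x k
  proof (rule udiffI[where K="norm (c + L x) + M"])
    fix vs :: "'a list" and h assume "vs \<in> {vs. length vs = k}"
    have "norm (D x vs) \<le> norm (c + L x) + M" if "vs = []" using that M by (simp add: D_def)
    moreover have "norm (D x [v]) \<le> (norm (c + L x) + M) * norm v" for v
      using Mle by (simp add: D_def)
    moreover have "0 \<le> (norm (c + L x) + M) * np vs" using M by (intro mult_nonneg_nonneg np_nonneg) simp
    ultimately show "norm (D x vs) \<le> (norm (c + L x) + M) * np vs"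
      by (cases vs; cases "tl vs") (auto simp: D_def)
    have "norm (D x [h]) \<le> (norm (c + L x) + M) * norm h"
      using Mle by (simp add: D_def)
    moreover have "0 \<le> (norm (c + L x) + M) * norm h * np vs"
      using M by (intro mult_nonneg_nonneg np_nonneg) simp_all
    ultimately show "norm (D x (h # vs)) \<le> (norm (c + L x) + M) * norm h * np vs"
      by (cases vs) (auto simp: D_def)
  next
    fix \<epsilon> :: real assume "\<epsilon> > 0"
    have "D (x + h) vs - D x vs - D x (h # vs) = 0" for h vs
      by (cases vs; cases "tl vs") (auto simp: D_def L.add)
    then show "\<exists>\<delta>>0. \<forall>h. norm h < \<delta> \<and> x + h \<in> U \<longrightarrow> (\<forall>vs\<in>{vs. length vs = k}.
          norm (D (x + h) vs - D x vs - D x (h # vs)) \<le> \<epsilon> * norm h * np vs)"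
      using \<open>\<epsilon> > 0\<close> by (intro exI[of _ 1]) (simp add: np_nonneg)
  qed (use M np_nonneg in auto)
  moreover have "linear (\<lambda>v. D x (vs[i := v]))" if i: "i < length vs" for x vs i
  proof -
    consider w where "vs = [w]" | a b ws where "vs = a # b # ws"
      using i by (cases vs; cases "tl vs") auto
    then show ?thesis
    proof cases
      case 1
      then show ?thesis using i by (simp add: D_def L.linear)
    next
      case 2
      then have "(\<lambda>v. D x (vs[i := v])) = (\<lambda>v. 0)"
        by (auto simp: D_def fun_eq_iff split: nat.split list.split)
      then show ?thesis by (simp add: linear_zero)
    qed
  qed
  ultimately have "tower U D (\<lambda>x. c + L x)" unfolding tower_def using assms(1) by (simp add: D_def)
  then show ?thesis by (auto simp: smooth_on_tower)
qed

lemma smooth_on_const: "open U \<Longrightarrow> smooth_on U (\<lambda>x. c)"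
  using smooth_on_affine[OF _ bounded_linear_zero, of U c] by simp

lemma smooth_on_linear: "open U \<Longrightarrow> bounded_linear L \<Longrightarrow> smooth_on U L"
  using smooth_on_affine[of U L 0] by simp

lemma smooth_on_add:
  assumes "smooth_on U f" "smooth_on U g" shows "smooth_on U (\<lambda>x. f x + g x)"
proof -
  obtain D E where "tower U D f" "tower U E g" using assms by (auto simp: smooth_on_tower)
  then have "tower U (\<lambda>x vs. D x vs + E x vs) (\<lambda>x. f x + g x)"
    unfolding tower_def by (auto intro!: linear_compose_add udiff_add)
  then show ?thesis by (auto simp: smooth_on_tower)
qed

subsection \<open>Leibniz rule\<close>

text \<open>The sum of \<open>B (F us') (G ws')\<close> over all ways to append each member of the list to \<open>us\<close> or to \<open>ws\<close>.\<close>

primrec leibniz :: "('f \<Rightarrow> 'g \<Rightarrow> 'h::real_normed_vector) \<Rightarrow> ('e list \<Rightarrow> 'f) \<Rightarrow> ('e list \<Rightarrow> 'g) \<Rightarrow> 'e list \<Rightarrow> 'e list \<Rightarrow> 'e list \<Rightarrow> 'h" where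
  "leibniz B F G us ws [] = B (F us) (G ws)"
| "leibniz B F G us ws (v # vs) = leibniz B F G (us @ [v]) ws vs + leibniz B F G us (ws @ [v]) vs"

text \<open>The three lists must be treated together, since a slot of \<open>vs\<close> becomes the
  last slot of \<open>us\<close> or of \<open>ws\<close> in the recursion.\<close>

lemma leibniz_linear:
  assumes B: "bounded_bilinear B"
    and F: "\<And>us i. i < length us \<Longrightarrow> linear (\<lambda>v. F (us[i := v]))"
    and G: "\<And>us i. i < length us \<Longrightarrow> linear (\<lambda>v. G (us[i := v]))"
  shows "(i < length us \<longrightarrow> linear (\<lambda>v. leibniz B F G (us[i := v]) ws vs)) \<and>
    (i < length ws \<longrightarrow> linear (\<lambda>v. leibniz B F G us (ws[i := v]) vs)) \<and>
    (i < length vs \<longrightarrow> linear (\<lambda>v. leibniz B F G us ws (vs[i := v])))"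
proof (induction vs arbitrary: us ws i)
  case Nil
  interpret B: bounded_bilinear B by (rule B)
  show ?case
    using linear_compose[OF F bounded_linear.linear[OF B.bounded_linear_left]]
      linear_compose[OF G bounded_linear.linear[OF B.bounded_linear_right]] by (simp add: o_def)
next
  case (Cons a vs)
  have "linear (\<lambda>v. leibniz B F G (us[i := v]) ws (a # vs))" if "i < length us"
  proof -
    have "linear (\<lambda>v. leibniz B F G ((us @ [a])[i := v]) ws vs)" using Cons[of i "us @ [a]"] that by simp
    moreover have "linear (\<lambda>v. leibniz B F G (us[i := v]) (ws @ [a]) vs)" using Cons that by blast
    ultimately show ?thesis using that by (simp add: linear_compose_add list_update_append1)
  qed
  moreover have "linear (\<lambda>v. leibniz B F G us (ws[i := v]) (a # vs))" if "i < length ws"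
  proof -
    have "linear (\<lambda>v. leibniz B F G us ((ws @ [a])[i := v]) vs)" using Cons[of i us "ws @ [a]"] that by simp
    moreover have "linear (\<lambda>v. leibniz B F G (us @ [a]) (ws[i := v]) vs)" using Cons that by blast
    ultimately show ?thesis using that by (simp add: linear_compose_add list_update_append1)
  qed
  moreover have "linear (\<lambda>v. leibniz B F G us ws ((a # vs)[i := v]))" if "i < length (a # vs)"
  proof (cases i)
    case 0
    have "linear (\<lambda>v. leibniz B F G ((us @ [a])[length us := v]) ws vs)"
      using Cons[of "length us" "us @ [a]"] by simp
    moreover have "linear (\<lambda>v. leibniz B F G us ((ws @ [a])[length ws := v]) vs)"
      using Cons[of "length ws" us "ws @ [a]"] by simp
    ultimately show ?thesis using 0 by (simp add: linear_compose_add)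
  next
    case (Suc j)
    then show ?thesis using Cons[of j "us @ [a]" ws] Cons[of j us "ws @ [a]"] that
      by (simp add: linear_compose_add)
  qed
  ultimately show ?case by blast
qed

lemma length_SucE:
  assumes "length vs = Suc k" obtains v ws where "vs = v # ws" "length ws = k"
  using assms by (auto simp: length_Suc_conv)

text \<open>Differentiation adds the new direction in front of \<open>us\<close> or
  \<open>ws\<close>, while the recursion appends at the end, so the two do not interfere. For empty
  \<open>us\<close> and \<open>ws\<close> the derivative is the Leibniz sum of the longer
  list.\<close>

lemma leibniz_udiff:
  assumes B: "bounded_bilinear B" and x: "x \<in> U"
    and F: "\<And>k. udiff U x {vs. length vs = k} np F (\<lambda>h vs. F x (h # vs))"
    and G: "\<And>k. udiff U x {vs. length vs = k} np G (\<lambda>h vs. G x (h # vs))"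
  shows "udiff U x {(us,ws,vs). length us = a \<and> length ws = b \<and> length vs = k}
    (\<lambda>(us,ws,vs). np us * np ws * np vs) (\<lambda>y (us,ws,vs). leibniz B (F y) (G y) us ws vs)
    (\<lambda>h (us,ws,vs). leibniz B (F x) (G x) (h # us) ws vs + leibniz B (F x) (G x) us (h # ws) vs)"
proof (induction k arbitrary: a b)
  case 0
  show ?case
    by (rule udiff_reindex[OF udiff_bilinear[OF B F[of a] G[of b]], of _ "\<lambda>(us,ws,vs). (us,ws)"])
      (auto simp: x)
next
  case (Suc k)
  let ?A = "{(us,ws,vs). length us = a \<and> length ws = b \<and> length vs = Suc k}"
  have 1: "udiff U x ?A (\<lambda>(us,ws,vs). np us * np ws * np vs)
      (\<lambda>y (us,ws,vs). leibniz B (F y) (G y) (us @ [hd vs]) ws (tl vs))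
      (\<lambda>h (us,ws,vs). leibniz B (F x) (G x) (h # us @ [hd vs]) ws (tl vs) + leibniz B (F x) (G x) (us @ [hd vs]) (h # ws) (tl vs))"
    by (rule udiff_reindex[OF Suc[of "Suc a" b], of _ "\<lambda>(us,ws,vs). (us @ [hd vs], ws, tl vs)"])
      (auto simp: x elim!: length_SucE)
  have 2: "udiff U x ?A (\<lambda>(us,ws,vs). np us * np ws * np vs)
      (\<lambda>y (us,ws,vs). leibniz B (F y) (G y) us (ws @ [hd vs]) (tl vs))
      (\<lambda>h (us,ws,vs). leibniz B (F x) (G x) (h # us) (ws @ [hd vs]) (tl vs) + leibniz B (F x) (G x) us (h # ws @ [hd vs]) (tl vs))"
    by (rule udiff_reindex[OF Suc[of a "Suc b"], of _ "\<lambda>(us,ws,vs). (us, ws @ [hd vs], tl vs)"])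
      (auto simp: x elim!: length_SucE)
  show ?case
    by (rule udiff_reindex[OF udiff_add[OF 1 2], of _ "\<lambda>p. p"]) (auto simp: x elim!: length_SucE)
qed

lemma smooth_on_bilinear:
  assumes B: "bounded_bilinear B" and "smooth_on U f" "smooth_on U g"
  shows "smooth_on U (\<lambda>x. B (f x) (g x))"
proof -
  obtain F G where F: "tower U F f" and G: "tower U G g" using assms by (auto simp: smooth_on_tower)
  have "tower U (\<lambda>x. leibniz B (F x) (G x) [] []) (\<lambda>x. B (f x) (g x))"
    unfolding tower_def
  proof (intro conjI ballI allI impI)
    show "open U" using F by (simp add: tower_def)
    fix x assume x: "x \<in> U"
    have Fl: "linear (\<lambda>v. F x (us[i := v]))" if "i < length us" for us i using F x that by (simp add: tower_def)
    have Gl: "linear (\<lambda>v. G x (us[i := v]))" if "i < length us" for us i using G x that by (simp add: tower_def)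
    have Fd: "udiff U x {vs. length vs = k} np F (\<lambda>h vs. F x (h # vs))" for k using F x by (simp add: tower_def)
    have Gd: "udiff U x {vs. length vs = k} np G (\<lambda>h vs. G x (h # vs))" for k using G x by (simp add: tower_def)
    show "leibniz B (F x) (G x) [] [] [] = B (f x) (g x)" using F G x by (simp add: tower_def)
    show "linear (\<lambda>v. leibniz B (F x) (G x) [] [] (vs[i := v]))" if "i < length vs" for vs i
      using leibniz_linear[OF B Fl Gl, of i "[]" "[]" vs] that by simp
    show "udiff U x {vs. length vs = k} np (\<lambda>x. leibniz B (F x) (G x) [] [])
        (\<lambda>h vs. leibniz B (F x) (G x) [] [] (h # vs))" for k
      by (rule udiff_reindex[OF leibniz_udiff[OF B x Fd Gd, of 0 0 k], of _ "\<lambda>vs. ([], [], vs)"])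
        (auto simp: x)
  qed
  then show ?thesis by (auto simp: smooth_on_tower)
qed

lemma smooth_on_mult:
  fixes f g :: "'e::real_normed_vector \<Rightarrow> 'a::real_normed_algebra"
  shows "smooth_on U f \<Longrightarrow> smooth_on U g \<Longrightarrow> smooth_on U (\<lambda>x. f x * g x)"
  by (rule smooth_on_bilinear[OF bounded_bilinear_mult])

lemma smooth_on_linear_compose:
  assumes "bounded_linear L" "smooth_on U f" shows "smooth_on U (\<lambda>x. L (f x))"
proof -
  \<comment> \<open>A linear map is this bilinear map at the constant scalar 1, so the Leibniz rule
    covers the composition.\<close>
  have "bounded_bilinear (\<lambda>(r::real) v. r *\<^sub>R L v)"
    using bounded_bilinear.comp[OF bounded_bilinear_scaleR bounded_linear_ident assms(1)] .
  from smooth_on_bilinear[OF this smooth_on_const[of U 1] assms(2)] smooth_on_open[OF assms(2)]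
  show ?thesis by simp
qed

lemma smooth_on_diff:
  assumes "smooth_on U f" "smooth_on U g" shows "smooth_on U (\<lambda>x. f x - g x)"
  using smooth_on_add[OF assms(1) smooth_on_linear_compose[OF bounded_linear_minus[OF bounded_linear_ident] assms(2)]]
  by simp

subsection \<open>Inversion\<close>

text \<open>A derivative of an inverse is a word in which inverses alternate with directions.
  Differentiating one of its inverses puts the new direction into that gap.\<close>

fun inserts :: "'a \<Rightarrow> 'a list \<Rightarrow> 'a list list" where
  "inserts h [] = [[h]]"
| "inserts h (u # w) = (h # u # w) # map ((#) u) (inserts h w)"

text \<open>The \<open>k\<close>-th derivative of an inverse is a sum over the orderings of its \<open>k\<close> arguments.\<close>

fun orderings :: "'a list \<Rightarrow> 'a list list" where
  "orderings [] = [[]]"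
| "orderings (h # vs) = concat (map (inserts h) (orderings vs))"

lemma sum_list_concat_map: "sum_list (map g (concat xss)) = (\<Sum>xs\<leftarrow>xss. sum_list (map g xs))"
  for g :: "'b \<Rightarrow> 'c::comm_monoid_add"
  by (induction xss) simp_all

lemma length_inserts: "length (inserts h w) = Suc (length w)"
  by (induction w) simp_all

lemma length_mem_inserts: "w' \<in> set (inserts h w) \<Longrightarrow> length w' = Suc (length w)"
  by (induction w arbitrary: w') auto

lemma np_mem_inserts: "w' \<in> set (inserts h w) \<Longrightarrow> np w' = norm h * np w"
  by (induction w arbitrary: w') auto

lemma orderings_mem: "w \<in> set (orderings vs) \<Longrightarrow> length w = length vs \<and> np w = np vs"
  by (induction vs arbitrary: w) (auto simp: length_mem_inserts np_mem_inserts)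

lemma length_mem_orderings: "w \<in> set (orderings vs) \<Longrightarrow> length w = length vs"
  by (induction vs arbitrary: w) (auto simp: length_mem_inserts)

lemma length_orderings: "length (orderings vs) = fact (length vs)"
proof (induction vs)
  case (Cons h vs)
  have "sum_list (map (length \<circ> inserts h) (orderings vs)) = sum_list (map (\<lambda>_. Suc (length vs)) (orderings vs))"
    by (intro arg_cong[where f = sum_list] map_cong refl) (auto simp: length_inserts dest!: length_mem_orderings)
  then show ?case by (simp add: length_concat sum_list_triv Cons)
qed simp

lemma linear_sum_list:
  "(\<And>y. y \<in> set ys \<Longrightarrow> linear (\<lambda>v. g v y)) \<Longrightarrow> linear (\<lambda>v. \<Sum>y\<leftarrow>ys. g v y)"
  by (induction ys) (auto intro: linear_compose_add simp: linear_zero)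

lemma linear_inserts:
  assumes "\<And>w i. i < length w \<Longrightarrow> linear (\<lambda>v. g (w[i := v]))"
  shows "linear (\<lambda>v. sum_list (map g (inserts v w)))"
    and "i < length w \<Longrightarrow> linear (\<lambda>v. sum_list (map g (inserts h (w[i := v]))))"
proof -
  show "linear (\<lambda>v. sum_list (map g (inserts v w)))" using assms
  proof (induction w arbitrary: g)
    case Nil
    \<comment> \<open>The placeholder only supplies a slot, which the list update
      overwrites.\<close>
    then show ?case using Nil[of 0 "[undefined]"] by simp
  next
    case (Cons u w)
    have "linear (\<lambda>v. sum_list (map (\<lambda>w. g (u # w)) (inserts v w)))"
      by (rule Cons.IH) (use Cons.prems[of "Suc _" "u # _"] in simp)
    moreover have "linear (\<lambda>v. g (v # u # w))" using Cons.prems[of 0 "undefined # u # w"] by simp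
    ultimately show ?case by (simp add: linear_compose_add o_def)
  qed
  show "i < length w \<Longrightarrow> linear (\<lambda>v. sum_list (map g (inserts h (w[i := v]))))" using assms
  proof (induction w arbitrary: g i)
    case (Cons u w)
    show ?case
    proof (cases i)
      case 0
      have "linear (\<lambda>v. \<Sum>w'\<leftarrow>inserts h w. g (v # w'))"
        by (rule linear_sum_list) (use Cons.prems(2)[of 0 "undefined # _"] in simp)
      moreover have "linear (\<lambda>v. g (h # v # w))" using Cons.prems(2)[of 1 "h # undefined # w"] by simp
      ultimately show ?thesis using 0 by (simp add: linear_compose_add o_def)
    next
      case (Suc j)
      have "linear (\<lambda>v. sum_list (map (\<lambda>w. g (u # w)) (inserts h (w[j := v]))))"
        by (rule Cons.IH) (use Cons.prems Suc Cons.prems(2)[of "Suc _" "u # _"] in auto)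
      moreover have "linear (\<lambda>v. g (h # u # w[j := v]))"
        using Cons.prems(2)[of "Suc (Suc j)" "h # u # w"] Cons.prems(1) Suc by simp
      ultimately show ?thesis using Suc by (simp add: linear_compose_add o_def)
    qed
  qed simp
qed

lemma linear_orderings:
  assumes "\<And>w i. i < length w \<Longrightarrow> linear (\<lambda>v. g (w[i := v]))" "i < length vs"
  shows "linear (\<lambda>v. sum_list (map g (orderings (vs[i := v]))))"
  using assms
proof (induction vs arbitrary: g i)
  case (Cons h vs)
  show ?case
  proof (cases i)
    case 0
    have "linear (\<lambda>v. \<Sum>w\<leftarrow>orderings vs. sum_list (map g (inserts v w)))"
      by (rule linear_sum_list) (rule linear_inserts(1)[OF Cons.prems(1)])
    then show ?thesis using 0 by (simp add: sum_list_concat_map o_def)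
  next
    case (Suc j)
    have "linear (\<lambda>v. sum_list (map (\<lambda>w. sum_list (map g (inserts h w))) (orderings (vs[j := v]))))"
    proof (rule Cons.IH)
      show "linear (\<lambda>v. sum_list (map g (inserts h (w[i := v]))))" if "i < length w" for w i
        using linear_inserts(2)[of g i w h] Cons.prems(1) that by blast
    qed (use Cons.prems Suc in simp)
    then show ?thesis using Suc by (simp add: sum_list_concat_map o_def)
  qed
qed simp

context
  fixes U :: "'e::real_normed_vector set" and c :: "'a::complex_hilbert bop" and L :: "'e \<Rightarrow> 'a bop"
  assumes L: "bounded_linear L" and inv: "\<And>x. x \<in> U \<Longrightarrow> invertible_op (c + L x)"
begin

interpretation L: bounded_linear L by (rule L)

private abbreviation r where "r x \<equiv> inv_op (c + L x)"

text \<open>The word \<open>r L u1 r L u2 ... L uk r\<close> with sign \<open>(-1)^k\<close>, one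
  summand of the \<open>k\<close>-th derivative of the inverse.\<close>

private primrec W where
  "W x [] = r x"
| "W x (u # w) = - (r x * L u) * W x w"

private lemma resolvent: "x \<in> U \<Longrightarrow> x + h \<in> U \<Longrightarrow> r (x + h) - r x = - (r (x + h) * L h * r x)"
proof -
  assume x: "x \<in> U" "x + h \<in> U"
  have "r (x + h) * L h * r x = r (x + h) * ((c + L (x + h)) - (c + L x)) * r x" by (simp add: L.add)
  also have "\<dots> = r x - r (x + h)"
    using inv_op_simps[OF inv[OF x(1)]] inv_op_simps[OF inv[OF x(2)]]
    by (simp only: right_diff_distrib left_diff_distrib mult.assoc mult_1_right)
      (simp only: mult.assoc[symmetric] mult_1_left)
  finally show ?thesis by simp
qed

text \<open>The resolvent identity first bounds the inverse at \<open>x + h\<close> by twice that at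
  \<open>x\<close>; applied twice it then exhibits an error of second order in
  \<open>h\<close>.\<close>

private lemma r_udiff: assumes x: "x \<in> U"
  shows "udiff U x (UNIV::unit set) (\<lambda>_. 1) (\<lambda>y _. r y) (\<lambda>h _. - (r x * L h * r x))"
proof -
  obtain M where M: "0 < M" "\<And>x. norm (L x) \<le> norm x * M" using L.pos_bounded by blast
  define \<rho> where "\<rho> = norm (r x)"
  have \<rho>: "\<rho> \<ge> 0" by (simp add: \<rho>_def)
  have b: "norm (a * L h * a') \<le> norm a * (norm h * M) * norm a'" for a a' h
    using M(1) by (intro order_trans[OF norm_mult_ineq] mult_mono mult_left_mono M) auto
  show ?thesis
  proof (rule udiffI[where K="\<rho> + \<rho> * M * \<rho>"])
    show "norm (r x) \<le> (\<rho> + \<rho> * M * \<rho>) * 1" using M \<rho> by (simp add: \<rho>_def)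
    show "norm (- (r x * L h * r x)) \<le> (\<rho> + \<rho> * M * \<rho>) * norm h * 1" for h
      using b[of "r x" h "r x"] \<rho> by (simp add: \<rho>_def[symmetric] algebra_simps add_increasing)
    fix \<epsilon> :: real assume \<epsilon>: "\<epsilon> > 0"
    \<comment> \<open>The error is at most \<open>(C - 1)\<close> times the square of the norm of
      \<open>h\<close>; the added 1 makes \<open>C\<close> positive. The second bound in
      \<open>\<delta>\<close> makes the norm of \<open>r (x + h)\<close> at most
      \<open>2 * \<rho>\<close>.\<close>
    define C where "C = 2 * \<rho> * M * \<rho> * M * \<rho> + 1"
    have C: "C > 0" using M \<rho> by (auto simp: C_def intro!: add_nonneg_pos)
    define \<delta> where "\<delta> = min (\<epsilon> / C) (1 / (2 * (M * \<rho> + 1)))"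
    have M\<rho>: "M * \<rho> + 1 > 0" using M \<rho> by (simp add: add_nonneg_pos)
    have \<delta>: "\<delta> > 0" using \<epsilon> C M\<rho> by (simp add: \<delta>_def)
    have "norm (r (x + h) - r x - - (r x * L h * r x)) \<le> \<epsilon> * norm h" if h: "norm h < \<delta>" "x + h \<in> U" for h
    proof -
      note res = resolvent[OF x h(2)]
      have "norm h * (2 * (M * \<rho> + 1)) \<le> 1" "norm h * C \<le> \<epsilon>"
        using h(1) C M\<rho> by (auto simp: \<delta>_def field_simps)
      moreover have "norm h * (2 * (M * \<rho> + 1)) = 2 * norm h + 2 * (norm h * (M * \<rho>))"
        by (simp add: algebra_simps)
      ultimately have h2: "norm h * (M * \<rho>) \<le> 1 / 2" "norm h * C \<le> \<epsilon>"
        using norm_ge_zero[of h] by linarith+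
      have "norm (r (x + h)) \<le> \<rho> + norm (r (x + h)) * (norm h * M) * \<rho>"
      proof -
        have "r (x + h) = r x + - (r (x + h) * L h * r x)" using res by (simp add: diff_eq_eq add.commute)
        then have "norm (r (x + h)) \<le> norm (r x) + norm (r (x + h) * L h * r x)"
          using norm_triangle_ineq[of "r x" "- (r (x + h) * L h * r x)"] by (simp only: norm_minus_cancel)
        then show ?thesis using b[of "r (x + h)" h "r x"] by (simp add: \<rho>_def)
      qed
      also have "norm (r (x + h)) * (norm h * M) * \<rho> = norm (r (x + h)) * (norm h * (M * \<rho>))" by simp
      also have "\<dots> \<le> norm (r (x + h)) * (1 / 2)" by (rule mult_left_mono[OF h2(1)]) simp
      finally have r': "norm (r (x + h)) \<le> 2 * \<rho>" by simp
      have "r (x + h) - r x - - (r x * L h * r x) = - ((r (x + h) - r x) * L h * r x)"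
        using res by (simp add: algebra_simps)
      also have "\<dots> = (r (x + h) * L h * r x) * L h * r x" unfolding res by simp
      also have "norm \<dots> \<le> norm (r (x + h) * L h * r x) * (norm h * M) * norm (r x)" by (rule b)
      also have "\<dots> \<le> (2 * \<rho> * (norm h * M) * \<rho>) * (norm h * M) * \<rho>"
        unfolding \<rho>_def[symmetric] using M(1) \<rho>
        by (intro mult_right_mono order_trans[OF b] order_trans[OF mult_right_mono[OF mult_right_mono[OF r']]])
          (auto simp: \<rho>_def)
      also have "\<dots> = ((C - 1) * norm h) * norm h" by (simp add: C_def)
      also have "\<dots> \<le> \<epsilon> * norm h"
        using h2(2) by (intro mult_right_mono) (auto simp: algebra_simps add_increasing2)
      finally show ?thesis .
    qed
    then show "\<exists>\<delta>>0. \<forall>h. norm h < \<delta> \<and> x + h \<in> U \<longrightarrow>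
        (\<forall>p\<in>UNIV. norm (r (x + h) - r x - - (r x * L h * r x)) \<le> \<epsilon> * norm h * 1)"
      using \<delta> by (intro exI[of _ \<delta>]) auto
  qed (use M \<rho> in auto)
qed

private lemma L_udiff: assumes x: "x \<in> U"
  shows "udiff U x UNIV norm (\<lambda>y u. L u) (\<lambda>h u. 0)"
proof -
  obtain M where M: "0 < M" "\<And>x. norm (L x) \<le> norm x * M" using L.pos_bounded by blast
  show ?thesis
  proof (rule udiffI[where K=M])
    fix \<epsilon> :: real assume "\<epsilon> > 0"
    then show "\<exists>\<delta>>0. \<forall>h. norm h < \<delta> \<and> x + h \<in> U \<longrightarrow> (\<forall>p\<in>UNIV. norm (L p - L p - 0) \<le> \<epsilon> * norm h * norm p)"
      by (intro exI[of _ 1]) simp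
  qed (use M in \<open>auto simp: mult.commute\<close>)
qed

private lemma W_udiff: assumes x: "x \<in> U"
  shows "udiff U x {w. length w = k} np W (\<lambda>h w. sum_list (map (W x) (inserts h w)))"
proof (induction k)
  case 0
  show ?case by (rule udiff_reindex[OF r_udiff[OF x], of _ "\<lambda>_. ()"]) (auto simp: x)
next
  case (Suc k)
  have neg: "bounded_bilinear (\<lambda>(a::'a bop) b. - a * b)"
    using bounded_bilinear.comp1[OF bounded_bilinear_mult bounded_linear_minus[OF bounded_linear_ident]] .
  note ud = udiff_bilinear[OF neg udiff_bilinear[OF bounded_bilinear_mult r_udiff[OF x] L_udiff[OF x]] Suc]
  show ?case
  proof (rule udiff_reindex[OF ud, of _ "\<lambda>w. (((), hd w), tl w)"])
    fix h and w :: "'e list" assume "w \<in> {w. length w = Suc k}"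
    then obtain u w' where w: "w = u # w'" by (auto simp: length_Suc_conv)
    show "sum_list (map (W x) (inserts h w)) = (\<lambda>(p, q). - (case p of (p, q) \<Rightarrow> - (r x * L h * r x) * L q + r x * 0) * W x q
        + - (case p of (p, q) \<Rightarrow> r x * L q) * sum_list (map (W x) (inserts h q))) (((), hd w), tl w)"
    proof -
      have "(\<Sum>w\<leftarrow>ws. - (r x * (L u * W x w))) = - (r x * (L u * sum_list (map (W x) ws)))" for ws
        by (induction ws) (simp_all add: distrib_left)
      then show ?thesis by (simp add: w o_def mult.assoc)
    qed
  qed (auto simp: x length_Suc_conv)
qed

private lemma W_linear: "i < length w \<Longrightarrow> linear (\<lambda>v. W x (w[i := v]))"
proof (induction w arbitrary: i)
  case (Cons u w)
  show ?case
  proof (cases i)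
    case 0
    have "bounded_linear (\<lambda>v. - (r x * L v) * W x w)"
      by (intro bounded_linear_compose[OF bounded_linear_mult_left] bounded_linear_minus
          bounded_linear_compose[OF bounded_linear_mult_right] L)
    then show ?thesis using 0 by (simp add: bounded_linear.linear)
  next
    case (Suc j)
    then have "linear (\<lambda>v. W x (w[j := v]))" using Cons by simp
    from linear_compose[OF this bounded_linear.linear[OF bounded_linear_mult_right[of "- (r x * L u)"]]]
    have "linear (\<lambda>v. - (r x * L u) * W x (w[j := v]))" unfolding o_def .
    then show ?thesis using Suc by simp
  qed
qed simp

text \<open>Inserting \<open>h\<close> into each word for an ordering of \<open>vs\<close> gives
  precisely the words for the orderings of \<open>h # vs\<close>, so these sums form a
  tower.\<close>

lemma smooth_on_inv_op: assumes "open U" shows "smooth_on U (\<lambda>x. inv_op (c + L x))"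
proof -
  define D where "D x vs = sum_list (map (W x) (orderings vs))" for x vs
  have "udiff U x {vs. length vs = k} np D (\<lambda>h vs. D x (h # vs))" if x: "x \<in> U" for x k
  proof -
    let ?dW = "\<lambda>h w. sum_list (map (W x) (inserts h w))"
    have dD: "D x (h # vs) = sum_list (map (?dW h) (orderings vs))" for h vs
      by (simp add: D_def sum_list_concat_map o_def)
    have bound: "norm (sum_list (map g (orderings vs))) \<le> fact (length vs) * C"
      if "\<And>w. length w = length vs \<Longrightarrow> np w = np vs \<Longrightarrow> norm (g w) \<le> C" for g :: "'e list \<Rightarrow> 'a bop" and vs C
    proof -
      have "norm (sum_list (map g ws)) \<le> real (length ws) * C" if "\<And>w. w \<in> set ws \<Longrightarrow> norm (g w) \<le> C" for ws
        using that
      proof (induction ws)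
        case (Cons w ws)
        then show ?case using norm_triangle_ineq[of "g w" "sum_list (map g ws)"]
          by (simp add: distrib_right) (smt (verit, best))
      qed simp
      from this[of "orderings vs"] show ?thesis
        using orderings_mem[of _ vs] that by (simp add: length_orderings)
    qed
    obtain K where K: "0 \<le> K" "\<And>w. w \<in> {w. length w = k} \<Longrightarrow> norm (W x w) \<le> K * np w"
      "\<And>w h. w \<in> {w. length w = k} \<Longrightarrow> norm (?dW h w) \<le> K * norm h * np w"
      using udiffE[OF W_udiff[OF x]] by metis
    show ?thesis
    proof (rule udiffI[where K="fact k * K"])
      fix vs :: "'e list" and h assume "vs \<in> {vs. length vs = k}"
      then have vs: "length vs = k" by simp
      show "norm (D x vs) \<le> fact k * K * np vs"
        unfolding D_def mult.assoc vs[symmetric] by (rule bound) (metis K(2) vs mem_Collect_eq)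
      show "norm (D x (h # vs)) \<le> fact k * K * norm h * np vs"
        unfolding dD mult.assoc[of "fact k"] vs[symmetric] by (simp only: mult.assoc[of "fact _"]) (rule bound, metis K(3) vs mem_Collect_eq)
    next
      fix \<epsilon> :: real assume "\<epsilon> > 0"
      \<comment> \<open>The error is shared among the \<open>fact k\<close> orderings.\<close>
      then have "\<epsilon> / fact k > 0" by simp
      from udiffD[OF W_udiff[OF x, of k] this] obtain \<delta> where \<delta>: "\<delta> > 0"
        "\<And>h w. norm h < \<delta> \<Longrightarrow> x + h \<in> U \<Longrightarrow> w \<in> {w. length w = k} \<Longrightarrow>
          norm (W (x + h) w - W x w - ?dW h w) \<le> \<epsilon> / fact k * norm h * np w" by metis
      have "norm (D (x + h) vs - D x vs - D x (h # vs)) \<le> \<epsilon> * norm h * np vs"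
        if h: "norm h < \<delta>" "x + h \<in> U" and vs: "length vs = k" for h vs
      proof -
        have "D (x + h) vs - D x vs - D x (h # vs) = sum_list (map (\<lambda>w. W (x + h) w - W x w - ?dW h w) (orderings vs))"
          unfolding dD unfolding D_def by (simp add: sum_list_subtractf)
        also have "norm \<dots> \<le> fact (length vs) * (\<epsilon> / fact k * norm h * np vs)"
          by (rule bound) (use \<delta>(2)[OF h] vs in \<open>metis mem_Collect_eq\<close>)
        finally show ?thesis by (simp add: vs)
      qed
      then show "\<exists>\<delta>>0. \<forall>h. norm h < \<delta> \<and> x + h \<in> U \<longrightarrow> (\<forall>vs\<in>{vs. length vs = k}.
          norm (D (x + h) vs - D x vs - D x (h # vs)) \<le> \<epsilon> * norm h * np vs)"
        using \<delta>(1) by (intro exI[of _ \<delta>]) auto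
    qed (use K np_nonneg in auto)
  qed
  moreover have "linear (\<lambda>v. D x (vs[i := v]))" if "i < length vs" for x vs i
    unfolding D_def by (rule linear_orderings[OF W_linear that])
  ultimately have "tower U D r" unfolding tower_def using assms by (simp add: D_def)
  then show ?thesis by (auto simp: smooth_on_tower)
qed

end

subsection \<open>One-parameter groups\<close>

text \<open>In one real variable the \<open>k\<close>-th derivative is \<open>T ^ k\<close> times
  the exponential, multiplied by the product of its real arguments.\<close>

lemma smooth_on_bexp:
  fixes T :: "'a::complex_hilbert bop"
  assumes "open I" shows "smooth_on I (\<lambda>t. bexp (t *\<^sub>R T))"
proof -
  define D where "D t vs = prod_list vs *\<^sub>R (T ^ length vs * bexp (t *\<^sub>R T))" for t :: real and vs
  have np: "np vs = \<bar>prod_list vs\<bar>" for vs :: "real list"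
    by (induction vs) (simp_all add: abs_mult)
  have "udiff I t {vs. length vs = k} np D (\<lambda>h vs. D t (h # vs))" for t k
  proof (rule udiffI[where K="norm (T ^ k * bexp (t *\<^sub>R T)) + norm (T ^ Suc k * bexp (t *\<^sub>R T))"])
    fix vs :: "real list" and h assume "vs \<in> {vs. length vs = k}"
    then have vs: "length vs = k" by simp
    show "norm (D t vs) \<le> (norm (T ^ k * bexp (t *\<^sub>R T)) + norm (T ^ Suc k * bexp (t *\<^sub>R T))) * np vs"
      by (simp add: D_def np vs distrib_left distrib_right mult_ac)
    show "norm (D t (h # vs)) \<le> (norm (T ^ k * bexp (t *\<^sub>R T)) + norm (T ^ Suc k * bexp (t *\<^sub>R T))) * norm h * np vs"
      by (simp add: D_def np vs abs_mult distrib_left distrib_right mult_ac)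
  next
    fix \<epsilon> :: real assume \<epsilon>: "\<epsilon> > 0"
    define \<eta> where "\<eta> = \<epsilon> / (norm (T ^ k) + 1)"
    have "norm (T ^ k) + 1 > 0" by (simp add: add_nonneg_pos)
    then have \<eta>: "\<eta> > 0" "norm (T ^ k) * \<eta> \<le> \<epsilon>"
      using \<epsilon> by (auto simp: \<eta>_def pos_divide_le_eq mult.commute intro!: mult_left_mono)
    have "((\<lambda>t. bexp (t *\<^sub>R T)) has_derivative (\<lambda>h. h *\<^sub>R (T * bexp (t *\<^sub>R T)))) (at t)"
      using bexp_has_vector_derivative[of T t UNIV] by (simp add: has_vector_derivative_def)
    then obtain \<delta> where \<delta>: "\<delta> > 0" "\<And>s. norm (s - t) < \<delta> \<Longrightarrow>
        norm (bexp (s *\<^sub>R T) - bexp (t *\<^sub>R T) - (s - t) *\<^sub>R (T * bexp (t *\<^sub>R T))) \<le> \<eta> * norm (s - t)"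
      unfolding has_derivative_at_alt using \<eta>(1) by blast
    have "norm (D (t + h) vs - D t vs - D t (h # vs)) \<le> \<epsilon> * norm h * np vs"
      if h: "norm h < \<delta>" and vs: "length vs = k" for h vs
    proof -
      have "D (t + h) vs - D t vs - D t (h # vs)
          = prod_list vs *\<^sub>R (T ^ k * (bexp ((t + h) *\<^sub>R T) - bexp (t *\<^sub>R T) - h *\<^sub>R (T * bexp (t *\<^sub>R T))))"
        by (simp add: D_def vs power_Suc2 right_diff_distrib scaleR_diff_right mult.assoc mult.commute[of h] del: power_Suc)
      also have "norm \<dots> \<le> np vs * (norm (T ^ k) * (\<eta> * norm h))"
        using \<delta>(2)[of "t + h"] h
        by (simp add: np) (intro mult_left_mono order_trans[OF norm_mult_ineq], auto)
      also have "\<dots> \<le> np vs * (\<epsilon> * norm h)"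
        using \<eta>(2) by (intro mult_left_mono np_nonneg) (simp add: mult.assoc[symmetric] mult_right_mono)
      finally show ?thesis by (simp add: mult_ac)
    qed
    then show "\<exists>\<delta>>0. \<forall>h. norm h < \<delta> \<and> t + h \<in> I \<longrightarrow> (\<forall>vs\<in>{vs. length vs = k}.
        norm (D (t + h) vs - D t vs - D t (h # vs)) \<le> \<epsilon> * norm h * np vs)"
      using \<delta>(1) by (intro exI[of _ \<delta>]) auto
  qed (simp_all add: np_nonneg)
  moreover have "linear (\<lambda>v. D t (vs[i := v]))" if "i < length vs" for t vs i
  proof -
    have "linear (\<lambda>v. prod_list (vs[i := v]))" using that
    proof (induction vs arbitrary: i)
      case (Cons a vs)
      show ?case
      proof (cases i)
        case 0
        then show ?thesis using bounded_linear.linear[OF bounded_linear_mult_left] by simp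
      next
        case (Suc j)
        then show ?thesis using linear_compose[OF Cons.IH bounded_linear.linear[OF bounded_linear_mult_right, of a]] Cons.prems
          by (simp add: o_def)
      qed
    qed simp
    from linear_compose[OF this bounded_linear.linear[OF bounded_linear_scaleR_left]] show ?thesis
      by (simp add: D_def o_def)
  qed
  ultimately have "tower I D (\<lambda>t. bexp (t *\<^sub>R T))" unfolding tower_def using assms by (simp add: D_def)
  then show ?thesis by (auto simp: smooth_on_tower)
qed

section \<open>Hilbert-Schmidt projections\<close>

subsection \<open>Rank-one operators\<close>

definition rank1 :: "'a::complex_hilbert \<Rightarrow> 'a \<Rightarrow> 'a bop" where
  "rank1 x y = (SOME T. \<forall>z. bapp T z = cinner y z *\<^sub>C x)"

lemma bapp_rank1: "bapp (rank1 x y) z = cinner y z *\<^sub>C x"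
proof -
  have "\<exists>T. \<forall>z. bapp T z = cinner y z *\<^sub>C x"
  proof (rule bop_of_linear)
    show "norm (cinner y z *\<^sub>C x) \<le> norm y * norm x * norm z" for z
      using mult_right_mono[OF norm_cinner_le[of y z] norm_ge_zero[of x]] by (simp add: mult_ac)
  qed (simp_all add: cinner_add_right cinner_scaleC_right scaleC_add_left scaleC_scaleC)
  then show ?thesis unfolding rank1_def by (rule someI2_ex) blast
qed

lemma rank1_simps:
  "adj (rank1 x y) = rank1 y x" "S * rank1 x y = rank1 (bapp S x) y"
  "rank1 x y * S = rank1 x (bapp (adj S) y)" "rank1 0 y = 0" "rank1 x 0 = 0"
  "rank1 (- x) y = - rank1 x y" "rank1 x (- y) = - rank1 x y"
proof -
  show "adj (rank1 x y) = rank1 y x"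
    by (rule adj_eqI) (simp add: bapp_rank1 cinner_scaleC_left cinner_scaleC_right cinner_commute[of _ x])
qed (rule bop_eqI, simp add: bapp_rank1 bapp_mult bapp_scaleC cinner_adj bapp_linear_simps cinner_minus_left)+

lemma hs_rank1: "hilbert_schmidt (rank1 x y)" "hs2 (rank1 x y) = (norm x)\<^sup>2 * (norm y)\<^sup>2"
proof -
  have "((\<lambda>e. (cmod (cinner y e))\<^sup>2 * (norm x)\<^sup>2) has_sum ((norm y)\<^sup>2 * (norm x)\<^sup>2)) onb"
    by (intro has_sum_cmult_left parseval')
  then have h: "((\<lambda>e. (norm (bapp (rank1 x y) e))\<^sup>2) has_sum ((norm x)\<^sup>2 * (norm y)\<^sup>2)) onb"
    by (simp add: bapp_rank1 power_mult_distrib mult.commute)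
  then show "hilbert_schmidt (rank1 x y)" by (auto simp: hilbert_schmidt_def summable_on_def)
  show "hs2 (rank1 x y) = (norm x)\<^sup>2 * (norm y)\<^sup>2" unfolding hs2_def by (rule infsumI[OF h])
qed

text \<open>The hypothesis makes the ranges orthogonal, so Pythagoras applies to each basis
  vector.\<close>

lemma hs2_add_orthogonal:
  assumes "hilbert_schmidt S" "hilbert_schmidt T" "adj S * T = 0"
  shows "hs2 (S + T) = hs2 S + hs2 T"
proof -
  have "((\<lambda>e. (norm (bapp S e))\<^sup>2 + (norm (bapp T e))\<^sup>2) has_sum (hs2 S + hs2 T)) onb"
    by (intro has_sum_add has_sum_hs2 assms)
  moreover have "(norm (bapp (S + T) e))\<^sup>2 = (norm (bapp S e))\<^sup>2 + (norm (bapp T e))\<^sup>2" for e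
  proof -
    have "cinner (bapp S e) (bapp T e) = cinner e (bapp (adj S * T) e)" by (simp add: bapp_mult cinner_adj')
    then have "inner (bapp S e) (bapp T e) = 0"
      by (simp add: assms(3) bapp_linear_simps Re_cinner[symmetric])
    then show ?thesis
      by (simp add: power2_norm_eq_inner inner_add_left inner_add_right inner_commute bapp_linear_simps)
  qed
  ultimately have "((\<lambda>e. (norm (bapp (S + T) e))\<^sup>2) has_sum (hs2 S + hs2 T)) onb" by simp
  then show ?thesis unfolding hs2_def[of "S + T"] by (rule infsumI)
qed

subsection \<open>Compactness of the range\<close>

definition hs_proj :: "'a::complex_hilbert bop \<Rightarrow> bool" where
  "hs_proj P \<longleftrightarrow> adj P = P \<and> P * P = P \<and> hilbert_schmidt P"

lemma hs_projD:
  assumes "hs_proj P" shows "adj P = P" "P * P = P" "P * (P * T) = P * T" "hilbert_schmidt P"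
  using assms by (simp_all add: hs_proj_def mult.assoc[symmetric])

lemma hs_proj_bapp: "hs_proj P \<Longrightarrow> bapp P (bapp P x) = bapp P x"
  by (simp add: bapp_mult[symmetric] hs_projD)

lemma hs_proj_cinner: "hs_proj P \<Longrightarrow> cinner (bapp P x) y = cinner x (bapp P y)"
  using cinner_adj[of P x y] by (simp add: hs_projD)

lemma hs_proj_inner: "hs_proj P \<Longrightarrow> inner (bapp P x) y = inner x (bapp P y)"
  using hs_proj_cinner[of P x y] by (simp add: Re_cinner[symmetric])

lemma norm_hs_proj: assumes "hs_proj P" shows "norm (bapp P x) \<le> norm x"
proof (cases "bapp P x = 0")
  case False
  have "(norm (bapp P x))\<^sup>2 = inner x (bapp P x)"
    using assms by (simp add: power2_norm_eq_inner hs_proj_inner hs_proj_bapp)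
  also have "\<dots> \<le> norm x * norm (bapp P x)" by (rule norm_cauchy_schwarz)
  finally show ?thesis using False by (simp add: power2_eq_square)
qed simp

lemma hs_proj_unitary:
  assumes P: "hs_proj P" and u: "unitary_op u" shows "hs_proj (u * P * adj u)"
  unfolding hs_proj_def[of "u * P * adj u"] using hs_projD[OF P]
  by (simp add: unitary_op_simps[OF u] mult.assoc hs_mult_left hs_mult_right)

text \<open>One induction step on the rank: each dimension split off accounts for exactly 1 in
  \<open>hs2\<close>.\<close>

lemma hs_proj_split:
  assumes P: "hs_proj P" and e: "bapp P e = e" "norm e = 1"
  shows "hs_proj (P - rank1 e e)" "hs2 (P - rank1 e e) = hs2 P - 1"
proof -
  have c: "cinner e e = 1" by (simp add: cinner_self e)
  show pr: "hs_proj (P - rank1 e e)"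
    using P unfolding hs_proj_def
    by (simp add: rank1_simps bapp_rank1 bapp_linear_simps algebra_simps hs_diff hs_rank1 e c)
  have "hs2 ((P - rank1 e e) + rank1 e e) = hs2 (P - rank1 e e) + hs2 (rank1 e e)"
    using hs_projD[OF pr] by (intro hs2_add_orthogonal hs_rank1)
      (simp_all add: rank1_simps bapp_rank1 bapp_linear_simps e c)
  then show "hs2 (P - rank1 e e) = hs2 P - 1" by (simp add: hs_rank1 e)
qed

lemma hs_proj_nonzero:
  assumes "hs_proj P" "P \<noteq> 0" obtains e where "bapp P e = e" "norm e = 1"
proof -
  obtain x where x: "bapp P x \<noteq> 0" using assms(2) bop_eqI[of P 0] by (auto simp: bapp_linear_simps)
  show ?thesis
    using that[of "(1 / norm (bapp P x)) *\<^sub>R bapp P x"] x assms(1)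
    by (simp add: bapp_vec_simps hs_proj_bapp)
qed

lemma hs_proj_ge_1: assumes "hs_proj P" "P \<noteq> 0" shows "hs2 P \<ge> 1"
proof -
  obtain e where "bapp P e = e" "norm e = 1" using hs_proj_nonzero[OF assms] .
  from hs_proj_split(2)[OF assms(1) this] show ?thesis using hs2_nonneg[of "P - rank1 e e"] by simp
qed

text \<open>Induction on an integer bound for \<open>hs2 P\<close>: the unit ball of the range is a
  closed part of the continuous image of a smaller such ball times the complex unit disc.\<close>

lemma hs_proj_unit_ball_compact:
  assumes "hs_proj P" shows "compact {x. bapp P x = x \<and> norm x \<le> 1}"
proof -
  obtain n :: nat where "hs2 P \<le> n" using real_arch_simple by blast
  with assms show ?thesis
  proof (induction n arbitrary: P)
    case 0
    then have "P = 0" using hs_proj_ge_1[of P] by fastforce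
    then have "{x. bapp P x = x \<and> norm x \<le> 1} = {0}" by (auto simp: bapp_linear_simps)
    then show ?case by simp
  next
    case (Suc n)
    show ?case
    proof (cases "P = 0")
      case True
      then have "{x. bapp P x = x \<and> norm x \<le> 1} = {0}" by (auto simp: bapp_linear_simps)
      then show ?thesis by simp
    next
      case False
      then obtain e where e: "bapp P e = e" "norm e = 1" using hs_proj_nonzero[OF Suc.prems(1)] by blast
      let ?P' = "P - rank1 e e"
      note P' = hs_proj_split[OF Suc.prems(1) e]
      let ?K = "{x. bapp ?P' x = x \<and> norm x \<le> 1}"
      have K: "compact ((\<lambda>(y,c). y + c *\<^sub>C e) ` (?K \<times> cball (0::complex) 1))"
      proof (rule compact_continuous_image)
        have "bounded_linear (\<lambda>c. c *\<^sub>C e)"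
          by (rule bounded_linear_intro[where K="norm e"])
            (simp_all add: scaleC_add_left scaleC_of_real[symmetric] scaleC_scaleC scaleR_conv_of_real)
        note c = bounded_linear.continuous_on[OF this]
        show "continuous_on (?K \<times> cball (0::complex) 1) (\<lambda>(y,c). y + c *\<^sub>C e)"
          unfolding case_prod_unfold by (intro continuous_intros c)
        show "compact (?K \<times> cball (0::complex) 1)"
          using Suc.IH[OF P'(1)] P'(2) Suc.prems(2) by (intro compact_Times compact_cball) simp
      qed
      have cl: "closed {x. bapp P x = x \<and> norm x \<le> 1}"
        by (intro closed_Collect_conj closed_Collect_eq closed_Collect_le continuous_intros
            linear_continuous_on bounded_linear_bapp)
      have sub: "{x. bapp P x = x \<and> norm x \<le> 1} \<subseteq> (\<lambda>(y,c). y + c *\<^sub>C e) ` (?K \<times> cball (0::complex) 1)"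
      proof
        fix x assume "x \<in> {x. bapp P x = x \<and> norm x \<le> 1}"
        then have x: "bapp P x = x" "norm x \<le> 1" by auto
        have "x = bapp ?P' x + cinner e x *\<^sub>C e" by (simp add: bapp_linear_simps bapp_rank1 x)
        moreover have "bapp ?P' x \<in> ?K"
          using hs_proj_bapp[OF P'(1), of x] norm_hs_proj[OF P'(1), of x] x by simp
        moreover have "cinner e x \<in> cball 0 1" using norm_cinner_le[of e x] e x by simp
        ultimately show "x \<in> (\<lambda>(y,c). y + c *\<^sub>C e) ` (?K \<times> cball (0::complex) 1)" by force
      qed
      from compact_Int_closed[OF K cl] show ?thesis unfolding Int_absorb1[OF sub] .
    qed
  qed
qed

lemma hs_proj_unit_sphere_compact:
  assumes "hs_proj P" shows "compact {x. bapp P x = x \<and> norm x = 1}"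
proof -
  have "compact ({x. bapp P x = x \<and> norm x \<le> 1} \<inter> {x. norm x = 1})"
    by (intro compact_Int_closed hs_proj_unit_ball_compact assms closed_Collect_eq continuous_intros)
  moreover have "{x. bapp P x = x \<and> norm x \<le> 1} \<inter> {x. norm x = 1} = {x. bapp P x = x \<and> norm x = 1}" by auto
  ultimately show ?thesis by simp
qed

subsection \<open>Principal angles\<close>

text \<open>The rotating vector solves \<open>y' = T y\<close>, so applying the inverse exponential
  to it gives a constant.\<close>

lemma bexp_rotation:
  fixes T :: "'a::complex_hilbert bop"
  assumes "bapp T e = \<theta> *\<^sub>R g" "bapp T g = - \<theta> *\<^sub>R e"
  shows "bapp (bexp T) e = cos \<theta> *\<^sub>R e + sin \<theta> *\<^sub>R g"
proof -
  let ?E = "\<lambda>t. bexp (t *\<^sub>R (- T))" and ?y = "\<lambda>t. cos (t * \<theta>) *\<^sub>R e + sin (t * \<theta>) *\<^sub>R g"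
  have "bapp (?E 1) (?y 1) = bapp (?E 0) (?y 0)"
  proof (rule const_if_has_vector_derivative_0[of "\<lambda>t. bapp (?E t) (?y t)"])
    fix t :: real
    have y: "(?y has_vector_derivative (- (sin (t * \<theta>) * \<theta>)) *\<^sub>R e + (cos (t * \<theta>) * \<theta>) *\<^sub>R g) (at t within {0..1})"
      by (auto intro!: derivative_eq_intros simp: has_vector_derivative_def algebra_simps)
    have c: "- T * ?E t = ?E t * - T" by (rule bexp_commute) simp
    have Ty: "bapp (- T) (?y t) = - ((- (sin (t * \<theta>) * \<theta>)) *\<^sub>R e + (cos (t * \<theta>) * \<theta>) *\<^sub>R g)"
      by (simp add: bapp_linear_simps bapp_vec_simps assms mult.commute)
    have z: "bapp (?E t) ((- (sin (t * \<theta>) * \<theta>)) *\<^sub>R e + (cos (t * \<theta>) * \<theta>) *\<^sub>R g) + bapp (- T * ?E t) (?y t) = 0"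
      unfolding c bapp_mult Ty bapp_vec_simps(3) by (rule right_minus)
    show "((\<lambda>t. bapp (?E t) (?y t)) has_vector_derivative 0) (at t within {0..1})"
      using bounded_bilinear.has_vector_derivative[OF bounded_bilinear_bapp bexp_has_vector_derivative[of "- T" t] y]
      unfolding z .
  qed simp
  then have "bapp (bexp (- T)) (?y 1) = e" by (simp add: bapp_one)
  then have "bapp (bexp T) e = bapp (bexp T * bexp (- T)) (?y 1)" by (simp add: bapp_mult)
  then show ?thesis by (simp add: bexp_minus_mult bapp_one)
qed

lemma bexp_fix: assumes "bapp T x = 0" shows "bapp (bexp T) x = x"
  using bexp_rotation[of T x 0 0] assms by (simp add: bapp_vec_simps)

text \<open>Two unit vectors in the ranges of \<open>P\<close> and \<open>Q\<close> that enclose the smallest angle span the same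
  complex line or a plane, which is then split off.\<close>

lemma principal_vectors:
  assumes P: "hs_proj P" "P \<noteq> 0" and Q: "hs_proj Q" "Q \<noteq> 0"
  obtains e f s where "bapp P e = e" "norm e = 1" "bapp Q f = f" "norm f = 1"
    "bapp P f = s *\<^sub>R e" "bapp Q e = s *\<^sub>R f" "0 \<le> s" "s \<le> 1"
proof -
  let ?KP = "{x. bapp P x = x \<and> norm x = 1}" and ?KQ = "{x. bapp Q x = x \<and> norm x = 1}"
  obtain e0 where e0: "bapp P e0 = e0" "norm e0 = 1" by (rule hs_proj_nonzero[OF P])
  obtain f0 where f0: "bapp Q f0 = f0" "norm f0 = 1" by (rule hs_proj_nonzero[OF Q])
  have "compact (?KP \<times> ?KQ)" by (intro compact_Times hs_proj_unit_sphere_compact P Q)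
  moreover have "?KP \<times> ?KQ \<noteq> {}" using e0 f0 by auto
  moreover have "continuous_on (?KP \<times> ?KQ) (\<lambda>z. inner (fst z) (snd z))" by (intro continuous_intros)
  ultimately have "\<exists>z\<in>?KP \<times> ?KQ. \<forall>y\<in>?KP \<times> ?KQ. inner (fst y) (snd y) \<le> inner (fst z) (snd z)"
    by (rule continuous_attains_sup)
  then obtain e f where e: "bapp P e = e" "norm e = 1" and f: "bapp Q f = f" "norm f = 1"
    and max: "\<And>x y. bapp P x = x \<Longrightarrow> norm x = 1 \<Longrightarrow> bapp Q y = y \<Longrightarrow> norm y = 1 \<Longrightarrow> inner x y \<le> inner e f"
    by auto
  define s where "s = inner e f"
  \<comment> \<open>The vector \<open>- e\<close> competes in the maximum as well.\<close>
  have s0: "0 \<le> s" using max[of "- e" f] e f by (simp add: bapp_vec_simps s_def)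
  have s1: "s \<le> 1" using norm_cauchy_schwarz[of e f] e f by (simp add: s_def)
  \<comment> \<open>The normalized \<open>bapp P f\<close> competes with \<open>e\<close>, so its
    length is at most \<open>s\<close>; its component along \<open>e\<close> is \<open>s\<close>
    already, and nothing is left for the rest. The claim is kept general because it is applied again
    with the roles exchanged.\<close>
  have key: "bapp P f = s *\<^sub>R e"
    if P: "hs_proj P" and e: "bapp P e = e" "norm e = 1" and s: "s = inner e f"
      and max: "\<And>x. bapp P x = x \<Longrightarrow> norm x = 1 \<Longrightarrow> inner x f \<le> s" for P e f
  proof -
    let ?x = "bapp P f"
    have xf: "inner ?x f = (norm ?x)\<^sup>2"
      using P by (simp add: power2_norm_eq_inner hs_proj_inner hs_proj_bapp)
    have ex: "inner e ?x = s" using hs_proj_inner[OF P, of e f] e s by simp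
    have "norm ?x \<le> s"
    proof (cases "?x = 0")
      case False
      have "inner ((1 / norm ?x) *\<^sub>R ?x) f \<le> s"
        by (rule max) (use False P in \<open>simp_all add: bapp_vec_simps hs_proj_bapp\<close>)
      then show ?thesis using False by (simp add: xf power2_eq_square)
    qed (use s0 in simp)
    then have "(norm ?x)\<^sup>2 \<le> s\<^sup>2" by (intro power_mono) auto
    moreover have "(norm (?x - s *\<^sub>R e))\<^sup>2 = (norm ?x)\<^sup>2 - s\<^sup>2"
    proof -
      have "inner e e = 1" using e by (simp add: power2_norm_eq_inner[symmetric])
      then show ?thesis unfolding power2_norm_eq_inner
        using ex inner_commute[of ?x e] by (simp add: inner_diff_left inner_diff_right power2_eq_square)
    qed
    ultimately have "(norm (?x - s *\<^sub>R e))\<^sup>2 \<le> 0" by simp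
    then show ?thesis by simp
  qed
  have "bapp P f = s *\<^sub>R e" by (rule key[OF P(1) e]) (use max f in \<open>auto simp: s_def\<close>)
  moreover have "bapp Q e = s *\<^sub>R f"
  proof (rule key[OF Q(1) f])
    show "s = inner f e" by (simp add: s_def inner_commute)
    show "inner x e \<le> s" if "bapp Q x = x" "norm x = 1" for x
      using max[OF e that] by (simp add: s_def inner_commute[of x])
  qed
  ultimately show ?thesis using that e f s0 s1 by blast
qed

text \<open>Vanishing on the common kernel carries the induction: the generator for the remaining
  projections annihilates the plane just split off, so both generators have product zero and their
  exponentials multiply. The final alternative says that the rotated \<open>P\<close> lies below
  \<open>Q\<close> or above it, depending on which of the two is exhausted.\<close>

lemma principal_rotation:
  assumes "hs_proj P" "hs_proj Q"
  shows "\<exists>T. adj T = - T \<and> P * T + T * P = T \<and> (\<forall>x. bapp P x = 0 \<longrightarrow> bapp Q x = 0 \<longrightarrow> bapp T x = 0) \<and>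
    (bexp T * P * bexp (- T) * Q = bexp T * P * bexp (- T) \<or> bexp T * P * bexp (- T) * Q = Q)"
proof -
  obtain n :: nat where "hs2 P \<le> n" using real_arch_simple by blast
  with assms show ?thesis
  proof (induction n arbitrary: P Q)
    case 0
    then have "P = 0" using hs_proj_ge_1[of P] by fastforce
    then show ?case by (intro exI[of _ 0]) (simp add: bapp_linear_simps)
  next
    case (Suc n)
    note P = Suc.prems(1) and Q = Suc.prems(2)
    show ?case
    proof (cases "P = 0 \<or> Q = 0")
      case True
      then show ?thesis by (intro exI[of _ 0]) (auto simp: bapp_linear_simps)
    next
      case False
      then obtain e f s where e: "bapp P e = e" "norm e = 1" and f: "bapp Q f = f" "norm f = 1"
        and Pf: "bapp P f = s *\<^sub>R e" and Qe: "bapp Q e = s *\<^sub>R f" and s: "0 \<le> s" "s \<le> 1"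
        using principal_vectors[OF P _ Q] by metis
      let ?P = "P - rank1 e e" and ?Q = "Q - rank1 f f"
      note P' = hs_proj_split[OF P e] and Q' = hs_proj_split[OF Q f]
      have "hs2 ?P \<le> real n" using P'(2) Suc.prems(3) by simp
      from Suc.IH[OF P'(1) Q'(1) this] obtain T' where T': "adj T' = - T'" "?P * T' + T' * ?P = T'"
        "\<And>x. bapp ?P x = 0 \<Longrightarrow> bapp ?Q x = 0 \<Longrightarrow> bapp T' x = 0"
        "bexp T' * ?P * bexp (- T') * ?Q = bexp T' * ?P * bexp (- T') \<or> bexp T' * ?P * bexp (- T') * ?Q = ?Q"
        by blast
      have ee: "cinner e e = 1" "cinner f f = 1" using e f by (simp_all add: cinner_self)
      have ef: "cinner e f = s"
        using hs_proj_cinner[OF P, of e f] by (simp add: e Pf cinner_scaleR ee)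
      have fe: "cinner f e = s" using cinner_commute[of f e] ef by simp
      define \<theta> where "\<theta> = arccos s"
      have cs: "cos \<theta> = s" "sin \<theta> = sqrt (1 - s\<^sup>2)"
        using s by (simp_all add: \<theta>_def sin_arccos)
      \<comment> \<open>The direction in the plane of \<open>e\<close> and \<open>f\<close>
        orthogonal to \<open>e\<close>. For \<open>s = 1\<close> the quotient is 0 by convention, so
        \<open>g = 0\<close>, in agreement with \<open>f = e\<close>.\<close>
      define g where "g = (1 / sin \<theta>) *\<^sub>R (f - s *\<^sub>R e)"
      have nf: "(norm (f - s *\<^sub>R e))\<^sup>2 = 1 - s\<^sup>2"
      proof -
        have "inner e e = 1" "inner f f = 1" "inner e f = s" "inner f e = s"
          using ee ef fe by (simp_all add: Re_cinner[symmetric])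
        then show ?thesis unfolding power2_norm_eq_inner
          by (simp add: inner_diff_left inner_diff_right power2_eq_square)
      qed
      have fg: "f = cos \<theta> *\<^sub>R e + sin \<theta> *\<^sub>R g"
      proof (cases "sin \<theta> = 0")
        case True
        then have "f - s *\<^sub>R e = 0" using nf s by (simp add: cs)
        then show ?thesis using True by (simp add: cs)
      qed (simp add: g_def cs)
      have eg: "cinner e g = 0" "cinner g e = 0"
        by (simp_all add: g_def cinner_scaleR cinner_diff_left cinner_diff_right ee ef fe)
      have gg: "\<theta> = 0 \<or> cinner g g = 1"
      proof (cases "s = 1")
        case False
        then have "1 - s\<^sup>2 > 0" using s by (simp add: power2_eq_square mult_le_one[of s s] less_le abs_square_eq_1[unfolded power2_eq_square])
        then have "sin \<theta> > 0" "(sin \<theta>)\<^sup>2 = 1 - s\<^sup>2" by (simp_all add: cs)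
        with \<open>1 - s\<^sup>2 > 0\<close> have "(norm g)\<^sup>2 = 1" by (simp add: g_def power_divide nf power_mult_distrib)
        then show ?thesis by (simp add: cinner_self del: of_real_power)
      qed (simp add: \<theta>_def)
      have Pg: "bapp P g = 0" by (simp add: g_def bapp_vec_simps Pf e)
      \<comment> \<open>The skew generator that turns \<open>e\<close> towards \<open>g\<close>
        through the angle \<open>\<theta>\<close>, which takes it to \<open>f\<close>. It is
        co-diagonal because \<open>P\<close> fixes \<open>e\<close> and kills
        \<open>g\<close>.\<close>
      define T0 where "T0 = \<theta> *\<^sub>R (rank1 g e - rank1 e g)"
      have T0e: "bapp T0 e = \<theta> *\<^sub>R g" "bapp T0 g = - \<theta> *\<^sub>R e"
        using gg by (auto simp: T0_def bapp_linear_simps bapp_rank1 ee eg)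
      have P'e: "bapp ?P e = 0" "bapp ?P f = 0" and Q'e: "bapp ?Q e = 0" "bapp ?Q f = 0"
        by (simp_all add: bapp_linear_simps bapp_rank1 e f Pf Qe ee ef fe scaleC_of_real)
      then have P'g: "bapp ?P g = 0" "bapp ?Q g = 0" by (simp_all add: g_def bapp_vec_simps)
      have T'0: "bapp T' e = 0" "bapp T' f = 0" "bapp T' g = 0" using T'(3) P'e Q'e P'g by blast+
      have TT: "T' * T0 = 0" "T0 * T' = 0"
        by (simp_all add: T0_def right_diff_distrib left_diff_distrib rank1_simps T'0 T'(1) bapp_linear_simps)
      define T where "T = T' + T0"
      have bT: "bexp T = bexp T' * bexp T0" unfolding T_def by (rule bexp_add) (simp add: TT)
      have adjT0: "adj T0 = - T0" by (simp add: T0_def rank1_simps algebra_simps)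
      then have adjT: "adj T = - T" by (simp add: T_def T'(1))
      have adjE: "adj (bexp T) = bexp (- T)" by (simp add: adj_bexp adjT)
      have bTe: "bapp (bexp T) e = f"
        unfolding bT bapp_mult using bexp_rotation[OF T0e] fg bexp_fix[OF T'0(2)] by simp
      \<comment> \<open>The range of the remaining projection is orthogonal to \<open>e\<close> and
        \<open>g\<close>, so \<open>T0\<close> vanishes there.\<close>
      have E0P: "bexp T0 * ?P = ?P"
      proof (rule bop_eqI)
        fix x
        have "cinner e (bapp ?P x) = 0" "cinner g (bapp ?P x) = 0"
          using hs_proj_cinner[OF P'(1), of e x] hs_proj_cinner[OF P'(1), of g x] P'e P'g by simp_all
        then have "bapp T0 (bapp ?P x) = 0"
          unfolding T0_def by (simp add: bapp_linear_simps(2,5) bapp_rank1)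
        then show "bapp (bexp T0 * ?P) x = bapp ?P x" by (simp only: bapp_mult bexp_fix)
      qed
      have PE0: "?P * bexp (- T0) = ?P"
        using arg_cong[OF E0P, of adj] hs_projD(1)[OF P'(1)] by (simp only: adj_simps(2) adj_bexp adjT0)
      let ?R' = "bexp T' * ?P * bexp (- T')"
      have "- T = - T0 + - T'" by (simp add: T_def)
      moreover have "bexp (- T0 + - T') = bexp (- T0) * bexp (- T')" by (rule bexp_add) (simp add: TT)
      ultimately have bmT: "bexp (- T) = bexp (- T0) * bexp (- T')" by simp
      have "bexp T * ?P * bexp (- T) = bexp T' * (bexp T0 * ?P) * bexp (- T0) * bexp (- T')"
        unfolding bT bmT by (simp only: mult.assoc)
      also have "\<dots> = bexp T' * (?P * bexp (- T0)) * bexp (- T')" unfolding E0P by (simp only: mult.assoc)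
      finally have 1: "bexp T * ?P * bexp (- T) = ?R'" unfolding PE0 .
      have 2: "bexp T * rank1 e e * bexp (- T) = rank1 f f"
        unfolding adjE[symmetric] by (simp add: rank1_simps bTe)
      have "bexp T * P * bexp (- T) = bexp T * ?P * bexp (- T) + bexp T * rank1 e e * bexp (- T)"
        by (simp add: algebra_simps)
      then have R: "bexp T * P * bexp (- T) = ?R' + rank1 f f" unfolding 1 2 .
      have R'f: "bapp ?R' f = 0"
        using bexp_fix[of "- T'" f] T'0 P'e by (simp add: bapp_mult bapp_linear_simps(3) bapp_vec_simps(4))
      \<comment> \<open>The mixed terms vanish, so either alternative for the remaining projections
        passes to \<open>P\<close> and \<open>Q\<close>.\<close>
      have "(?R' + rank1 f f) * (?Q + rank1 f f) = ?R' * ?Q + (?R' * rank1 f f + rank1 f f * ?Q) + rank1 f f * rank1 f f"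
        by (simp only: distrib_left distrib_right add.assoc) (simp only: add.left_commute)
      also have "?R' * rank1 f f = 0" using R'f by (simp only: rank1_simps)
      also have "rank1 f f * ?Q = 0" using Q'e hs_projD(1)[OF Q'(1)] by (simp only: rank1_simps)
      also have "rank1 f f * rank1 f f = rank1 f f" by (simp add: rank1_simps bapp_rank1 ee)
      finally have RQ: "(?R' + rank1 f f) * (?Q + rank1 f f) = ?R' * ?Q + rank1 f f" by simp
      have QQ: "?Q + rank1 f f = Q" by simp
      have 3: "bexp T * P * bexp (- T) * Q = bexp T * P * bexp (- T) \<or> bexp T * P * bexp (- T) * Q = Q"
        using T'(4) RQ unfolding R QQ by (metis QQ)
      have 4: "P * T + T * P = T"
      proof -
        have "P * T' + T' * P = (?P * T' + T' * ?P) + (rank1 e e * T' + T' * rank1 e e)"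
          by (simp only: left_diff_distrib right_diff_distrib) simp
        also have "rank1 e e * T' + T' * rank1 e e = 0"
          by (simp add: rank1_simps T'(1) T'0 bapp_linear_simps)
        finally have "P * T' + T' * P = T'" by (simp only: T'(2) add_0_right)
        moreover have "P * T0 + T0 * P = T0"
          by (simp add: T0_def right_diff_distrib left_diff_distrib rank1_simps hs_projD[OF P] Pg e scaleR_diff_right)
        ultimately show ?thesis by (simp add: T_def algebra_simps)
      qed
      have 5: "bapp T x = 0" if "bapp P x = 0" "bapp Q x = 0" for x
      proof -
        have ex: "cinner e x = 0" "cinner f x = 0"
          using hs_proj_cinner[OF P, of e x] hs_proj_cinner[OF Q, of f x] e f that by simp_all
        then have "cinner g x = 0" by (simp add: g_def cinner_scaleR cinner_diff_left)
        then have "bapp T0 x = 0" using ex by (simp add: T0_def bapp_linear_simps bapp_rank1)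
        moreover have "bapp T' x = 0" using ex that by (intro T'(3)) (simp_all add: bapp_linear_simps bapp_rank1)
        ultimately show ?thesis by (simp add: T_def bapp_linear_simps)
      qed
      show ?thesis using adjT 3 4 5 by blast
    qed
  qed
qed

text \<open>A gap below 1 amounts to equal ranks. The rotated \<open>P\<close> is comparable with
  \<open>Q\<close>, and the difference of comparable projections is a projection, whose
  \<open>hs2\<close> is at least 1 unless it is zero.\<close>

lemma hs_proj_rotation:
  assumes P: "hs_proj P" and Q: "hs_proj Q" and "\<bar>hs2 P - hs2 Q\<bar> < 1"
  obtains T where "adj T = - T" "P * T + T * P = T" "bexp T * P * bexp (- T) = Q"
proof -
  obtain T where T: "adj T = - T" "P * T + T * P = T"
    and R: "bexp T * P * bexp (- T) * Q = bexp T * P * bexp (- T) \<or> bexp T * P * bexp (- T) * Q = Q"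
    using principal_rotation[OF P Q] by blast
  define R where "R = bexp T * P * bexp (- T)"
  have adjE: "bexp (- T) = adj (bexp T)" by (simp add: adj_bexp T)
  have u: "unitary_op (bexp T)" by (rule unitary_bexp[OF T(1)])
  have Rp: "hs_proj R" "hs2 R = hs2 P"
    unfolding R_def adjE using hs_proj_unitary[OF P u] hs2_unitary[OF hs_projD(4)[OF P] u] by auto
  have le: "R1 = R2" if 12: "R1 * R2 = R1" "hs_proj R1" "hs_proj R2" "\<bar>hs2 R1 - hs2 R2\<bar> < 1" for R1 R2 :: "'a bop"
  proof (rule ccontr)
    assume "R1 \<noteq> R2"
    have 21: "R2 * R1 = R1" using arg_cong[OF 12(1), of adj] 12(2,3) by (simp add: hs_proj_def)
    have "hs_proj (R2 - R1)"
      using 12 21 by (simp add: hs_proj_def algebra_simps hs_diff)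
    then have "hs2 (R2 - R1) \<ge> 1" using hs_proj_ge_1[of "R2 - R1"] \<open>R1 \<noteq> R2\<close> by simp
    moreover have "hs2 (R1 + (R2 - R1)) = hs2 R1 + hs2 (R2 - R1)"
      using 12 by (intro hs2_add_orthogonal) (auto simp: hs_proj_def algebra_simps intro!: hs_diff)
    ultimately show False using 12(4) by simp
  qed
  have "R = Q"
  proof (cases "R * Q = R")
    case True
    then show ?thesis using le[of R Q] Rp Q assms(3) by simp
  next
    case False
    then have "R * Q = Q" using R by (simp add: R_def)
    then have "adj (R * Q) = adj Q" by simp
    then have "Q * R = Q" using hs_projD(1)[OF Rp(1)] hs_projD(1)[OF Q] by simp
    then show ?thesis using le[of Q R] Rp Q assms(3) by (simp add: abs_minus_commute)
  qed
  then show ?thesis by (intro that[OF T]) (simp only: R_def)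
qed

section \<open>Geometry of the orbit\<close>

text \<open>The exponential series without its first term has the factor \<open>T\<close>, and
  Hilbert-Schmidt operators form an ideal.\<close>

lemma hs_bexp_minus_1:
  assumes "hilbert_schmidt (T::'a::complex_hilbert bop)" shows "hilbert_schmidt (bexp T - 1)"
proof -
  have "summable (\<lambda>n. T ^ n /\<^sub>R fact (Suc n))"
  proof (rule summable_norm_cancel, rule summable_comparison_test')
    show "summable (\<lambda>n. inverse (fact n) * norm T ^ n)" by (rule summable_exp)
    fix n
    have "(fact n :: real) \<le> fact (Suc n)" by (rule fact_mono) simp
    then have "inverse (fact (Suc n)) \<le> (inverse (fact n) :: real)" by (intro le_imp_inverse_le) simp_all
    then show "norm (norm (T ^ n /\<^sub>R fact (Suc n))) \<le> inverse (fact n) * norm T ^ n"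
      by (simp add: norm_bop_power mult_mono del: fact_Suc)
  qed
  then obtain R where "(\<lambda>n. T ^ n /\<^sub>R fact (Suc n)) sums R" by (auto simp: summable_def)
  from bounded_linear.sums[OF bounded_linear_mult_right this]
  have "(\<lambda>n. T ^ Suc n /\<^sub>R fact (Suc n)) sums (T * R)" by simp
  moreover have "(\<lambda>n. T ^ Suc n /\<^sub>R fact (Suc n)) sums (bexp T - 1)"
    using bexp_sums[of T] sums_Suc_iff[of "\<lambda>n. T ^ n /\<^sub>R fact n" "bexp T - 1"] by simp
  ultimately have "bexp T - 1 = T * R" using sums_unique2 by blast
  then show ?thesis using hs_mult_right(1)[OF assms] by simp
qed

text \<open>\<open>1 + P\<close> is 2 on the range of \<open>P\<close> and 1 on its
  complement.\<close>

lemma inv_op_one_plus: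
  assumes "P * P = P" shows "inv_op (1 + P) = 1 - (1/2) *\<^sub>R (P::'a::complex_hilbert bop)"
    "invertible_op (1 + P)"
proof -
  have 1: "(1 - (1/2) *\<^sub>R P) * (1 + P) = 1" "(1 + P) * (1 - (1/2) *\<^sub>R P) = 1"
    by (simp_all add: algebra_simps assms) (simp_all add: scaleR_left_distrib[symmetric])
  show "inv_op (1 + P) = 1 - (1/2) *\<^sub>R P" by (rule inv_op_eqI[OF 1])
  show "invertible_op (1 + P)" using 1 by (auto simp: invertible_op_def)
qed

lemma op_of_coord: "hs_proj P \<Longrightarrow> op_of (coord (1 + P)) = P"
  by (simp add: coord_def op_of_hsh_of hs_projD)

subsection \<open>Tangent vectors\<close>

text \<open>The equation \<open>P * P = P\<close> differentiated in direction \<open>V\<close>;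
  equivalently, both diagonal blocks of \<open>V\<close> vanish.\<close>

definition tangential :: "'a::complex_hilbert bop \<Rightarrow> 'a bop \<Rightarrow> bool" where
  "tangential P V \<longleftrightarrow> P * V + V * P = V"

lemma tangential_simps:
  assumes P: "P * P = P" and V: "tangential P V"
  shows "P * V * P = 0" "P * (V * P) = 0" "P * (V * (P * S)) = 0" "V * P = V - P * V"
proof -
  have "P * (P * V + V * P) = P * V" using V by (simp add: tangential_def)
  then have "P * V + P * V * P = P * V" by (simp add: distrib_left mult.assoc[symmetric] P)
  then show 1: "P * V * P = 0" by simp
  then show "P * (V * P) = 0" by (simp add: mult.assoc)
  have "P * V * P * S = 0" by (simp add: 1)
  then show "P * (V * (P * S)) = 0" by (simp add: mult.assoc)
  show "V * P = V - P * V" using V unfolding tangential_def by (metis add_diff_cancel_left')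
qed

text \<open>The commutator with \<open>P\<close> keeps one off-diagonal block and flips the sign of
  the other, so it is an involution on co-diagonal operators. It translates between tangent vectors
  and skew generators of curves.\<close>

lemma tangential_commutator:
  assumes P: "P * P = P" and V: "tangential P V"
  shows "tangential P (V * P - P * V)" "(V * P - P * V) * P - P * (V * P - P * V) = V"
proof -
  have PP: "P * (P * S) = P * S" for S by (simp add: mult.assoc[symmetric] P)
  note s = tangential_simps[OF P V]
  show "tangential P (V * P - P * V)"
    by (simp add: tangential_def algebra_simps P PP s(2,3))
  have "(V * P - P * V) * P - P * (V * P - P * V) = P * V + V * P"
    by (simp add: algebra_simps P PP s(2,3))
  then show "(V * P - P * V) * P - P * (V * P - P * V) = V" using V by (simp add: tangential_def)
qed

text \<open>A product of two off-diagonal operators is block diagonal.\<close>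

lemma tangential_mult_commute:
  assumes "tangential P S" "tangential P T" shows "P * (S * T) = S * T * P"
proof -
  have "P * (S * T) = (S - S * P) * T"
    using assms(1) unfolding tangential_def by (metis add_diff_cancel_right' mult.assoc)
  also have "\<dots> = S * (T - P * T)" by (simp add: algebra_simps)
  also have "T - P * T = T * P" using assms(2) unfolding tangential_def by (metis add_diff_cancel_left')
  finally show ?thesis by (simp add: mult.assoc)
qed

text \<open>Only one argument has to be tangential, the other position being reached by cyclicity of
  the trace; this is what determines the normal space.\<close>

lemma riem_metric_tangential:
  assumes P: "hs_proj P" and v: "tangential P (op_of v)"
  shows "riem_metric (1 + P) v x = inner v x / 2" "riem_metric (1 + P) x v = inner x v / 2"
proof -
  let ?I = "1 - (1/2) *\<^sub>R P"
  have "?I * op_of v * ?I = op_of v - (1/2) *\<^sub>R (P * op_of v + op_of v * P)"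
    by (simp add: algebra_simps tangential_simps(1,2)[OF hs_projD(2)[OF P] v])
  also have "\<dots> = op_of ((1/2) *\<^sub>R v)"
    using v by (simp add: tangential_def) (simp add: algebra_simps flip: scaleR_left_distrib)
  finally have I: "?I * op_of v * ?I = op_of ((1/2) *\<^sub>R v)" .
  have inv: "inv_op (1 + P) = ?I" by (rule inv_op_one_plus[OF hs_projD(2)[OF P]])
  have "riem_metric (1 + P) v x = inner ((1/2) *\<^sub>R v) x"
    unfolding riem_metric_def inv I inner_hsh_def ..
  then show vx: "riem_metric (1 + P) v x = inner v x / 2" by simp
  have "rtr ((?I * op_of x) * (?I * op_of v)) = rtr ((?I * op_of v) * (?I * op_of x))"
    by (intro rtr_swap hs_mult_left hilbert_schmidt_op_of)
  then have "riem_metric (1 + P) x v = riem_metric (1 + P) v x"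
    unfolding riem_metric_def inv by (simp only: mult.assoc)
  then show "riem_metric (1 + P) x v = inner x v / 2" by (simp add: vx inner_commute)
qed

text \<open>The filter \<open>at t within S\<close> covers two-sided curves as well as the end
  points of the unit interval.\<close>

lemma projector_curve_tangential:
  assumes x: "(x has_vector_derivative v) (at t within S)" and "at t within S \<noteq> bot" "t \<in> S"
    and P: "\<And>s. s \<in> S \<Longrightarrow> op_of (x s) * op_of (x s) = op_of (x s)"
  shows "tangential (op_of (x t)) (op_of v)"
proof -
  have y: "((\<lambda>s. op_of (x s)) has_vector_derivative op_of v) (at t within S)"
    by (rule bounded_linear.has_vector_derivative[OF bounded_linear_op_of x])
  have "((\<lambda>s. op_of (x s)) has_vector_derivative op_of (x t) * op_of v + op_of v * op_of (x t)) (at t within S)"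
    by (rule has_vector_derivative_transform[OF assms(3) _ bop_mult_has_vector_derivative[OF y y]]) (simp add: P)
  then show ?thesis unfolding tangential_def by (rule vector_derivative_unique_within[OF assms(2) _ y])
qed

subsection \<open>Conjugation by a one-parameter group\<close>

text \<open>With \<open>W\<close> equal to \<open>P\<close>, to its commutator with
  \<open>T\<close>, and to the double commutator, this is position, velocity and acceleration of one
  and the same motion.\<close>

definition conj_curve :: "'a::complex_hilbert bop \<Rightarrow> 'a bop \<Rightarrow> real \<Rightarrow> 'a hsh" where
  "conj_curve T W t = sa_part (bexp (t *\<^sub>R T) * W * bexp (t *\<^sub>R (- T)))"

lemma sa_part_add:
  "hilbert_schmidt S \<Longrightarrow> hilbert_schmidt T \<Longrightarrow> sa_part (S + T) = sa_part S + sa_part T"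
  unfolding op_of_inject[symmetric] by (simp add: op_of_sa_part hilbert_schmidt_add) (simp add: algebra_simps)

lemma conj_curve_has_vector_derivative:
  assumes W: "hilbert_schmidt W"
  shows "(conj_curve T W has_vector_derivative conj_curve T (T * W - W * T) t) (at t within S)"
proof -
  let ?E = "bexp (t *\<^sub>R T)" and ?F = "bexp (t *\<^sub>R (- T))"
  note d = bounded_bilinear.has_vector_derivative[OF bounded_bilinear_sandwich[OF W]
      bexp_has_vector_derivative[of T t S] bexp_has_vector_derivative[of "- T" t S]]
  have c: "T * ?E = ?E * T" by (rule bexp_commute) simp
  have "sa_part (?E * W * (- T * ?F)) + sa_part (T * ?E * W * ?F) = sa_part (?E * W * (- T * ?F) + T * ?E * W * ?F)"
    by (rule sa_part_add[symmetric]) (intro hs_mult_left hs_mult_right W)+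
  also have "?E * W * (- T * ?F) + T * ?E * W * ?F = ?E * (T * W - W * T) * ?F"
    unfolding c by (simp add: algebra_simps)
  finally show ?thesis using d unfolding conj_curve_def[abs_def] by simp
qed

lemma smooth_on_conj_curve:
  assumes "hilbert_schmidt W" "open I" shows "smooth_on I (conj_curve T W)"
  unfolding conj_curve_def[abs_def]
  by (rule smooth_on_bilinear[OF bounded_bilinear_sandwich[OF assms(1)]]) (intro smooth_on_bexp assms(2))+

lemma adj_bexp_skew: "adj T = - T \<Longrightarrow> adj (bexp (t *\<^sub>R T)) = bexp (t *\<^sub>R (- T))"
  by (simp add: adj_bexp)

lemma unitary_bexp_skew: "adj T = - T \<Longrightarrow> unitary_op (bexp (t *\<^sub>R T))"
  by (rule unitary_bexp) simp

lemma op_of_conj_curve: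
  assumes "hilbert_schmidt W" "adj W = W" "adj T = - T"
  shows "op_of (conj_curve T W t) = bexp (t *\<^sub>R T) * W * bexp (t *\<^sub>R (- T))"
  unfolding conj_curve_def using assms(2) adj_bexp_skew[OF assms(3), of t] adj_bexp_skew[of "- T" t] assms(3)
  by (intro op_of_sa_part_self hs_mult_left hs_mult_right assms(1)) (simp add: mult.assoc)

lemma norm_conj_curve:
  assumes "hilbert_schmidt W" "adj W = W" "adj T = - T"
  shows "norm (conj_curve T W t) = 2 * sqrt (hs2 W)"
  unfolding norm_hsh_hs2 op_of_conj_curve[OF assms] adj_bexp_skew[OF assms(3), symmetric]
  using hs2_unitary[OF assms(1) unitary_bexp_skew[OF assms(3)]] by simp

lemma conj_curve_continuous_on: "hilbert_schmidt W \<Longrightarrow> continuous_on S (conj_curve T W)"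
  by (rule continuous_on_vector_derivative[OF conj_curve_has_vector_derivative])

lemma velocity_eqI:
  assumes "((\<lambda>s. coord (\<gamma> s)) has_vector_derivative v) (at t within {0..1})" "t \<in> {0..1}"
  shows "velocity \<gamma> t = v"
  unfolding velocity_def using assms
  by (intro vector_derivative_within_cbox[of 0 1, unfolded box_real]) auto

lemma C1_curve_has_vector_derivative:
  assumes "C1_curve S \<gamma>" "t \<in> {0..1}"
  shows "((\<lambda>s. coord (\<gamma> s)) has_vector_derivative velocity \<gamma> t) (at t within {0..1})"
  using assms by (simp add: C1_curve_def velocity_def vector_derivative_works[symmetric])

lemma at_within_01: "t \<in> {0..1::real} \<Longrightarrow> at t within {0..1} \<noteq> bot"
  by (simp add: trivial_limit_within islimpt_Icc)

section \<open>Membership in the orbit, expressed through projections\<close>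

context
  fixes A :: "'a::complex_hilbert bop"
  assumes A: "hs_proj A"
begin

abbreviation (input) "orbit \<equiv> unitary_orbit (1 + A)"

definition "in_orbit P \<longleftrightarrow> (\<exists>u. unitary_op u \<and> P = u * A * adj u)"

lemma orbit_iff: "p \<in> orbit \<longleftrightarrow> (\<exists>P. p = 1 + P \<and> in_orbit P)"
proof -
  have eq: "u * (1 + A) * adj u = 1 + u * A * adj u" if "unitary_op u" for u
    using that by (simp add: algebra_simps unitary_op_simps)
  have "p \<in> orbit \<longleftrightarrow> (\<exists>u. unitary_op u \<and> p = u * (1 + A) * adj u)" by (auto simp: unitary_orbit_def)
  also have "\<dots> \<longleftrightarrow> (\<exists>u. unitary_op u \<and> p = 1 + u * A * adj u)" by (simp only: eq cong: conj_cong)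
  finally show ?thesis by (auto simp: in_orbit_def)
qed

lemma in_orbit_hs_proj: "in_orbit P \<Longrightarrow> hs_proj P"
  using hs_proj_unitary[OF A] by (auto simp: in_orbit_def)

lemma in_orbit_hs2: "in_orbit P \<Longrightarrow> hs2 P = hs2 A"
  using hs2_unitary[OF hs_projD(4)[OF A]] by (auto simp: in_orbit_def)

lemma in_orbit_unitary:
  assumes "in_orbit P" "unitary_op w" shows "in_orbit (w * P * adj w)"
proof -
  obtain u where "unitary_op u" "P = u * A * adj u" using assms by (auto simp: in_orbit_def)
  then show ?thesis unfolding in_orbit_def
    by (intro exI[of _ "w * u"]) (simp add: unitary_op_mult assms mult.assoc)
qed

lemma in_orbit_diff: "p \<in> orbit \<Longrightarrow> in_orbit (p - 1)"
  by (auto simp: orbit_iff)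

lemma op_of_coord_orbit: "p \<in> orbit \<Longrightarrow> op_of (coord p) = p - 1"
  by (auto simp: orbit_iff op_of_coord[OF in_orbit_hs_proj])

lemma in_orbit_bexp:
  assumes "in_orbit P" "adj T = - T"
  shows "in_orbit (bexp (t *\<^sub>R T) * P * bexp (t *\<^sub>R (- T)))"
  using in_orbit_unitary[OF assms(1) unitary_bexp_skew[OF assms(2)]] adj_bexp_skew[OF assms(2)] by simp

lemma one_plus_conj: "bexp (t *\<^sub>R T) * (1 + P) * bexp (t *\<^sub>R (- T)) = 1 + bexp (t *\<^sub>R T) * P * bexp (t *\<^sub>R (- T))"
  using bexp_minus_mult[of "t *\<^sub>R T"] by (simp add: algebra_simps)

lemma coord_conj:
  assumes "in_orbit P" "adj T = - T"
  shows "coord (bexp (t *\<^sub>R T) * (1 + P) * bexp (t *\<^sub>R (- T))) = conj_curve T P t"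
  unfolding op_of_inject[symmetric] one_plus_conj op_of_coord[OF in_orbit_hs_proj[OF in_orbit_bexp[OF assms]]]
  using hs_projD[OF in_orbit_hs_proj[OF assms(1)]] by (simp only: op_of_conj_curve assms(2))

lemma curve_in_orbit:
  "in_orbit P \<Longrightarrow> adj T = - T \<Longrightarrow> bexp (t *\<^sub>R T) * (1 + P) * bexp (t *\<^sub>R (- T)) \<in> orbit"
  unfolding one_plus_conj orbit_iff using in_orbit_bexp by blast

section \<open>Tangent and normal spaces of the orbit\<close>

lemma skew_commutator: "adj V = V \<Longrightarrow> adj P = P \<Longrightarrow> adj (V * P - P * V) = - (V * P - P * (V::'a bop))"
  by simp

text \<open>A curve of projections has co-diagonal velocity. Conversely the commutator of
  \<open>v\<close> with \<open>P\<close> is a skew generator, whose own commutator with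
  \<open>P\<close> is \<open>v\<close> again, so its conjugation curve starts with velocity
  \<open>v\<close>.\<close>

lemma tangent_space_orbit:
  assumes P: "in_orbit P"
  shows "tangent_space orbit (1 + P) = {v. tangential P (op_of v)}"
proof (intro set_eqI iffI)
  fix v assume "v \<in> tangent_space orbit (1 + P)"
  then obtain \<gamma> and \<epsilon> :: real where e: "\<epsilon> > 0" and \<gamma>: "\<And>t. t \<in> {-\<epsilon><..<\<epsilon>} \<Longrightarrow> \<gamma> t \<in> orbit" "\<gamma> 0 = 1 + P"
    and d: "((\<lambda>t. coord (\<gamma> t)) has_vector_derivative v) (at 0)"
    unfolding tangent_space_def by blast
  have "tangential (op_of (coord (\<gamma> 0))) (op_of v)"
  proof (rule projector_curve_tangential[where S="{-\<epsilon><..<\<epsilon>}"])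
    have w: "at 0 within {-\<epsilon><..<\<epsilon>} = at 0" using e by (intro at_within_open) auto
    show "((\<lambda>t. coord (\<gamma> t)) has_vector_derivative v) (at 0 within {-\<epsilon><..<\<epsilon>})" unfolding w by (rule d)
    show "at 0 within {-\<epsilon><..<\<epsilon>} \<noteq> bot" unfolding w by simp
    show "op_of (coord (\<gamma> s)) * op_of (coord (\<gamma> s)) = op_of (coord (\<gamma> s))" if "s \<in> {-\<epsilon><..<\<epsilon>}" for s
      using hs_projD(2)[OF in_orbit_hs_proj[OF in_orbit_diff[OF \<gamma>(1)[OF that]]]]
        op_of_coord_orbit[OF \<gamma>(1)[OF that]] by simp
  qed (use e in auto)
  then show "v \<in> {v. tangential P (op_of v)}"
    using \<gamma>(2) op_of_coord[OF in_orbit_hs_proj[OF P]] by simp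
next
  fix v assume "v \<in> {v. tangential P (op_of v)}"
  then have v: "tangential P (op_of v)" by simp
  note hP = hs_projD[OF in_orbit_hs_proj[OF P]]
  define T where "T = op_of v * P - P * op_of v"
  have T: "adj T = - T" unfolding T_def by (rule skew_commutator) (simp_all add: hP)
  let ?\<gamma> = "\<lambda>t. bexp (t *\<^sub>R T) * (1 + P) * bexp (t *\<^sub>R (- T))"
  have d: "((\<lambda>t. coord (?\<gamma> t)) has_vector_derivative v) (at 0)"
  proof -
    have "T * P - P * T = op_of v" unfolding T_def by (rule tangential_commutator(2)[OF hP(2) v])
    moreover have "conj_curve T (op_of v) 0 = v"
      unfolding op_of_inject[symmetric] by (simp add: op_of_conj_curve hilbert_schmidt_op_of T)
    ultimately show ?thesis
      using conj_curve_has_vector_derivative[OF hP(4), of T 0 UNIV] unfolding coord_conj[OF P T] by simp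
  qed
  have "smooth_on {-1<..<1} (\<lambda>t::real. coord (?\<gamma> t))"
    unfolding coord_conj[OF P T] by (rule smooth_on_conj_curve[OF hP(4)]) simp
  then show "v \<in> tangent_space orbit (1 + P)"
    unfolding tangent_space_def using d curve_in_orbit[OF P T]
    by (intro CollectI exI[of _ ?\<gamma>] exI[of _ "1::real"]) simp
qed

lemma codiag_split:
  assumes P: "hs_proj P"
  obtains c where "tangential P (op_of c)" "P * (op_of x - op_of c) = (op_of x - op_of c) * P"
proof -
  note hP = hs_projD[OF P]
  \<comment> \<open>The co-diagonal part \<open>P x (1 - P) + (1 - P) x P\<close>, multiplied
    out.\<close>
  let ?C = "P * op_of x + op_of x * P - (P * op_of x * P + P * op_of x * P)"
  have C: "hilbert_schmidt ?C" by (intro hs_intros hs_mult_left hs_mult_right)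
  have c: "op_of (sa_part ?C) = ?C" by (rule op_of_sa_part_self[OF C]) (simp add: hP mult.assoc)
  show ?thesis
  proof (rule that[of "sa_part ?C"])
    show "tangential P (op_of (sa_part ?C))" unfolding c tangential_def by (simp add: algebra_simps hP)
    show "P * (op_of x - op_of (sa_part ?C)) = (op_of x - op_of (sa_part ?C)) * P"
      unfolding c by (simp add: algebra_simps hP)
  qed
qed

text \<open>Conjugation by the reflection \<open>2P - 1\<close> is isometric, fixes the operators that commute with \<open>P\<close>
  and changes the sign of tangent vectors.\<close>

lemma commuting_orthogonal:
  assumes P: "hs_proj P" and x: "P * op_of x = op_of x * P" and v: "tangential P (op_of v)"
  shows "inner x v = 0"
proof -
  note hP = hs_projD[OF P]
  let ?s = "P + P - 1"
  have "P * (op_of x * S) = op_of x * (P * S)" for S using x by (metis mult.assoc)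
  then have sx: "?s * op_of x * ?s = op_of x"
    by (simp add: algebra_simps hP x)
  have "?s * op_of v * ?s = op_of v - ((P * op_of v + op_of v * P) + (P * op_of v + op_of v * P))"
    by (simp add: algebra_simps tangential_simps(2)[OF hP(2) v])
  also have "\<dots> = op_of (- v)" using v by (simp add: tangential_def)
  finally have sv: "?s * op_of v * ?s = op_of (- v)" .
  note hs = hs_mult_right(1)[OF hilbert_schmidt_op_of]
  have "inner x (- v) = 4 * rtr ((op_of x * ?s) * (op_of v * ?s))"
    unfolding inner_hsh_def sv[symmetric] by (simp only: mult.assoc)
  also have "\<dots> = 4 * rtr ((op_of v * ?s) * (op_of x * ?s))" by (simp only: rtr_swap[OF hs hs])
  also have "\<dots> = 4 * rtr (op_of v * (?s * op_of x * ?s))" by (simp only: mult.assoc)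
  also have "\<dots> = inner x v" unfolding sx
    by (simp only: inner_hsh_def rtr_swap[OF hilbert_schmidt_op_of[of x] hilbert_schmidt_op_of[of v]])
  finally show ?thesis by simp
qed

text \<open>A normal vector is tested against its own co-diagonal part, which must therefore
  vanish.\<close>

lemma tangent_perp_orbit:
  assumes P: "in_orbit P"
  shows "tangent_perp orbit (1 + P) = {x. P * op_of x = op_of x * P}"
proof (intro set_eqI iffI)
  note hP = in_orbit_hs_proj[OF P]
  fix x assume x: "x \<in> tangent_perp orbit (1 + P)"
  have perp: "inner x v = 0" if "tangential P (op_of v)" for v
    using x that riem_metric_tangential(2)[OF hP that, of x]
    by (simp add: tangent_perp_def tangent_space_orbit[OF P])
  obtain c where c: "tangential P (op_of c)" "P * op_of (x - c) = op_of (x - c) * P"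
    using codiag_split[OF hP, of x] by auto
  have "inner c c = inner x c - inner (x - c) c" by (simp add: inner_diff_left)
  also have "\<dots> = 0" using perp[OF c(1)] commuting_orthogonal[OF hP c(2,1)] by simp
  finally have "c = 0" by simp
  then show "x \<in> {x. P * op_of x = op_of x * P}" using c(2) by simp
next
  note hP = in_orbit_hs_proj[OF P]
  fix x assume "x \<in> {x. P * op_of x = op_of x * P}"
  then have "riem_metric (1 + P) x v = 0" if "tangential P (op_of v)" for v
    using riem_metric_tangential(2)[OF hP that, of x] commuting_orthogonal[OF hP _ that, of x] by simp
  then show "x \<in> tangent_perp orbit (1 + P)"
    by (simp add: tangent_perp_def tangent_space_orbit[OF P])
qed

subsection \<open>Geodesics\<close>

lemma velocity_conj:
  assumes "in_orbit P" "adj T = - T" "t \<in> {0..1}"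
  shows "velocity (\<lambda>t. bexp (t *\<^sub>R T) * (1 + P) * bexp (t *\<^sub>R (- T))) t = conj_curve T (T * P - P * T) t"
  by (rule velocity_eqI) (simp_all only: coord_conj assms conj_curve_has_vector_derivative
      hs_projD(4)[OF in_orbit_hs_proj])

text \<open>At every time the picture is the one at time 0 conjugated by a unitary. There
  \<open>T\<close> and the velocity \<open>W\<close> are co-diagonal, so the acceleration
  \<open>Y\<close> and the correction term are diagonal, which means normal to the orbit.\<close>

lemma geodesic_conj:
  assumes P: "in_orbit P" and T: "adj T = - T" "tangential P T"
  shows "geodesic orbit (\<lambda>t. bexp (t *\<^sub>R T) * (1 + P) * bexp (t *\<^sub>R (- T)))" (is "geodesic _ ?\<gamma>")
proof -
  note hP = hs_projD[OF in_orbit_hs_proj[OF P]]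
  define W where "W = T * P - P * T"
  define Y where "Y = T * W - W * T"
  have W: "hilbert_schmidt W" "adj W = W"
    unfolding W_def by (auto intro!: hs_diff hs_mult_left(1)[OF hP(4)] hs_mult_right(1)[OF hP(4)] simp: hP T)
  have Y: "hilbert_schmidt Y" "adj Y = Y"
    unfolding Y_def by (auto intro!: hs_diff hs_mult_left(1)[OF W(1)] hs_mult_right(1)[OF W(1)] simp: W T)
  have tW: "tangential P W" unfolding W_def by (rule tangential_commutator(1)[OF hP(2) T(2)])
  have coordg: "(\<lambda>t. coord (?\<gamma> t)) = conj_curve T P" by (rule ext) (rule coord_conj[OF P T(1)])
  have vel: "velocity ?\<gamma> t = conj_curve T W t" if "t \<in> {0..1}" for t
    unfolding W_def by (rule velocity_conj[OF P T(1) that])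
  have d: "(conj_curve T P has_vector_derivative conj_curve T W t) (at t within {0..1})" for t
    unfolding W_def by (rule conj_curve_has_vector_derivative[OF hP(4)])
  have C1: "C1_curve orbit ?\<gamma>"
    unfolding C1_curve_def coordg
  proof (intro conjI ballI)
    show "?\<gamma> t \<in> orbit" for t by (rule curve_in_orbit[OF P T(1)])
    show "conj_curve T P differentiable at t within {0..1}" for t
      using d by (rule differentiableI_vector)
    show "continuous_on {0..1} (velocity ?\<gamma>)"
      using conj_curve_continuous_on[OF W(1), of "{0..1}" T] by (rule continuous_on_eq) (simp only: vel)
  qed
  show ?thesis
    unfolding geodesic_def
  proof (intro conjI C1 exI[of _ "conj_curve T Y"] ballI)
    show "continuous_on {0..1} (conj_curve T Y)" by (rule conj_curve_continuous_on[OF Y(1)])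
    fix t :: real assume t: "t \<in> {0..1}"
    show "(velocity ?\<gamma> has_vector_derivative conj_curve T Y t) (at t within {0..1})"
      using conj_curve_has_vector_derivative[OF W(1), of T t "{0..1}"] unfolding Y_def
      by (rule has_vector_derivative_transform[OF t, rotated]) (simp only: vel)
    let ?E = "bexp (t *\<^sub>R T)" and ?F = "bexp (t *\<^sub>R (- T))"
    let ?I = "1 - (1/2) *\<^sub>R P"
    have EF: "?E * ?F = 1" "?F * ?E = 1" using bexp_minus_mult[of "t *\<^sub>R T"] bexp_minus_mult[of "- (t *\<^sub>R T)"] by simp_all
    have FE: "?F * (?E * S) = S" for S by (simp only: mult.assoc[symmetric] EF mult_1_left)
    let ?Q = "?E * P * ?F"
    have Q: "in_orbit ?Q" by (rule in_orbit_bexp[OF P T(1)])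
    note hQ = hs_projD[OF in_orbit_hs_proj[OF Q]]
    have \<gamma>Q: "?\<gamma> t = 1 + ?Q" by (rule one_plus_conj)
    have I: "inv_op (?\<gamma> t) = ?E * ?I * ?F"
      unfolding \<gamma>Q inv_op_one_plus(1)[OF hQ(2)]
      by (simp only: left_diff_distrib right_diff_distrib mult.right_neutral EF mult_scaleR_left mult_scaleR_right)
    have opW: "op_of (conj_curve T W t) = ?E * W * ?F" and opY: "op_of (conj_curve T Y t) = ?E * Y * ?F"
      by (intro op_of_conj_curve W Y T(1))+
    \<comment> \<open>The covariant derivative carried back to time 0, where it has to commute with
      \<open>P\<close>.\<close>
    define Z where "Z = Y - W * ?I * W"
    have Z: "op_of (conj_curve T Y t) - op_of (conj_curve T W t) * inv_op (?\<gamma> t) * op_of (conj_curve T W t) = ?E * Z * ?F"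
      unfolding I opW opY Z_def by (simp only: left_diff_distrib right_diff_distrib mult.assoc FE)
    have Zhs: "hilbert_schmidt (?E * Z * ?F)" unfolding Z_def
      by (intro hs_mult_left hs_mult_right hs_diff Y W)
    have "adj Z = Z" unfolding Z_def by (simp add: Y W hP mult.assoc)
    then have Zadj: "adj (?E * Z * ?F) = ?E * Z * ?F"
      using adj_bexp_skew[OF T(1), of t] adj_bexp_skew[of "- T" t] T(1) by (simp add: mult.assoc)
    have PZ: "P * Z = Z * P"
    proof -
      have 1: "P * Y = Y * P" unfolding Y_def
        using tangential_mult_commute[OF T(2) tW] tangential_mult_commute[OF tW T(2)]
        by (simp add: left_diff_distrib right_diff_distrib mult.assoc)
      have "W * ?I * W = W * W - (1/2) *\<^sub>R (W * (P * W))" by (simp add: algebra_simps)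
      moreover have "P * (W * (P * W)) = W * (P * W) * P"
        using tangential_simps(3)[OF hP(2) tW] tangential_simps(2)[OF hP(2) tW] by (simp add: mult.assoc)
      ultimately show ?thesis
        unfolding Z_def using 1 tangential_mult_commute[OF tW tW] by (simp add: algebra_simps)
    qed
    have "?Q * (?E * Z * ?F) = (?E * Z * ?F) * ?Q"
    proof -
      have "?Q * (?E * Z * ?F) = ?E * (P * Z) * ?F" by (simp only: mult.assoc FE)
      also have "\<dots> = (?E * Z * ?F) * ?Q" unfolding PZ by (simp only: mult.assoc FE)
      finally show ?thesis .
    qed
    then show "cov_deriv (?\<gamma> t) (velocity ?\<gamma> t) (conj_curve T Y t) \<in> tangent_perp orbit (?\<gamma> t)"
      unfolding cov_deriv_def vel[OF t] Z unfolding \<gamma>Q tangent_perp_orbit[OF Q]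
      by (simp only: mem_Collect_eq op_of_hsh_of[OF Zadj Zhs])
  qed
qed

text \<open>Along a geodesic the commutator \<open>[P', P]\<close> is constant, and \<open>P' = [[P', P], P]\<close>.  So the geodesic
  equation reduces to a linear one, which determines the geodesic.\<close>

lemma geodesic_end:
  assumes g: "geodesic orbit \<gamma>" and V0: "V0 = op_of (velocity \<gamma> 0)" and P0: "\<gamma> 0 = 1 + P0"
  shows "\<gamma> 1 = bexp (V0 * P0 - P0 * V0) * \<gamma> 0 * bexp (- (V0 * P0 - P0 * V0))"
proof -
  obtain acc where C1: "C1_curve orbit \<gamma>"
    and acc: "\<And>t. t \<in> {0..1} \<Longrightarrow> (velocity \<gamma> has_vector_derivative acc t) (at t within {0..1})"
    and perp: "\<And>t. t \<in> {0..1} \<Longrightarrow> cov_deriv (\<gamma> t) (velocity \<gamma> t) (acc t) \<in> tangent_perp orbit (\<gamma> t)"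
    using g unfolding geodesic_def by blast
  define P where "P t = op_of (coord (\<gamma> t))" for t
  define V where "V t = op_of (velocity \<gamma> t)" for t
  define a where "a t = op_of (acc t)" for t
  have \<gamma>: "\<gamma> t \<in> orbit" if "t \<in> {0..1}" for t using C1 that by (simp add: C1_curve_def)
  have \<gamma>P: "\<gamma> t = 1 + P t" if "t \<in> {0..1}" for t using op_of_coord_orbit[OF \<gamma>[OF that]] by (simp add: P_def)
  have orb: "in_orbit (P t)" if "t \<in> {0..1}" for t using \<gamma>[OF that] \<gamma>P[OF that] by (auto simp: orbit_iff)
  have hP: "hs_proj (P t)" if "t \<in> {0..1}" for t using in_orbit_hs_proj[OF orb[OF that]] .
  have dc: "((\<lambda>s. coord (\<gamma> s)) has_vector_derivative velocity \<gamma> t) (at t within {0..1})" if "t \<in> {0..1}" for t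
    by (rule C1_curve_has_vector_derivative[OF C1 that])
  have dP: "(P has_vector_derivative V t) (at t within {0..1})" if "t \<in> {0..1}" for t
    unfolding P_def[abs_def] V_def by (rule bounded_linear.has_vector_derivative[OF bounded_linear_op_of dc[OF that]])
  have dV: "(V has_vector_derivative a t) (at t within {0..1})" if "t \<in> {0..1}" for t
    unfolding a_def V_def[abs_def] by (rule bounded_linear.has_vector_derivative[OF bounded_linear_op_of acc[OF that]])
  have tan: "tangential (P t) (V t)" if t: "t \<in> {0..1}" for t
    unfolding P_def V_def
    by (rule projector_curve_tangential[OF dc[OF t] at_within_01[OF t] t]) (use hs_projD(2)[OF hP] in \<open>simp add: P_def\<close>)
  \<comment> \<open>Normality says that the covariant derivative commutes with \<open>P t\<close>;
    its quadratic velocity term does so by itself, which leaves the acceleration.\<close>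
  have comm: "P t * a t = a t * P t" if t: "t \<in> {0..1}" for t
  proof -
    note h = hs_projD[OF hP[OF t]]
    let ?I = "1 - (1/2) *\<^sub>R P t"
    let ?Z = "a t - V t * ?I * V t"
    have inv: "inv_op (\<gamma> t) = ?I" unfolding \<gamma>P[OF t] by (rule inv_op_one_plus(1)[OF h(2)])
    have "adj ?Z = ?Z" "hilbert_schmidt ?Z"
      by (auto simp: a_def V_def h mult.assoc intro!: hs_intros hs_mult_left)
    then have "op_of (cov_deriv (\<gamma> t) (velocity \<gamma> t) (acc t)) = ?Z"
      unfolding cov_deriv_def inv by (simp add: op_of_hsh_of a_def V_def)
    then have 1: "P t * ?Z = ?Z * P t"
      using perp[OF t] unfolding \<gamma>P[OF t] tangent_perp_orbit[OF orb[OF t]] by simp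
    have "V t * ?I * V t = V t * V t - (1/2) *\<^sub>R (V t * (P t * V t))" by (simp add: algebra_simps)
    moreover have "P t * (V t * (P t * V t)) = V t * (P t * V t) * P t"
      using tangential_simps(3)[OF h(2) tan[OF t]] tangential_simps(2)[OF h(2) tan[OF t]] by (simp add: mult.assoc)
    ultimately have "P t * (V t * ?I * V t) = (V t * ?I * V t) * P t"
      using tangential_mult_commute[OF tan[OF t] tan[OF t]] by (simp add: algebra_simps)
    with 1 show ?thesis by (simp only: left_diff_distrib right_diff_distrib) simp
  qed
  define X where "X t = V t * P t - P t * V t" for t
  have X: "X t = X 0" if "t \<in> {0..1}" for t
  proof (rule const_if_has_vector_derivative_0[OF _ that])
    fix t :: real assume t: "t \<in> {0..1}"
    have "(X has_vector_derivative (V t * V t + a t * P t) - (P t * a t + V t * V t)) (at t within {0..1})"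
      unfolding X_def[abs_def]
      by (intro has_vector_derivative_diff bop_mult_has_vector_derivative dP dV t)
    then show "(X has_vector_derivative 0) (at t within {0..1})" by (simp add: comm[OF t])
  qed
  define Y where "Y = X 0"
  \<comment> \<open>By the involution property the velocity is the commutator of the conserved
    \<open>Y\<close> with \<open>P t\<close>, so \<open>P\<close> solves a linear equation with
    constant coefficients.\<close>
  have VY: "V t = Y * P t - P t * Y" if t: "t \<in> {0..1}" for t
    using tangential_commutator(2)[OF hs_projD(2)[OF hP[OF t]] tan[OF t]] X[OF t] unfolding X_def Y_def by simp
  let ?E = "\<lambda>t. bexp (t *\<^sub>R (- Y))" and ?F = "\<lambda>t. bexp (t *\<^sub>R Y)"
  \<comment> \<open>Undoing the conjugation by the group generated by \<open>Y\<close> freezes the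
    curve.\<close>
  have "(\<lambda>t. ?E t * (P t * ?F t)) 1 = (\<lambda>t. ?E t * (P t * ?F t)) 0"
  proof (rule const_if_has_vector_derivative_0)
    fix t :: real assume t: "t \<in> {0..1}"
    have c: "- Y * ?E t = ?E t * - Y" by (rule bexp_commute) simp
    have "?E t * (P t * (Y * ?F t) + V t * ?F t) + - Y * ?E t * (P t * ?F t) = 0"
      unfolding c VY[OF t] by (simp add: algebra_simps)
    with bop_mult_has_vector_derivative[OF bexp_has_vector_derivative[of "- Y" t "{0..1}"]
        bop_mult_has_vector_derivative[OF dP[OF t] bexp_has_vector_derivative[of Y t "{0..1}"]]]
    show "((\<lambda>t. ?E t * (P t * ?F t)) has_vector_derivative 0) (at t within {0..1})" by simp
  qed simp
  then have eq: "bexp (- Y) * (P 1 * bexp Y) = P 0" by simp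
  have "bexp Y * P 0 * bexp (- Y) = (bexp Y * bexp (- Y)) * P 1 * (bexp Y * bexp (- Y))"
    unfolding eq[symmetric] by (simp only: mult.assoc)
  then have "bexp Y * P 0 * bexp (- Y) = P 1" by (simp add: bexp_minus_mult)
  then have "\<gamma> 1 = bexp Y * \<gamma> 0 * bexp (- Y)"
    using \<gamma>P[of 0] \<gamma>P[of 1] one_plus_conj[of 1 Y "P 0"] by simp
  moreover have "P 0 = P0" using P0 \<gamma>P[of 0] by simp
  ultimately show ?thesis by (simp add: Y_def X_def V_def V0)
qed

text \<open>The definite description is resolved by one explicit geodesic for existence and by
  \<open>geodesic_end\<close> for uniqueness of the end point.\<close>

lemma exp_map_orbit:
  assumes P: "in_orbit P" and v: "tangential P (op_of v)" and T: "T = op_of v * P - P * op_of v"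
  shows "v \<in> exp_domain orbit (1 + P)" "exp_map orbit (1 + P) v = bexp T * (1 + P) * bexp (- T)"
proof -
  note hP = hs_projD[OF in_orbit_hs_proj[OF P]]
  have adjT: "adj T = - T" unfolding T by (rule skew_commutator) (simp_all add: hP)
  have tT: "tangential P T" "T * P - P * T = op_of v"
    unfolding T using tangential_commutator[OF hP(2) v] by blast+
  let ?\<gamma> = "\<lambda>t. bexp (t *\<^sub>R T) * (1 + P) * bexp (t *\<^sub>R (- T))"
  have g: "geodesic orbit ?\<gamma>" by (rule geodesic_conj[OF P adjT tT(1)])
  have v0: "velocity ?\<gamma> 0 = v"
  proof -
    have "velocity ?\<gamma> 0 = conj_curve T (op_of v) 0"
      using velocity_conj[OF P adjT, of 0] unfolding tT(2) by simp
    also have "\<dots> = v"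
      unfolding op_of_inject[symmetric] by (simp add: op_of_conj_curve hilbert_schmidt_op_of adjT)
    finally show ?thesis .
  qed
  show "v \<in> exp_domain orbit (1 + P)"
    unfolding exp_domain_def tangent_space_orbit[OF P] using v g v0
    by (intro CollectI conjI exI[of _ ?\<gamma>]) simp_all
  show "exp_map orbit (1 + P) v = bexp T * (1 + P) * bexp (- T)"
    unfolding exp_map_def
  proof (rule the_equality)
    show "\<exists>\<gamma>. geodesic orbit \<gamma> \<and> \<gamma> 0 = 1 + P \<and> velocity \<gamma> 0 = v \<and> \<gamma> 1 = bexp T * (1 + P) * bexp (- T)"
      using g v0 by (intro exI[of _ ?\<gamma>]) simp
    fix q assume "\<exists>\<gamma>. geodesic orbit \<gamma> \<and> \<gamma> 0 = 1 + P \<and> velocity \<gamma> 0 = v \<and> \<gamma> 1 = q"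
    then obtain \<gamma> where "geodesic orbit \<gamma>" "\<gamma> 0 = 1 + P" "velocity \<gamma> 0 = v" "\<gamma> 1 = q" by blast
    then show "q = bexp T * (1 + P) * bexp (- T)" using geodesic_end[of \<gamma> "op_of v" P] by (simp add: T)
  qed
qed

text \<open>The rotation that takes \<open>P\<close> to \<open>Q\<close> has a co-diagonal skew
  generator \<open>T\<close>. Its commutator with \<open>P\<close> is Hilbert-Schmidt because
  \<open>P\<close> is, and it is the tangent vector whose exponential is \<open>q\<close>.\<close>

lemma exp_map_orbit_surj:
  assumes P: "in_orbit P"
  shows "exp_map orbit (1 + P) ` tangent_space orbit (1 + P) = orbit"
proof (intro set_eqI iffI)
  note hP = hs_projD[OF in_orbit_hs_proj[OF P]]
  fix q assume "q \<in> exp_map orbit (1 + P) ` tangent_space orbit (1 + P)"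
  then obtain v where v: "tangential P (op_of v)" "q = exp_map orbit (1 + P) v"
    by (auto simp: tangent_space_orbit[OF P])
  have "adj (op_of v * P - P * op_of v) = - (op_of v * P - P * op_of v)"
    by (rule skew_commutator) (simp_all add: hP)
  from curve_in_orbit[OF P this, of 1] show "q \<in> orbit" unfolding v(2) exp_map_orbit(2)[OF P v(1) refl] by simp
next
  note hP = hs_projD[OF in_orbit_hs_proj[OF P]]
  fix q assume "q \<in> orbit"
  then obtain Q where q: "q = 1 + Q" "in_orbit Q" by (auto simp: orbit_iff)
  have "\<bar>hs2 P - hs2 Q\<bar> < 1" using in_orbit_hs2 P q by simp
  then obtain T where T: "adj T = - T" "P * T + T * P = T" "bexp T * P * bexp (- T) = Q"
    using hs_proj_rotation[OF in_orbit_hs_proj[OF P] in_orbit_hs_proj[OF q(2)]] by blast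
  have tT: "tangential P T" using T(2) by (simp add: tangential_def)
  let ?V = "T * P - P * T"
  have V: "op_of (sa_part ?V) = ?V"
    by (rule op_of_sa_part_self) (auto intro!: hs_diff hs_mult_left(1)[OF hP(4)] hs_mult_right(1)[OF hP(4)] simp: hP T(1))
  have "tangential P (op_of (sa_part ?V))" "T = op_of (sa_part ?V) * P - P * op_of (sa_part ?V)"
    unfolding V using tangential_commutator[OF hP(2) tT] by simp_all
  moreover from exp_map_orbit(2)[OF P this] have "exp_map orbit (1 + P) (sa_part ?V) = q"
    using one_plus_conj[of 1 T P] T(3) q by simp
  ultimately show "q \<in> exp_map orbit (1 + P) ` tangent_space orbit (1 + P)"
    unfolding tangent_space_orbit[OF P] by blast
qed

text \<open>The speed is constant, since unitary conjugation preserves \<open>hs2\<close>. The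
  squared norm is 4 times \<open>hs2\<close> and the metric is half of it, which leaves the factor
  2.\<close>

lemma curve_length_conj:
  assumes P: "in_orbit P" and T: "adj T = - T" "tangential P T"
  shows "curve_length (\<lambda>t. bexp (t *\<^sub>R T) * (1 + P) * bexp (t *\<^sub>R (- T))) = sqrt (2 * hs2 (T * P - P * T))"
proof -
  note hP = hs_projD[OF in_orbit_hs_proj[OF P]]
  let ?\<gamma> = "\<lambda>t. bexp (t *\<^sub>R T) * (1 + P) * bexp (t *\<^sub>R (- T))"
  let ?W = "T * P - P * T"
  have W: "hilbert_schmidt ?W" "adj ?W = ?W"
    by (auto intro!: hs_diff hs_mult_left(1)[OF hP(4)] hs_mult_right(1)[OF hP(4)] simp: hP T)
  have "riem_metric (?\<gamma> t) (velocity ?\<gamma> t) (velocity ?\<gamma> t) = 2 * hs2 ?W" if t: "t \<in> {0..1}" for t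
  proof -
    let ?Q = "bexp (t *\<^sub>R T) * P * bexp (t *\<^sub>R (- T))" and ?v = "velocity ?\<gamma> t"
    have "in_orbit ?Q" by (rule in_orbit_bexp[OF P T(1)])
    note hQ = in_orbit_hs_proj[OF this]
    have EF: "bexp (t *\<^sub>R (- T)) * (bexp (t *\<^sub>R T) * S) = S" for S
      using bexp_minus_mult[of "- (t *\<^sub>R T)"] by (simp add: mult.assoc[symmetric])
    have v: "?v = conj_curve T ?W t" by (rule velocity_conj[OF P T(1) t])
    have "P * ?W + ?W * P = ?W" using tangential_commutator(1)[OF hP(2) T(2)] by (simp only: tangential_def)
    then have "bexp (t *\<^sub>R T) * (P * ?W + ?W * P) * bexp (t *\<^sub>R (- T)) = bexp (t *\<^sub>R T) * ?W * bexp (t *\<^sub>R (- T))"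
      by (simp only:)
    then have "tangential ?Q (op_of ?v)"
      unfolding v op_of_conj_curve[OF W T(1)] tangential_def
      by (simp only: distrib_left distrib_right mult.assoc EF)
    from riem_metric_tangential(1)[OF hQ this, of ?v]
    have "riem_metric (?\<gamma> t) ?v ?v = (norm ?v)\<^sup>2 / 2"
      unfolding one_plus_conj by (simp add: power2_norm_eq_inner)
    also have "\<dots> = 2 * hs2 ?W" unfolding v norm_conj_curve[OF W T(1)] by (simp add: power_mult_distrib hs2_nonneg)
    finally show ?thesis .
  qed
  then have "curve_length ?\<gamma> = integral {0..1} (\<lambda>t::real. sqrt (2 * hs2 ?W))"
    unfolding curve_length_def by (intro integral_cong) simp
  then show ?thesis by simp
qed

subsection \<open>Invariance of the distance\<close>

text \<open>Conjugation turns each curve from \<open>p\<close> to \<open>q\<close> into one of equal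
  length between the conjugated points, so the second infimum runs over a subset. Equality follows
  by conjugating back.\<close>

lemma geod_dist_conj_le:
  assumes u: "unitary_op u"
  shows "geod_dist orbit (u * p * adj u) (u * q * adj u) \<le> geod_dist orbit p q"
  unfolding geod_dist_def
proof (rule Inf_superset_mono, rule subsetI)
  fix l assume "l \<in> {ereal (curve_length \<gamma>) |\<gamma>. C1_curve orbit \<gamma> \<and> \<gamma> 0 = p \<and> \<gamma> 1 = q}"
  then obtain \<gamma> where l: "l = ereal (curve_length \<gamma>)" and C1: "C1_curve orbit \<gamma>" and ends: "\<gamma> 0 = p" "\<gamma> 1 = q" by blast
  \<comment> \<open>Conjugation as a bounded linear isometry of the Hilbert-Schmidt space, so that
    it commutes with taking velocities.\<close>
  define K where "K x = sa_part (u * op_of x * adj u)" for x :: "'a hsh"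
  let ?\<delta> = "\<lambda>t. u * \<gamma> t * adj u"
  have hs: "hilbert_schmidt (u * op_of x * adj u)" for x by (intro hs_mult_left hs_mult_right hilbert_schmidt_op_of)
  have opK: "op_of (K x) = u * op_of x * adj u" for x
    unfolding K_def by (rule op_of_sa_part_self[OF hs]) (simp add: mult.assoc)
  have normK: "norm (K x) = norm x" for x
    unfolding norm_hsh_hs2 opK hs2_unitary[OF hilbert_schmidt_op_of u] ..
  have K: "bounded_linear K"
  proof (rule bounded_linear_intro[where K=1])
    show "K (x + y) = K x + K y" "K (r *\<^sub>R x) = r *\<^sub>R K x" for x y r
      unfolding op_of_inject[symmetric] by (simp_all add: opK algebra_simps)
  qed (simp add: normK)
  have \<gamma>: "\<gamma> t \<in> orbit" if "t \<in> {0..1}" for t using C1 that by (simp add: C1_curve_def)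
  have \<delta>: "in_orbit (u * (\<gamma> t - 1) * adj u)" "?\<delta> t = 1 + u * (\<gamma> t - 1) * adj u" if "t \<in> {0..1}" for t
    using in_orbit_unitary[OF in_orbit_diff[OF \<gamma>[OF that]] u] by (simp_all add: algebra_simps unitary_op_simps[OF u])
  have coord\<delta>: "coord (?\<delta> t) = K (coord (\<gamma> t))" if "t \<in> {0..1}" for t
    unfolding op_of_inject[symmetric] opK op_of_coord_orbit[OF \<gamma>[OF that]]
    using op_of_coord[OF in_orbit_hs_proj[OF \<delta>(1)[OF that]]] \<delta>(2)[OF that] by simp
  have d: "((\<lambda>s. coord (\<gamma> s)) has_vector_derivative velocity \<gamma> t) (at t within {0..1})" if "t \<in> {0..1}" for t
    by (rule C1_curve_has_vector_derivative[OF C1 that])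
  have d\<delta>: "((\<lambda>s. coord (?\<delta> s)) has_vector_derivative K (velocity \<gamma> t)) (at t within {0..1})" if t: "t \<in> {0..1}" for t
    by (rule has_vector_derivative_transform[OF t coord\<delta> bounded_linear.has_vector_derivative[OF K d[OF t]]])
  have v\<delta>: "velocity ?\<delta> t = K (velocity \<gamma> t)" if "t \<in> {0..1}" for t by (rule velocity_eqI[OF d\<delta>[OF that] that])
  have "C1_curve orbit ?\<delta>"
    unfolding C1_curve_def
  proof (intro conjI ballI)
    show "?\<delta> t \<in> orbit" if "t \<in> {0..1}" for t using \<delta>[OF that] by (auto simp: orbit_iff)
    show "(\<lambda>s. coord (?\<delta> s)) differentiable at t within {0..1}" if "t \<in> {0..1}" for t
      using d\<delta>[OF that] by (rule differentiableI_vector)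
    have "continuous_on {0..1} (\<lambda>t. K (velocity \<gamma> t))"
      using C1 by (intro bounded_linear.continuous_on[OF K]) (simp add: C1_curve_def)
    then show "continuous_on {0..1} (velocity ?\<delta>)" by (rule continuous_on_eq) (simp add: v\<delta>)
  qed
  moreover have "curve_length ?\<delta> = curve_length \<gamma>"
    unfolding curve_length_def
  proof (intro integral_cong arg_cong[where f = sqrt])
    fix t :: real assume t: "t \<in> {0..1}"
    have "tangential (op_of (coord (\<gamma> t))) (op_of (velocity \<gamma> t))"
      by (rule projector_curve_tangential[OF d[OF t] at_within_01[OF t] t])
        (simp only: op_of_coord_orbit[OF \<gamma>] hs_projD(2)[OF in_orbit_hs_proj[OF in_orbit_diff[OF \<gamma>]]])
    then have tan: "tangential (\<gamma> t - 1) (op_of (velocity \<gamma> t))"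
      by (simp only: op_of_coord_orbit[OF \<gamma>[OF t]])
    then have "u * ((\<gamma> t - 1) * op_of (velocity \<gamma> t) + op_of (velocity \<gamma> t) * (\<gamma> t - 1)) * adj u = op_of (K (velocity \<gamma> t))"
      unfolding opK tangential_def by (simp only:)
    then have "tangential (u * (\<gamma> t - 1) * adj u) (op_of (K (velocity \<gamma> t)))"
      unfolding opK tangential_def
      by (simp only: distrib_left distrib_right mult.assoc unitary_op_simps[OF u])
    from riem_metric_tangential(1)[OF in_orbit_hs_proj[OF \<delta>(1)[OF t]] this, of "K (velocity \<gamma> t)"]
      riem_metric_tangential(1)[OF in_orbit_hs_proj[OF in_orbit_diff[OF \<gamma>[OF t]]] tan, of "velocity \<gamma> t"]
    show "riem_metric (?\<delta> t) (velocity ?\<delta> t) (velocity ?\<delta> t) = riem_metric (\<gamma> t) (velocity \<gamma> t) (velocity \<gamma> t)"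
      unfolding v\<delta>[OF t] \<delta>(2)[OF t] by (simp add: power2_norm_eq_inner[symmetric] normK)
  qed
  ultimately show "l \<in> {ereal (curve_length \<gamma>) |\<gamma>. C1_curve orbit \<gamma> \<and> \<gamma> 0 = u * p * adj u \<and> \<gamma> 1 = u * q * adj u}"
    using l ends by (intro CollectI exI[of _ ?\<delta>]) simp
qed

lemma geod_dist_conj:
  assumes u: "unitary_op u"
  shows "geod_dist orbit (u * p * adj u) (u * q * adj u) = geod_dist orbit p q"
proof (rule antisym[OF geod_dist_conj_le[OF u]])
  show "geod_dist orbit p q \<le> geod_dist orbit (u * p * adj u) (u * q * adj u)"
    using geod_dist_conj_le[OF unitary_op_adj[OF u], of "u * p * adj u" "u * q * adj u"]
    by (simp add: mult.assoc unitary_op_simps[OF u])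
qed

end

section \<open>The orbit as a submanifold\<close>

subsection \<open>Openness\<close>

text \<open>With \<open>K\<close> as below, \<open>S = T * (1 - K)\<close> and the norm of
  \<open>K\<close> is below 1, so the geometric series inverts the second factor.\<close>

lemma neumann_invertible:
  assumes T: "invertible_op (T::'a::complex_hilbert bop)" and S: "norm (S - T) * norm (inv_op T) < 1"
  shows "invertible_op S"
proof -
  define K where "K = inv_op T * (T - S)"
  have "norm K \<le> norm (inv_op T) * norm (T - S)" unfolding K_def by (rule norm_mult_ineq)
  then have K1: "norm K < 1" using S by (simp add: norm_minus_commute mult.commute)
  have sm: "summable (\<lambda>n. K ^ n)"
  proof (rule summable_norm_cancel, rule summable_comparison_test')
    show "summable (\<lambda>n. norm K ^ n)" using K1 by (intro summable_geometric) simp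
    show "norm (norm (K ^ n)) \<le> norm K ^ n" for n by (simp add: norm_bop_power)
  qed
  define N where "N = suminf (\<lambda>n. K ^ n)"
  have s: "(\<lambda>n. K ^ n) sums N" unfolding N_def by (rule summable_sums[OF sm])
  have tel: "(\<lambda>n. K ^ n - K ^ Suc n) sums 1"
    using telescope_sums'[OF summable_LIMSEQ_zero[OF sm]] by simp
  have "(\<lambda>n. (1 - K) * K ^ n) sums ((1 - K) * N)"
    by (rule bounded_linear.sums[OF bounded_linear_mult_right s])
  then have 1: "(1 - K) * N = 1" using tel by (simp add: left_diff_distrib sums_unique2)
  have "(\<lambda>n. K ^ n * (1 - K)) sums (N * (1 - K))"
    by (rule bounded_linear.sums[OF bounded_linear_mult_left s])
  then have 2: "N * (1 - K) = 1" using tel by (simp add: right_diff_distrib power_Suc2 sums_unique2 del: power_Suc)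
  note iT = inv_op_simps[OF T]
  have SK: "S = T * (1 - K)" by (simp add: K_def right_diff_distrib iT)
  have "N * inv_op T * S = N * (inv_op T * (T * (1 - K)))" unfolding SK by (simp only: mult.assoc)
  then have a: "N * inv_op T * S = 1" by (simp only: iT 2)
  have "S * (N * inv_op T) = T * ((1 - K) * N) * inv_op T" unfolding SK by (simp only: mult.assoc)
  then have "S * (N * inv_op T) = 1" by (simp only: 1 mult.right_neutral iT)
  then show ?thesis using a by (auto simp: invertible_op_def)
qed

lemma open_invertible_affine:
  fixes L :: "'e::real_normed_vector \<Rightarrow> 'a::complex_hilbert bop"
  assumes L: "bounded_linear L" shows "open {x. invertible_op (c + L x)}"
proof (rule openI)
  fix x assume x: "x \<in> {x. invertible_op (c + L x)}"
  interpret L: bounded_linear L by (rule L)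
  obtain M where M: "0 < M" "\<And>x. norm (L x) \<le> norm x * M" using L.pos_bounded by blast
  define k where "k = M * (norm (inv_op (c + L x)) + 1)"
  have k: "k > 0" using M by (simp add: k_def add_nonneg_pos)
  have "invertible_op (c + L y)" if "y \<in> ball x (1 / k)" for y
  proof (rule neumann_invertible)
    show "invertible_op (c + L x)" using x by simp
    have d: "norm (y - x) * k < 1" using that k by (simp add: dist_norm norm_minus_commute field_simps)
    have "norm (c + L y - (c + L x)) * norm (inv_op (c + L x)) \<le> (norm (y - x) * M) * (norm (inv_op (c + L x)) + 1)"
      using M(2)[of "y - x"] M(1) by (intro mult_mono) (auto simp: L.diff)
    also have "\<dots> = norm (y - x) * k" by (simp add: k_def)
    finally show "norm (c + L y - (c + L x)) * norm (inv_op (c + L x)) < 1" using d by simp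
  qed
  then show "\<exists>e>0. ball x e \<subseteq> {x. invertible_op (c + L x)}"
    using k by (intro exI[of _ "1 / k"]) auto
qed

text \<open>Spectral theory is avoided by testing positivity on \<open>x - c J x\<close> with
  \<open>J\<close> the inverse of \<open>T\<close>. The linear term gives \<open>- 2 c\<close> times
  the squared norm of \<open>x\<close>, and the quadratic one returns at most \<open>c\<close> times
  it once \<open>c * norm J\<close> is at most 1.\<close>

lemma positive_invertible_coercive:
  assumes T: "positive_op (T::'a::complex_hilbert bop)" "invertible_op T"
  obtains c where "c > 0" "\<And>x. c * (norm x)\<^sup>2 \<le> inner x (bapp T x)"
proof -
  define J where "J = inv_op T"
  define c where "c = 1 / (norm J + 1)"
  have n: "norm J + 1 > 0" by (simp add: add_nonneg_pos)
  have c: "c > 0" "c * norm J \<le> 1" using n by (simp_all add: c_def)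
  have sa: "inner (bapp T x) y = inner x (bapp T y)" for x y
    using T(1) by (simp add: positive_op_def selfadjoint_def Re_cinner[symmetric])
  have "c * (norm x)\<^sup>2 \<le> inner x (bapp T x)" for x
  proof -
    have TJ: "bapp T (bapp J x) = x" unfolding J_def by (simp add: bapp_mult[symmetric] inv_op_simps[OF T(2)] bapp_one)
    have "0 \<le> inner (x - c *\<^sub>R bapp J x) (bapp T (x - c *\<^sub>R bapp J x))"
      using T(1) by (simp add: positive_op_def Re_cinner)
    also have "\<dots> = inner x (bapp T x) - 2 * c * (norm x)\<^sup>2 + c * (c * inner (bapp J x) x)"
      using sa[of "bapp J x" x] by (simp add: bapp_vec_simps TJ inner_diff_left inner_diff_right power2_norm_eq_inner inner_commute algebra_simps)
    finally have "0 \<le> inner x (bapp T x) - 2 * c * (norm x)\<^sup>2 + c * (c * inner (bapp J x) x)" .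
    moreover have "c * (c * inner (bapp J x) x) \<le> c * (norm x)\<^sup>2"
    proof (rule mult_left_mono)
      have "inner (bapp J x) x \<le> norm (bapp J x) * norm x" by (rule norm_cauchy_schwarz)
      also have "\<dots> \<le> norm J * norm x * norm x" by (intro mult_right_mono norm_bapp) simp
      finally have "c * inner (bapp J x) x \<le> c * (norm J * norm x * norm x)" using c(1) by (intro mult_left_mono) auto
      also have "\<dots> = (c * norm J) * (norm x)\<^sup>2" by (simp add: power2_eq_square)
      also have "\<dots> \<le> 1 * (norm x)\<^sup>2" using c(2) by (intro mult_right_mono) auto
      finally show "c * inner (bapp J x) x \<le> (norm x)\<^sup>2" by simp
    qed (use c in simp)
    ultimately show ?thesis by linarith
  qed
  then show ?thesis using that c(1) by blast
qed

lemma coord_Sigma1: "coord ` (Sigma1 :: 'a::complex_hilbert bop set) = {x. positive_op (1 + op_of x) \<and> invertible_op (1 + op_of x)}"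
proof -
  have c: "coord (1 + op_of x) = x" for x :: "'a hsh" by (simp add: coord_def op_of_inverse)
  have eq: "(Sigma1 :: 'a bop set) = (\<lambda>x. 1 + op_of x) ` {x. positive_op (1 + op_of x) \<and> invertible_op (1 + op_of x)}"
    by (auto simp: Sigma1_def)
  show ?thesis unfolding eq image_image c by (rule image_ident)
qed

text \<open>A coercivity constant \<open>c\<close> tolerates perturbations of operator norm below
  \<open>c\<close>, and the operator norm is dominated by the Hilbert-Schmidt norm.\<close>

lemma open_coord_Sigma1: "open (coord ` (Sigma1 :: 'a::complex_hilbert bop set))"
proof -
  have "open {x :: 'a hsh. positive_op (1 + op_of x) \<and> invertible_op (1 + op_of x)}"
  proof (rule openI)
    fix x :: "'a hsh" assume "x \<in> {x. positive_op (1 + op_of x) \<and> invertible_op (1 + op_of x)}"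
    then have x: "positive_op (1 + op_of x)" "invertible_op (1 + op_of x)" by auto
    obtain c where c: "c > 0" "\<And>v. c * (norm v)\<^sup>2 \<le> inner v (bapp (1 + op_of x) v)"
      using positive_invertible_coercive[OF x] by blast
    obtain e where e: "e > 0" "ball x e \<subseteq> {x. invertible_op (1 + op_of x)}"
      using open_invertible_affine[OF bounded_linear_op_of, of 1] x(2) unfolding open_contains_ball by blast
    have "positive_op (1 + op_of y)" if y: "y \<in> ball x (min c e)" for y
      unfolding positive_op_def
    proof (intro conjI allI)
      show "selfadjoint (1 + op_of y)" by (simp add: selfadjoint_iff)
      fix v
      have "bapp (1 + op_of y) v = bapp (1 + op_of x) v + bapp (op_of (y - x)) v" by (simp add: bapp_linear_simps)
      then have "inner v (bapp (1 + op_of y) v) = inner v (bapp (1 + op_of x) v) + inner v (bapp (op_of (y - x)) v)"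
        by (simp only: inner_add_right)
      moreover have "- inner v (bapp (op_of (y - x)) v) \<le> c * (norm v)\<^sup>2"
      proof -
        have "- inner v (bapp (op_of (y - x)) v) \<le> \<bar>inner v (bapp (op_of (y - x)) v)\<bar>" by simp
        also have "\<dots> \<le> norm v * norm (bapp (op_of (y - x)) v)" by (rule Cauchy_Schwarz_ineq2)
        also have "\<dots> \<le> norm v * (norm (y - x) * norm v)"
          by (intro mult_left_mono order_trans[OF norm_bapp] mult_right_mono norm_op_of_le) auto
        also have "\<dots> = norm (y - x) * (norm v)\<^sup>2" by (simp add: power2_eq_square)
        also have "\<dots> \<le> c * (norm v)\<^sup>2"
          using y by (intro mult_right_mono) (auto simp: dist_norm norm_minus_commute)
        finally show ?thesis .
      qed
      ultimately show "0 \<le> Re (cinner v (bapp (1 + op_of y) v))" using c(2)[of v] by (simp add: Re_cinner)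
    qed
    then show "\<exists>e>0. ball x e \<subseteq> {x. positive_op (1 + op_of x) \<and> invertible_op (1 + op_of x)}"
      using c(1) e by (intro exI[of _ "min c e"]) auto
  qed
  then show ?thesis by (simp only: coord_Sigma1)
qed

lemma hs_proj_in_Sigma1: assumes "hs_proj P" shows "1 + P \<in> Sigma1"
proof -
  have "positive_op (1 + P)"
    unfolding positive_op_def
  proof (intro conjI allI)
    show "selfadjoint (1 + P)" by (simp add: selfadjoint_iff hs_projD[OF assms])
    fix x
    have "inner x (bapp P x) = (norm (bapp P x))\<^sup>2"
      using assms by (simp add: power2_norm_eq_inner hs_proj_inner hs_proj_bapp)
    then show "0 \<le> Re (cinner x (bapp (1 + P) x))"
      by (simp add: Re_cinner bapp_linear_simps bapp_one inner_add_right)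
  qed
  moreover have "invertible_op (1 + P)" by (rule inv_op_one_plus(2)[OF hs_projD(2)[OF assms]])
  ultimately show ?thesis unfolding Sigma1_def
    by (intro CollectI exI[of _ "coord (1 + P)"]) (simp add: op_of_coord[OF assms])
qed

subsection \<open>Block operators\<close>

text \<open>In the block decomposition for \<open>1 = P + Q\<close>, a positive operator with invertible corner \<open>s\<close> is
  \<open>(1 + X) (s + n) (1 + X\<^sup>*)\<close>, where \<open>X\<close> maps the range of \<open>P\<close> to that of \<open>Q\<close> and \<open>n\<close> is the Schur
  complement.  It is a projection near \<open>P\<close> if and only if \<open>s\<^sup>-\<^sup>1 = 1 + X\<^sup>* X\<close> and \<open>n = 0\<close>.  Hence
  \<open>s\<^sup>-\<^sup>1 - 1 - X\<^sup>* X\<close>, \<open>X\<close> and \<open>n\<close> are coordinates that straighten the orbit.\<close>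

lemma mult_assoc_rules:
  fixes a b c d :: "'b::semigroup_mult"
  shows "a * b = d \<Longrightarrow> a * (b * x) = d * x" "a * (b * c) = d \<Longrightarrow> a * (b * (c * x)) = d * x"
    "a * (b * (c * e)) = d \<Longrightarrow> a * (b * (c * (e * x))) = d * x"
  by (simp_all add: mult.assoc[symmetric])

text \<open>In blocks the second factor is \<open>[[N - Y X, Y], [-X, 1]]\<close>. The Schur
  complement of its corner 1 is \<open>N\<close>, hence the inverse has the corner
  \<open>s\<close>.\<close>

lemma schur_inverse:
  fixes P Q N s X Y :: "'a::complex_hilbert bop"
  assumes P: "P * P = P" and Q: "P + Q = 1"
    and X: "P * X = 0" "X * P = X" and Y: "Y * P = 0" "P * Y = Y"
    and s: "P * s = s" "s * P = s" and N: "P * N = N" "N * P = N" and inv: "s * N = P" "N * s = P"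
  shows "(s - s * Y + X * s + Q - X * s * Y) * (Q + N - Y * X + Y - X) = 1"
    "(Q + N - Y * X + Y - X) * (s - s * Y + X * s + Q - X * s * Y) = 1"
proof -
  have Q': "Q = 1 - P" using Q by (simp add: eq_diff_eq add.commute)
  have 1: "X * X = 0" "Y * Y = 0" "X * N * P = X * N" "s * X = 0" "Y * s = 0" "N * X = 0" "Y * N = 0"
  proof -
    show "X * X = 0" using X by (metis mult.assoc mult_zero_right)
    show "Y * Y = 0" using Y by (metis mult.assoc mult_zero_left)
    show "X * N * P = X * N" using N by (simp add: mult.assoc)
    show "s * X = 0" using s X by (metis mult.assoc mult_zero_right)
    show "Y * s = 0" using s Y by (metis mult.assoc mult_zero_left)
    show "N * X = 0" using N X by (metis mult.assoc mult_zero_right)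
    show "Y * N = 0" using N Y by (metis mult.assoc mult_zero_left)
  qed
  note r = P X Y s N inv 1(1,2,4-)
  note r' = r[THEN mult_assoc_rules(1)]
  show "(s - s * Y + X * s + Q - X * s * Y) * (Q + N - Y * X + Y - X) = 1"
    unfolding Q' by (simp add: algebra_simps r r')
  show "(Q + N - Y * X + Y - X) * (s - s * Y + X * s + Q - X * s * Y) = 1"
    unfolding Q' by (simp add: algebra_simps r r')
qed

text \<open>The converse reading: if \<open>[[1 + m, Y], [-X, 1]]\<close> is invertible, the
  \<open>P\<close>-corner of its inverse inverts the Schur complement
  \<open>1 + m + Y X\<close>.\<close>

lemma schur_complement:
  fixes P Q m S X Y :: "'a::complex_hilbert bop"
  assumes P: "P * P = P" and Q: "P + Q = 1"
    and X: "P * X = 0" "X * P = X" and Y: "Y * P = 0" "P * Y = Y" and m: "P * m = m" "m * P = m"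
    and S: "S * (1 + m + Y - X) = 1" "(1 + m + Y - X) * S = 1"
  shows "P * S * P * (P + m + Y * X) = P" "(P + m + Y * X) * (P * S * P) = P"
proof -
  have Q': "Q = 1 - P" using Q by (simp add: eq_diff_eq add.commute)
  have YX: "P * (Y * X) = Y * X" "Y * X * P = Y * X" by (simp_all add: mult.assoc[symmetric] Y) (simp add: mult.assoc X)
  have "P * (S * (1 + m + Y - X)) * Q = P * Q" using S by simp
  then have a: "P * S * Q + P * S * Y = 0"
  proof -
    have "(1 + m + Y - X) * Q = Q + Y" unfolding Q' by (simp add: algebra_simps m Y X)
    then have "P * (S * (1 + m + Y - X)) * Q = P * S * (Q + Y)" by (simp only: mult.assoc)
    moreover have "P * Q = 0" unfolding Q' by (simp add: right_diff_distrib P)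
    ultimately show ?thesis using S by (simp add: distrib_left)
  qed
  have "(1 + m + Y - X) * P = P + m - X" by (simp add: algebra_simps m Y X)
  then have b: "P * S * (P + m - X) = P" using S(1) by (metis mult.assoc mult.right_neutral P)
  have "P * S * P * (P + m + Y * X) = P * S * (P + m + Y * X)"
    by (simp add: distrib_left mult.assoc m P YX Y(2) mult_assoc_rules(1)[OF Y(2)])
  also have "\<dots> = P * S * (P + m - X) + (P * S * Q + P * S * Y) * X"
    unfolding Q' by (simp add: algebra_simps X)
  finally show "P * S * P * (P + m + Y * X) = P" unfolding a b by simp
  have "Q * ((1 + m + Y - X) * S) * P = Q * P" using S by simp
  then have c: "Q * S * P - X * S * P = 0"
  proof -
    have "Q * (1 + m + Y - X) = Q - X" unfolding Q' by (simp add: algebra_simps m Y X)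
    then have "Q * ((1 + m + Y - X) * S) * P = (Q - X) * S * P" by (simp only: mult.assoc[symmetric])
    moreover have "Q * P = 0" unfolding Q' by (simp add: left_diff_distrib P)
    ultimately show ?thesis using S by (simp add: left_diff_distrib)
  qed
  have "P * (1 + m + Y - X) = P + m + Y" by (simp add: algebra_simps m Y X)
  then have d: "(P + m + Y) * S * P = P" using S(2) by (metis mult.assoc mult.right_neutral P)
  have "(P + m + Y * X) * (P * S * P) = (P + m + Y * X) * S * P"
    by (simp add: distrib_right mult.assoc mult_assoc_rules(1)[OF m(2)] mult_assoc_rules(1)[OF P] mult_assoc_rules(1)[OF X(2)])
  also have "\<dots> = (P + m + Y) * S * P - Y * (Q * S * P - X * S * P)"
    unfolding Q' by (simp add: algebra_simps mult_assoc_rules(1)[OF Y(1)])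
  finally show "(P + m + Y * X) * (P * S * P) = P" unfolding c d by simp
qed

subsection \<open>The chart\<close>

lemma subspace_tangential: "subspace {v. tangential P (op_of v)}"
proof (rule subspaceI)
  fix v w and c :: real
  assume v: "v \<in> {v. tangential P (op_of v)}"
  have "P * (c *\<^sub>R op_of v) + c *\<^sub>R op_of v * P = c *\<^sub>R (P * op_of v + op_of v * P)"
    by (simp add: scaleR_right_distrib)
  then show "c *\<^sub>R v \<in> {v. tangential P (op_of v)}" using v by (simp add: tangential_def)
  assume w: "w \<in> {v. tangential P (op_of v)}"
  have "P * (op_of v + op_of w) + (op_of v + op_of w) * P
      = (P * op_of v + op_of v * P) + (P * op_of w + op_of w * P)" by (simp add: algebra_simps)
  then show "v + w \<in> {v. tangential P (op_of v)}" using v w by (simp add: tangential_def)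
qed (simp add: tangential_def)

lemma closed_tangential: "closed {v. tangential P (op_of v)}"
  unfolding tangential_def
  by (intro closed_Collect_eq continuous_intros linear_continuous_on bounded_linear_op_of)

context
  fixes P :: "'a::complex_hilbert bop"
  assumes P: "hs_proj P"
begin

private abbreviation Q where "Q \<equiv> 1 - P"

private lemmas hP = hs_projD[OF P]

text \<open>Completing the corner by \<open>Q\<close> turns invertibility on the range of
  \<open>P\<close> into invertibility on the whole space.\<close>

private definition corner where "corner y = Q + P * op_of y * P"
text \<open>With \<open>X = Q z P\<close> and \<open>m = P z P\<close>, the inverse chart needs the
  inverse of \<open>P + m + adj X * X\<close>, which is quadratic in \<open>z\<close>. This block
  matrix is affine in \<open>z\<close>, and the corner of its inverse is the wanted operator, so
  \<open>smooth_on_inv_op\<close> applies.\<close>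

private definition schur where
  "schur z = 1 + (P * op_of z * P + P * op_of z * Q - Q * op_of z * P)"

private definition R where "R y = inv_op (corner y)"
private definition S where "S z = inv_op (schur z)"

private definition U where "U = {y. invertible_op (corner y)}"
private definition V where "V = {z. invertible_op (schur z)}"

text \<open>With \<open>s\<close> the corner of \<open>y\<close> and \<open>X = Q y P R\<close>, the
  blocks are \<open>1 / s - P - adj X * X\<close>, then \<open>X\<close> with its adjoint, then the
  Schur complement \<open>Q y Q - X s (adj X)\<close>. Factors 2 undo the halving in
  \<open>sa_part\<close>, and trailing factors 1 complete the shape of a product around
  \<open>P\<close>.\<close>

private definition phi where
  "phi y = sa_part (R y * P * 1) - sa_part P - sa_part (R y * P * op_of y * Q * op_of y * R y * P * 1)
    + 2 *\<^sub>R sa_part (Q * op_of y * R y * P * 1) + sa_part (Q * op_of y * Q)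
    - sa_part (Q * op_of y * R y * P * (op_of y * Q))"

private definition psi where
  "psi z = sa_part (P * S z * P * 1) + 2 *\<^sub>R sa_part (Q * op_of z * P * S z * P * 1)
    + sa_part (Q * op_of z * P * S z * P * (op_of z * Q)) + sa_part (Q * op_of z * Q)"

private lemma bl_corner: "bounded_linear (\<lambda>y. P * op_of y * P)"
  by (intro bounded_linear_compose[OF bounded_linear_mult_left]
      bounded_linear_compose[OF bounded_linear_mult_right] bounded_linear_op_of)

private lemma bl_schur: "bounded_linear (\<lambda>z. P * op_of z * P + P * op_of z * Q - Q * op_of z * P)"
  by (intro bounded_linear_add bounded_linear_sub bounded_linear_compose[OF bounded_linear_mult_left]
      bounded_linear_compose[OF bounded_linear_mult_right] bounded_linear_op_of)

private lemma open_U: "open U"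
  unfolding U_def corner_def by (rule open_invertible_affine[OF bl_corner])

private lemma open_V: "open V"
  unfolding V_def schur_def by (rule open_invertible_affine[OF bl_schur])

private lemma smooth_R: "smooth_on U R"
  unfolding R_def[abs_def] corner_def
  by (rule smooth_on_inv_op[OF bl_corner _ open_U]) (simp add: U_def corner_def)

private lemma smooth_S: "smooth_on V S"
  unfolding S_def[abs_def] schur_def
  by (rule smooth_on_inv_op[OF bl_schur _ open_V]) (simp add: V_def schur_def)

private lemma op_diag: "op_of (sa_part (Q * op_of y * Q)) = Q * op_of y * Q"
proof (rule op_of_sa_part_self)
  show "hilbert_schmidt (Q * op_of y * Q)" by (rule hs_mult_right(1)[OF hs_mult_left(1)[OF hilbert_schmidt_op_of]])
qed (simp add: hP mult.assoc)

private lemma bl_diag: "bounded_linear (\<lambda>y. sa_part (Q * op_of y * Q))"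
proof (rule bounded_linear_intro[where K="norm Q * norm Q"])
  show "sa_part (Q * op_of (x + y) * Q) = sa_part (Q * op_of x * Q) + sa_part (Q * op_of y * Q)" for x y
    unfolding op_of_inject[symmetric] op_diag unfolding op_of_simps op_diag by (simp add: algebra_simps)
  show "sa_part (Q * op_of (r *\<^sub>R x) * Q) = r *\<^sub>R sa_part (Q * op_of x * Q)" for r x
    unfolding op_of_inject[symmetric] op_diag unfolding op_of_simps op_diag by simp
  fix x
  have "hs2 (Q * op_of x * Q) \<le> (norm Q)\<^sup>2 * ((norm Q)\<^sup>2 * hs2 (op_of x))"
    by (rule order_trans[OF hs_mult_right(2)[OF hs_mult_left(1)[OF hilbert_schmidt_op_of]]])
      (intro mult_left_mono hs_mult_left(2) hilbert_schmidt_op_of, simp)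
  also have "\<dots> = (norm Q * norm Q * sqrt (hs2 (op_of x)))\<^sup>2"
    by (simp add: power_mult_distrib hs2_nonneg)
  finally have "sqrt (hs2 (Q * op_of x * Q)) \<le> norm Q * norm Q * sqrt (hs2 (op_of x))"
    by (rule real_le_lsqrt[rotated]) (simp add: hs2_nonneg)
  then show "norm (sa_part (Q * op_of x * Q)) \<le> norm x * (norm Q * norm Q)"
    unfolding norm_hsh_hs2 op_diag by (simp add: mult.commute)
qed

private lemma smooth_op: "open W \<Longrightarrow> smooth_on W op_of"
  by (rule smooth_on_linear[OF _ bounded_linear_op_of])

private lemma smooth_phi: "smooth_on U phi"
proof -
  note b = smooth_on_bilinear[OF bounded_bilinear_sandwich[OF hP(4)]]
  note i = smooth_on_mult smooth_R smooth_op[OF open_U] smooth_on_const[OF open_U]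
  have 1: "smooth_on U (\<lambda>y. sa_part (R y * P * 1))" by (rule b; (intro i)?)
  \<comment> \<open>The bracketing selects the last \<open>P\<close> as the Hilbert-Schmidt factor
    in the middle.\<close>
  have "smooth_on U (\<lambda>y. sa_part ((R y * P * op_of y * Q * op_of y * R y) * P * 1))"
    by (rule b; (intro i)?)
  then have 2: "smooth_on U (\<lambda>y. sa_part (R y * P * op_of y * Q * op_of y * R y * P * 1))" .
  have 3: "smooth_on U (\<lambda>y. sa_part (Q * op_of y * R y * P * 1))" by (rule b; (intro i)?)
  have 4: "smooth_on U (\<lambda>y. sa_part (Q * op_of y * R y * P * (op_of y * Q)))" by (rule b; (intro i)?)
  show ?thesis unfolding phi_def[abs_def]
    by (intro smooth_on_add smooth_on_diff 1 2 4 smooth_on_linear_compose[OF bounded_linear_scaleR_right 3]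
        smooth_on_linear[OF open_U bl_diag] smooth_on_const[OF open_U])
qed

private lemma smooth_psi: "smooth_on V psi"
proof -
  note b = smooth_on_bilinear[OF bounded_bilinear_sandwich[OF hP(4)]]
  note i = smooth_on_mult smooth_S smooth_op[OF open_V] smooth_on_const[OF open_V]
  have 1: "smooth_on V (\<lambda>z. sa_part (P * S z * P * 1))" by (rule b; (intro i)?)
  have 2: "smooth_on V (\<lambda>z. sa_part (Q * op_of z * P * S z * P * 1))" by (rule b; (intro i)?)
  have 3: "smooth_on V (\<lambda>z. sa_part (Q * op_of z * P * S z * P * (op_of z * Q)))" by (rule b; (intro i)?)
  show ?thesis unfolding psi_def[abs_def]
    by (intro smooth_on_add 1 3 smooth_on_linear_compose[OF bounded_linear_scaleR_right 2]
        smooth_on_linear[OF open_V bl_diag])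
qed

private lemma op_of_double_sa_part: "hilbert_schmidt T \<Longrightarrow> op_of (2 *\<^sub>R sa_part T) = T + adj T"
  by (simp add: op_of_sa_part)

private lemma QP: "P * Q = 0" "Q * P = 0" "Q * Q = Q"
  by (simp_all add: algebra_simps hP)

text \<open>\<open>R y\<close> is block diagonal: the inverse of the corner of \<open>y\<close> on
  the range of \<open>P\<close>, and 1 on the complement.\<close>

private lemma R_facts:
  assumes y: "y \<in> U"
  shows "R y * P = P * R y" "adj (R y) = R y" "R y * Q = Q" "Q * R y = Q"
    "P * op_of y * P * R y = P" "P * R y * (P * op_of y * P) = P"
proof -
  have inv: "invertible_op (corner y)" using y by (simp add: U_def)
  note i = inv_op_simps[OF inv, folded R_def]
  have c: "P * corner y = P * op_of y * P" "corner y * P = P * op_of y * P"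
    "Q * corner y = Q" "corner y * Q = Q"
    by (simp_all add: corner_def algebra_simps hP)
  have "R y * P = R y * P * (corner y * R y)" by (simp add: i)
  also have "\<dots> = R y * (P * corner y) * R y" by (simp only: mult.assoc)
  also have "\<dots> = (R y * corner y) * (P * R y)" unfolding c(1) c(2)[symmetric] by (simp only: mult.assoc)
  finally show RP: "R y * P = P * R y" by (simp add: i)
  have "adj (corner y) = corner y" by (simp add: corner_def hP mult.assoc)
  then have "adj (R y) * corner y = 1" "corner y * adj (R y) = 1"
    using arg_cong[OF i(1), of adj] arg_cong[OF i(2), of adj] by simp_all
  from inv_op_eqI[OF this] show "adj (R y) = R y" by (simp add: R_def)
  show "R y * Q = Q" using i(3)[of Q] unfolding c(4) .
  have "Q * (corner y * R y) = Q * R y" unfolding mult.assoc[symmetric] c(3) ..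
  then show "Q * R y = Q" by (simp add: i)
  have "P * op_of y * P * R y = P * (corner y * R y)" unfolding c(1)[symmetric] by (simp only: mult.assoc)
  then show "P * op_of y * P * R y = P" by (simp add: i)
  have "P * R y * (P * op_of y * P) = P * (R y * corner y) * P" unfolding c(2)[symmetric] by (simp only: mult.assoc)
  then show "P * R y * (P * op_of y * P) = P" by (simp add: i hP)
qed

private lemma op_of_phi:
  assumes y: "y \<in> U"
  defines "X \<equiv> Q * op_of y * P * R y"
  shows "op_of (phi y) = P * R y - P - adj X * X + (X + adj X) + Q * op_of y * Q - X * (P * op_of y * P) * adj X"
    "P * X = 0" "X * P = X"
proof -
  note r = R_facts[OF y] and ra = R_facts(1,3,4)[OF y, THEN mult_assoc_rules(1)]
  let ?Y = "op_of y"
  have aX: "adj X = P * R y * ?Y * Q" unfolding X_def by (simp add: r hP mult.assoc[symmetric])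
  show "P * X = 0" unfolding X_def by (simp add: QP mult.assoc[symmetric])
  show XP: "X * P = X" unfolding X_def by (simp add: mult.assoc r(1) ra(1) hP)
  have t1: "R y * P * 1 = P * R y" by (simp add: r)
  have t2: "R y * P * ?Y * Q * ?Y * R y * P * 1 = adj X * X"
  proof -
    have "adj X * X = P * R y * ?Y * (Q * Q) * ?Y * P * R y" unfolding aX unfolding X_def by (simp only: mult.assoc)
    then show ?thesis unfolding QP by (simp add: r mult.assoc)
  qed
  have t3: "Q * ?Y * R y * P * 1 = X" unfolding X_def by (simp add: mult.assoc r)
  have t4: "Q * ?Y * R y * P * (?Y * Q) = X * (P * ?Y * P) * adj X"
  proof -
    have "X * (P * ?Y * P) * adj X = Q * ?Y * (P * R y * (P * ?Y * P)) * (P * R y * ?Y * Q)"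
      unfolding aX unfolding X_def by (simp only: mult.assoc)
    also have "\<dots> = Q * ?Y * P * (P * R y * ?Y * Q)" unfolding r(6) ..
    also have "\<dots> = Q * ?Y * R y * P * (?Y * Q)" by (simp add: mult.assoc hP mult_assoc_rules(1)[OF r(1)])
    finally show ?thesis by simp
  qed
  have hX: "hilbert_schmidt X"
    unfolding X_def by (rule hs_mult_right(1)[OF hs_mult_left(1)[OF hP(4)]])
  have hs: "hilbert_schmidt (P * R y)" "hilbert_schmidt X" "hilbert_schmidt (adj X * X)" "hilbert_schmidt (X * (P * ?Y * P) * adj X)"
    by (rule hs_mult_right(1)[OF hP(4)], rule hX, rule hs_mult_left(1)[OF hX],
        rule hs_mult_right(1)[OF hs_mult_right(1)[OF hX]])
  have e: "op_of (sa_part (P * R y)) = P * R y" "op_of (sa_part (adj X * X)) = adj X * X"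
    "op_of (sa_part (X * (P * ?Y * P) * adj X)) = X * (P * ?Y * P) * adj X"
    by (rule op_of_sa_part_self[OF hs(1)], simp add: hP r(1,2), rule op_of_sa_part_self[OF hs(3)], simp,
        rule op_of_sa_part_self[OF hs(4)], simp add: hP mult.assoc)
  show "op_of (phi y) = P * R y - P - adj X * X + (X + adj X) + Q * ?Y * Q - X * (P * ?Y * P) * adj X"
    unfolding phi_def t1 t2 t3 t4 op_of_simps(1-4) op_diag op_of_double_sa_part[OF hs(2)]
      op_of_sa_part_self[OF hP(4,1)]
    by (simp only: e)
qed

text \<open>The off-diagonal blocks of \<open>schur z\<close> have opposite signs, so
  self-adjointness of \<open>s\<close> is not inherited from that matrix. It holds because
  \<open>s\<close> inverts the self-adjoint operator \<open>P + m + adj X * X\<close> in the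
  corner.\<close>

private lemma S_facts:
  assumes z: "z \<in> V"
  defines "X \<equiv> Q * op_of z * P" and "m \<equiv> P * op_of z * P" and "s \<equiv> P * S z * P"
  shows "s * (P + m + adj X * X) = P" "(P + m + adj X * X) * s = P" "P * s = s" "s * P = s" "adj s = s"
    "P * X = 0" "X * P = X" "adj X * P = 0" "P * adj X = adj X" "P * m = m" "m * P = m" "adj m = m"
proof -
  show X: "P * X = 0" "X * P = X" and m: "P * m = m" "m * P = m" "adj m = m" and s: "P * s = s" "s * P = s"
    unfolding X_def m_def s_def by (simp_all add: mult.assoc hP mult_assoc_rules(1)[OF QP(1)])
  show Y: "adj X * P = 0" "P * adj X = adj X"
    using arg_cong[OF X(1), of adj] arg_cong[OF X(2), of adj] by (simp_all add: hP)
  have inv: "invertible_op (schur z)" using z by (simp add: V_def)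
  have sc: "schur z = 1 + m + adj X - X" unfolding schur_def X_def m_def by (simp add: hP mult.assoc)
  note i = inv_op_simps(1,2)[OF inv, folded S_def, unfolded sc]
  note c = schur_complement[of P Q X "adj X" m "S z", OF hP(2) _ X Y m(1,2) i, folded s_def]
  show 1: "s * (P + m + adj X * X) = P" "(P + m + adj X * X) * s = P" using c by simp_all
  have "adj ((P + m + adj X * X) * s) = P" unfolding 1(2) by (rule hP(1))
  then have "adj s * (P + m + adj X * X) = P" by (simp add: hP m)
  then have "adj s * ((P + m + adj X * X) * s) = P * s" by (simp only: mult.assoc[symmetric])
  then have "adj s * P = s" unfolding 1(2) s(1) .
  moreover have "adj (P * s) = adj s" by (simp only: s(1))
  then have "adj s * P = adj s" by (simp add: hP)
  ultimately show "adj s = s" by simp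
qed

private lemma op_of_psi:
  assumes z: "z \<in> V"
  defines "X \<equiv> Q * op_of z * P" and "s \<equiv> P * S z * P"
  shows "op_of (psi z) = s + (X * s + s * adj X) + X * s * adj X + Q * op_of z * Q"
proof -
  note f = S_facts[OF z, folded X_def s_def]
  have aX: "adj X = P * op_of z * Q" unfolding X_def by (simp add: hP mult.assoc)
  have t: "P * S z * P * 1 = s" "Q * op_of z * P * S z * P * 1 = X * s"
    "Q * op_of z * P * S z * P * (op_of z * Q) = X * s * adj X"
    unfolding aX unfolding s_def X_def by (simp_all add: mult.assoc hP)
  have s: "hilbert_schmidt s" unfolding s_def by (intro hs_mult_left hP)
  have hs: "hilbert_schmidt (X * s)" "hilbert_schmidt (X * s * adj X)"
    using s by (simp_all add: hs_mult_left hs_mult_right)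
  have e: "op_of (sa_part (X * s * adj X)) = X * s * adj X"
    by (rule op_of_sa_part_self[OF hs(2)]) (simp add: f(5) mult.assoc)
  show ?thesis
    unfolding psi_def t op_of_simps(1-4) op_diag op_of_double_sa_part[OF hs(1)] op_of_sa_part_self[OF s f(5)]
    by (simp add: e f(5))
qed

text \<open>\<open>schur (phi y)\<close> is the block matrix of \<open>schur_inverse\<close>, with
  \<open>N\<close> the inverse corner of \<open>y\<close>. So \<open>phi y\<close> lies in
  \<open>V\<close>, and the corner of the inverse matrix returns the corner of
  \<open>y\<close>.\<close>

private lemma psi_phi:
  assumes y: "y \<in> U" shows "phi y \<in> V" "psi (phi y) = y"
proof -
  let ?Y = "op_of y"
  define X where "X = Q * ?Y * P * R y"
  define s where "s = P * ?Y * P"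
  define N where "N = P * R y"
  note p = op_of_phi[OF y, folded X_def s_def N_def]
  note r = R_facts[OF y, folded s_def]
  have Y: "adj X * P = 0" "P * adj X = adj X"
    using arg_cong[OF p(2), of adj] arg_cong[OF p(3), of adj] by (simp_all add: hP)
  have s: "P * s = s" "s * P = s" unfolding s_def by (simp_all add: mult.assoc hP)
  have N: "P * N = N" "N * P = N" unfolding N_def by (simp_all add: mult.assoc hP r(1))
  have sN: "s * N = P" "N * s = P" unfolding N_def
    using r(5,6) s by (simp_all add: mult.assoc[symmetric])
  have X': "Q * X = X" "adj X * Q = adj X" using p(2) Y(1) by (simp_all add: left_diff_distrib right_diff_distrib)
  note rr = p(2,3) Y s N hP(2) QP X'
  note rr' = rr[THEN mult_assoc_rules(1)]
  have z11: "P * op_of (phi y) * P = N - P - adj X * X"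
    unfolding p(1) by (simp add: algebra_simps rr rr')
  have z21: "Q * op_of (phi y) * P = X"
    unfolding p(1) by (simp add: algebra_simps rr rr')
  have z12: "P * op_of (phi y) * Q = adj X"
    unfolding p(1) by (simp add: algebra_simps rr rr')
  have z22: "Q * op_of (phi y) * Q = Q * ?Y * Q - X * s * adj X"
    unfolding p(1) by (simp add: algebra_simps rr rr')
  have sc: "schur (phi y) = Q + N - adj X * X + adj X - X"
    unfolding schur_def z11 z21 z12 by (simp add: algebra_simps)
  have PQ: "P + Q = 1" by simp
  note si = schur_inverse[OF hP(2) PQ p(2,3) Y s N sN]
  show V: "phi y \<in> V" unfolding V_def mem_Collect_eq sc invertible_op_def using si by blast
  have S: "S (phi y) = s - s * adj X + X * s + Q - X * s * adj X"
    unfolding S_def sc by (rule inv_op_eqI[OF si])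
  have PSP: "P * S (phi y) * P = s" unfolding S by (simp add: algebra_simps rr rr')
  have Xs: "X * s = Q * ?Y * P"
    unfolding X_def using r(6) by (simp only: mult.assoc)
  have "adj (X * s) = P * ?Y * Q" unfolding Xs by (simp add: hP mult.assoc)
  moreover have "adj s = s" unfolding s_def by (simp add: hP mult.assoc)
  ultimately have sX: "s * adj X = P * ?Y * Q" by simp
  have "op_of (psi (phi y)) = s + (X * s + s * adj X) + X * s * adj X + (Q * ?Y * Q - X * s * adj X)"
    using op_of_psi[OF V] unfolding z21 PSP z22 .
  also have "\<dots> = P * ?Y * P + (Q * ?Y * P + P * ?Y * Q) + Q * ?Y * Q"
    unfolding Xs sX by (simp add: s_def)
  also have "\<dots> = ?Y" by (simp add: algebra_simps)
  finally show "psi (phi y) = y" by (simp add: op_of_inject)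
qed

text \<open>The corner of \<open>psi z\<close> is \<open>s\<close> with inverse \<open>N\<close>, so
  \<open>Q + N\<close> inverts the completed corner, and \<open>X\<close> is recovered from the
  block \<open>X * s\<close> by multiplying with \<open>N\<close>.\<close>

private lemma phi_psi:
  assumes z: "z \<in> V" shows "psi z \<in> U" "phi (psi z) = z"
proof -
  let ?Z = "op_of z"
  define X where "X = Q * ?Z * P"
  define m where "m = P * ?Z * P"
  define s where "s = P * S z * P"
  note f = S_facts[OF z, folded X_def m_def s_def]
  note p = op_of_psi[OF z, folded X_def s_def]
  define N where "N = P + m + adj X * X"
  have N: "P * N = N" "N * P = N" unfolding N_def by (simp_all add: algebra_simps hP f mult_assoc_rules(1)[OF f(9)])
  have sN: "s * N = P" "N * s = P" using f(1,2) by (simp_all add: N_def)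
  have X': "Q * X = X" "adj X * Q = adj X" using f(6,8) by (simp_all add: left_diff_distrib right_diff_distrib)
  note rr = f(3,4,6-9) N hP(2) QP X'
  note rr' = rr[THEN mult_assoc_rules(1)]
  have y11: "P * op_of (psi z) * P = s" unfolding p by (simp add: algebra_simps rr rr')
  have y21: "Q * op_of (psi z) * P = X * s" unfolding p by (simp add: algebra_simps rr rr')
  have y22: "Q * op_of (psi z) * Q = X * s * adj X + Q * ?Z * Q" unfolding p by (simp add: algebra_simps rr rr')
  have c: "corner (psi z) = Q + s" unfolding corner_def y11 ..
  have i: "(Q + N) * (Q + s) = 1" "(Q + s) * (Q + N) = 1"
    by (simp_all add: algebra_simps rr rr' sN)
  show U: "psi z \<in> U" unfolding U_def mem_Collect_eq c invertible_op_def using i by blast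
  have R: "R (psi z) = Q + N" unfolding R_def c by (rule inv_op_eqI[OF i])
  have X2: "Q * op_of (psi z) * P * R (psi z) = X"
    unfolding y21 R by (simp add: algebra_simps rr rr' sN)
  have PR: "P * R (psi z) = N" unfolding R by (simp add: algebra_simps rr)
  have aX: "adj X = P * ?Z * Q" unfolding X_def by (simp add: hP mult.assoc)
  have "op_of (phi (psi z)) = N - P - adj X * X + (X + adj X) + (X * s * adj X + Q * ?Z * Q) - X * s * adj X"
    using op_of_phi(1)[OF U] unfolding X2 PR y11 y22 .
  also have "\<dots> = P * ?Z * P + (Q * ?Z * P + P * ?Z * Q) + Q * ?Z * Q"
    unfolding N_def m_def aX by (simp add: X_def)
  also have "\<dots> = ?Z" by (simp add: algebra_simps)
  finally show "phi (psi z) = z" by (simp add: op_of_inject)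
qed

section \<open>The image of the orbit in the chart\<close>

private lemma tangential_iff_blocks: "tangential P Z \<longleftrightarrow> P * Z * P = 0 \<and> Q * Z * Q = 0"
proof
  assume "tangential P Z"
  then show "P * Z * P = 0 \<and> Q * Z * Q = 0"
    using tangential_simps[OF hP(2), of Z] unfolding tangential_def by (simp add: algebra_simps)
next
  assume "P * Z * P = 0 \<and> Q * Z * Q = 0"
  moreover have "Z = P * Z * P + (P * Z * Q + Q * Z * P) + Q * Z * Q" by (simp add: algebra_simps)
  ultimately have Z: "Z = P * Z * Q + Q * Z * P" by simp
  have "P * Z + Z * P = P * (P * Z * Q + Q * Z * P) + (P * Z * Q + Q * Z * P) * P" using Z by simp
  also have "\<dots> = P * Z * Q + Q * Z * P"
    by (simp add: distrib_left distrib_right mult.assoc hP QP mult_assoc_rules(1)[OF QP(1)])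
  finally show "tangential P Z" using Z by (simp add: tangential_def)
qed

text \<open>Idempotence is read off block by block. The \<open>P\<close>-corner gives
  \<open>N = P + adj X * X\<close>, the other blocks show that the Schur complement \<open>n\<close>
  satisfies \<open>n = d n\<close>, where \<open>d\<close> is the \<open>Q\<close>-corner of the
  projection. Near \<open>P\<close> the norm of \<open>d\<close> is below 1, which forces
  \<open>n = 0\<close>.\<close>

private lemma projection_phi_tangential:
  assumes y: "y \<in> U" and Y: "op_of y * op_of y = op_of y" and near: "norm (op_of y - P) * (norm Q * norm Q) < 1"
  shows "tangential P (op_of (phi y))"
proof -
  let ?Y = "op_of y"
  define X where "X = Q * ?Y * P * R y"
  define s where "s = P * ?Y * P"
  define N where "N = P * R y"
  define b where "b = Q * ?Y * P"
  define d where "d = Q * ?Y * Q"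
  note p = op_of_phi[OF y, folded X_def s_def N_def]
  note r = R_facts[OF y, folded s_def]
  have Ya: "adj X * P = 0" "P * adj X = adj X"
    using arg_cong[OF p(2), of adj] arg_cong[OF p(3), of adj] by (simp_all add: hP)
  have s: "P * s = s" "s * P = s" unfolding s_def by (simp_all add: mult.assoc hP)
  have N: "P * N = N" "N * P = N" unfolding N_def by (simp_all add: mult.assoc hP r(1))
  have sN: "s * N = P" "N * s = P" unfolding N_def
    using r(5,6) s by (simp_all add: mult.assoc[symmetric])
  have X': "Q * X = X" "adj X * Q = adj X" using p(2) Ya(1) by (simp_all add: left_diff_distrib right_diff_distrib)
  note rr = p(2,3) Ya s N hP(2) QP X'
  note rr' = rr[THEN mult_assoc_rules(1)]
  have z11: "P * op_of (phi y) * P = N - P - adj X * X"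
    unfolding p(1) by (simp add: algebra_simps rr rr')
  have z22: "Q * op_of (phi y) * Q = d - X * s * adj X"
    unfolding p(1) by (simp add: d_def algebra_simps rr rr')
  have PQ1: "A * B = A * (P * B) + A * (Q * B)" for A B by (simp add: algebra_simps)
  have blk: "A * ?Y * B = (A * ?Y * P) * (P * ?Y * B) + (A * ?Y * Q) * (Q * ?Y * B)" for A B
  proof -
    have "A * ?Y * B = A * (?Y * ?Y) * B" by (simp only: Y)
    also have "\<dots> = A * (?Y * (P * ?Y) + ?Y * (Q * ?Y)) * B" by (simp only: PQ1[of ?Y ?Y, symmetric])
    also have "\<dots> = (A * ?Y * (P * P)) * ?Y * B + (A * ?Y * (Q * Q)) * ?Y * B"
      unfolding hP(2) QP(3) by (simp only: distrib_left distrib_right mult.assoc)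
    finally show ?thesis by (simp only: mult.assoc)
  qed
  have ab: "adj b = P * ?Y * Q" unfolding b_def by (simp add: hP mult.assoc)
  have Xb: "X = b * N" unfolding X_def b_def N_def by (simp add: mult.assoc hP)
  have adjN: "adj N = N" unfolding N_def by (simp add: hP r(1,2))
  have aXb: "adj X = N * adj b" unfolding Xb by (simp add: adjN)
  have e1: "s = s * s + adj b * b" using blk[of P P] unfolding s_def[symmetric] ab[symmetric] b_def[symmetric] .
  have e2: "b = b * s + d * b" using blk[of Q P] unfolding s_def[symmetric] d_def[symmetric] b_def[symmetric] .
  have e3: "d = b * adj b + d * d" using blk[of Q Q] unfolding d_def[symmetric] ab[symmetric] b_def[symmetric] .
  have bP: "b * P = b" "P * adj b = adj b" unfolding b_def by (simp_all add: hP mult.assoc)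
  have "N * s * N = N * (s * s) * N + N * (adj b * b) * N"
    using arg_cong[OF e1, of "\<lambda>T. N * T * N"] by (simp only: distrib_left distrib_right)
  moreover have "N * s * N = N" by (simp add: sN N)
  moreover have "N * (s * s) * N = P" by (simp add: mult.assoc[symmetric] sN s)
  ultimately have "N = P + N * (adj b * b) * N" by simp
  also have "N * (adj b * b) * N = adj X * X" unfolding aXb unfolding Xb by (simp only: mult.assoc)
  finally have "N = P + adj X * X" .
  then have 1: "P * op_of (phi y) * P = 0" unfolding z11 by simp
  have "b * N = b * s * N + d * b * N" using arg_cong[OF e2, of "\<lambda>T. T * N"] by (simp only: distrib_right)
  then have "X = b + d * X" unfolding Xb by (simp add: mult.assoc sN bP)
  then have "X * adj b = b * adj b + d * (X * adj b)" by (metis distrib_right mult.assoc)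
  moreover have XsX: "X * s * adj X = X * adj b" unfolding aXb by (simp add: mult.assoc mult_assoc_rules(1)[OF sN(1)] bP)
  ultimately have w: "d - X * s * adj X = d * (d - X * s * adj X)"
    using e3 by (simp add: right_diff_distrib) (metis add_diff_cancel_left add.commute)
  have "norm d \<le> norm (?Y - P) * (norm Q * norm Q)"
  proof -
    have "d = Q * (?Y - P) * Q" unfolding d_def by (simp add: right_diff_distrib QP del: left_diff_distrib)
    then have "norm d \<le> norm Q * norm (?Y - P) * norm Q"
      using order_trans[OF norm_mult_ineq mult_right_mono[OF norm_mult_ineq norm_ge_zero]] by simp
    then show ?thesis by (simp add: mult_ac)
  qed
  then have "norm d < 1" using near by simp
  have "norm (d - X * s * adj X) \<le> norm d * norm (d - X * s * adj X)"
    using norm_mult_ineq[of d "d - X * s * adj X"] w by simp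
  then have "\<not> norm (d - X * s * adj X) > 0"
    using mult_strict_right_mono[OF \<open>norm d < 1\<close>, of "norm (d - X * s * adj X)"] by linarith
  then have "d - X * s * adj X = 0" by simp
  then show ?thesis unfolding tangential_iff_blocks z22 using 1 by simp
qed

text \<open>For vanishing diagonal blocks \<open>psi z\<close> is
  \<open>(1 + X) s (1 + adj X)\<close>, and \<open>s\<close> is the inverse of
  \<open>P + adj X * X\<close> in the corner, so the inner factors of the square collapse to
  \<open>s\<close>.\<close>

private lemma psi_tangential_projection:
  assumes z: "z \<in> V" and Z: "tangential P (op_of z)"
  shows "hs_proj (op_of (psi z))"
proof -
  let ?Z = "op_of z"
  define X where "X = Q * ?Z * P"
  define s where "s = P * S z * P"
  note f = S_facts[OF z, folded X_def s_def]
  have z0: "P * ?Z * P = 0" "Q * ?Z * Q = 0" using Z by (simp_all add: tangential_iff_blocks)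
  have p: "op_of (psi z) = (s + X * s) * (1 + adj X)"
    unfolding op_of_psi[OF z, folded X_def s_def] z0 by (simp add: algebra_simps)
  have sN: "s * (P + adj X * X) = P" using f(1) unfolding z0 by simp
  have sX: "s * X = 0" "adj X * s = 0"
    using f(3,4,6,8) by (metis mult.assoc mult_zero_right, metis mult.assoc mult_zero_left)
  have "s * (1 + adj X) * (s + X * s) = s * (P + adj X * X) * s"
    by (simp add: algebra_simps f(3,4) mult_assoc_rules(1)[OF f(4)] sX mult_assoc_rules(1)[OF sX(1)] mult_assoc_rules(1)[OF sX(2)])
  then have k: "s * (1 + adj X) * (s + X * s) = s" unfolding sN f(3) .
  have e: "s + X * s = (1 + X) * s" by (simp add: distrib_right)
  have k': "s * (1 + adj X) * ((1 + X) * s) = s" using k unfolding e .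
  have "(s + X * s) * (1 + adj X) * ((s + X * s) * (1 + adj X)) = (1 + X) * (s * (1 + adj X) * (s + X * s)) * (1 + adj X)"
    unfolding e by (simp only: mult.assoc)
  then have "op_of (psi z) * op_of (psi z) = op_of (psi z)" unfolding p e k' .
  then show ?thesis by (simp add: hs_proj_def hilbert_schmidt_op_of)
qed

text \<open>The squared Hilbert-Schmidt norm of a projection is its rank, so nearby projections are
  unitarily equivalent.\<close>

lemma orbit_chart:
  assumes A: "hs_proj A" and PA: "in_orbit A P"
  defines "Orb \<equiv> coord ` unitary_orbit (1 + A)"
  shows "\<exists>U' V' E \<phi> \<psi>. coord (1 + P) \<in> U' \<and> U' \<subseteq> coord ` Sigma1 \<and> smooth_on U' \<phi> \<and> smooth_on V' \<psi> \<and>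
      \<phi> ` U' = V' \<and> \<psi> ` V' = U' \<and> (\<forall>y\<in>U'. \<psi> (\<phi> y) = y) \<and> (\<forall>z\<in>V'. \<phi> (\<psi> z) = z) \<and>
      subspace E \<and> closed E \<and> \<phi> ` (U' \<inter> Orb) = V' \<inter> (E :: 'a hsh set)"
proof -
  have orb_iff: "y \<in> Orb \<longleftrightarrow> in_orbit A (op_of y)" for y
  proof
    assume "y \<in> Orb"
    then obtain Q where "in_orbit A Q" "y = coord (1 + Q)" by (auto simp: Orb_def orbit_iff[OF A])
    then show "in_orbit A (op_of y)" by (simp add: op_of_coord[OF in_orbit_hs_proj[OF A]])
  next
    assume y: "in_orbit A (op_of y)"
    have "y = coord (1 + op_of y)" by (simp add: coord_def op_of_inverse)
    then show "y \<in> Orb" unfolding Orb_def using y orbit_iff[OF A] by blast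
  qed
  define y0 where "y0 = coord (1 + P)"
  have y0: "op_of y0 = P" unfolding y0_def by (rule op_of_coord[OF P])
  \<comment> \<open>The first summand of the denominator keeps the \<open>Q\<close>-corner below
    norm 1, the second bounds the change of the squared norm; each added 1 yields a strict
    inequality.\<close>
  define \<delta> where "\<delta> = 1 / ((norm Q * norm Q + 1) + (2 * norm y0 + 1))"
  have den: "(norm Q * norm Q + 1) + (2 * norm y0 + 1) > 0" by (intro add_pos_pos add_nonneg_pos) auto
  then have \<delta>: "\<delta> > 0" by (simp add: \<delta>_def)
  have \<delta>1: "\<delta> * (norm Q * norm Q) < 1" "\<delta> * (2 * norm y0 + 1) < 1" "\<delta> \<le> 1"
    using den add_pos_nonneg[of 2 "2 * norm y0"] add_pos_nonneg[of 1 "norm Q * norm Q"]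
    by (simp_all add: \<delta>_def divide_less_eq divide_le_eq add_nonneg_pos)
  define W where "W = ball y0 \<delta> \<inter> coord ` Sigma1"
  have oW: "open W" unfolding W_def by (intro open_Int open_ball open_coord_Sigma1)
  let ?U = "U \<inter> W" and ?V = "V \<inter> psi -` W"
  let ?E = "{z. tangential P (op_of z)}"
  have oU: "open ?U" by (intro open_Int open_U oW)
  have oV: "open ?V"
    by (rule continuous_open_preimage[OF smooth_on_imp_continuous_on[OF smooth_psi] open_V oW])
  have y0U: "y0 \<in> U"
  proof -
    have "corner y0 = 1" by (simp add: corner_def y0 hP)
    then show ?thesis by (auto simp: U_def invertible_op_def intro: exI[of _ 1])
  qed
  have y0W: "y0 \<in> W" unfolding W_def using \<delta> hs_proj_in_Sigma1[OF P] by (simp add: y0_def)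
  \<comment> \<open>The squared norm is 4 times \<open>hs2\<close>, so the two projections have
    \<open>hs2\<close> less than 1 apart and a unitary rotates one into the other.\<close>
  have near: "in_orbit A (op_of y)" if y: "y \<in> W" "hs_proj (op_of y)" for y
  proof -
    have d: "norm (y - y0) < \<delta>" using y(1) by (simp add: W_def dist_norm norm_minus_commute)
    have "\<bar>norm y - norm y0\<bar> \<le> norm (y - y0)" by (rule norm_triangle_ineq3)
    moreover have "norm y + norm y0 \<le> 2 * norm y0 + 1" using norm_triangle_ineq2[of y y0] d \<delta>1(3) by linarith
    ultimately have "\<bar>norm y - norm y0\<bar> * (norm y + norm y0) \<le> norm (y - y0) * (2 * norm y0 + 1)"
      by (intro mult_mono) auto
    also have "\<dots> \<le> \<delta> * (2 * norm y0 + 1)" using d by (intro mult_right_mono) auto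
    finally have "\<bar>norm y - norm y0\<bar> * (norm y + norm y0) < 1" using \<delta>1(2) by linarith
    moreover have "\<bar>(norm y)\<^sup>2 - (norm y0)\<^sup>2\<bar> = \<bar>norm y - norm y0\<bar> * (norm y + norm y0)"
    proof -
      have "(norm y)\<^sup>2 - (norm y0)\<^sup>2 = (norm y - norm y0) * (norm y + norm y0)"
        by (simp add: power2_eq_square algebra_simps)
      then show ?thesis by (simp add: abs_mult)
    qed
    ultimately have "\<bar>hs2 P - hs2 (op_of y)\<bar> < 1" unfolding norm_hsh_power2 y0 by linarith
    then obtain T where T: "adj T = - T" "bexp T * P * bexp (- T) = op_of y"
      using hs_proj_rotation[OF P y(2)] by blast
    show ?thesis using in_orbit_bexp[OF A PA T(1), of 1] T(2) by simp
  qed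
  have "coord (1 + P) \<in> ?U \<and> ?U \<subseteq> coord ` Sigma1 \<and> smooth_on ?U phi \<and> smooth_on ?V psi \<and>
      phi ` ?U = ?V \<and> psi ` ?V = ?U \<and> (\<forall>y\<in>?U. psi (phi y) = y) \<and> (\<forall>z\<in>?V. phi (psi z) = z) \<and>
      subspace ?E \<and> closed ?E \<and> phi ` (?U \<inter> Orb) = ?V \<inter> ?E"
  proof (intro conjI ballI)
    show "coord (1 + P) \<in> ?U" using y0U y0W by (simp add: y0_def)
    show "?U \<subseteq> coord ` Sigma1" by (auto simp: W_def)
    show "smooth_on ?U phi" by (rule smooth_on_subset[OF smooth_phi oU]) simp
    show "smooth_on ?V psi" by (rule smooth_on_subset[OF smooth_psi oV]) simp
    show i: "psi (phi y) = y" if "y \<in> ?U" for y using that psi_phi by simp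
    show j: "phi (psi z) = z" if "z \<in> ?V" for z using that phi_psi by simp
    have phiU: "phi y \<in> ?V" if "y \<in> ?U" for y using that psi_phi by simp
    have psiV: "psi z \<in> ?U" if "z \<in> ?V" for z using that phi_psi by simp
    show "phi ` ?U = ?V"
    proof (intro set_eqI iffI)
      fix z assume "z \<in> ?V"
      then show "z \<in> phi ` ?U" using j[of z] psiV[of z] by (metis imageI)
    qed (use phiU in blast)
    show "psi ` ?V = ?U"
    proof (intro set_eqI iffI)
      fix y assume "y \<in> ?U"
      then show "y \<in> psi ` ?V" using i[of y] phiU[of y] by (metis imageI)
    qed (use psiV in blast)
    show "subspace ?E" by (rule subspace_tangential)
    show "closed ?E" by (rule closed_tangential)
    show "phi ` (?U \<inter> Orb) = ?V \<inter> ?E"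
    proof (intro set_eqI iffI)
      fix z assume "z \<in> phi ` (?U \<inter> Orb)"
      then obtain y where y: "y \<in> ?U" "y \<in> Orb" "z = phi y" by blast
      have "tangential P (op_of (phi y))"
      proof (rule projection_phi_tangential)
        show "y \<in> U" using y by simp
        show "op_of y * op_of y = op_of y" using y(2) orb_iff hs_projD(2)[OF in_orbit_hs_proj[OF A]] by simp
        have "norm (op_of y - P) \<le> norm (y - y0)" using norm_op_of_le[of "y - y0"] by (simp add: y0)
        also have "\<dots> \<le> \<delta>" using y(1) by (simp add: W_def dist_norm norm_minus_commute)
        finally have "norm (op_of y - P) * (norm Q * norm Q) \<le> \<delta> * (norm Q * norm Q)" by (intro mult_right_mono) auto
        then show "norm (op_of y - P) * (norm Q * norm Q) < 1" using \<delta>1(1) by linarith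
      qed
      then show "z \<in> ?V \<inter> ?E" using y phiU by simp
    next
      fix z assume z: "z \<in> ?V \<inter> ?E"
      then have "hs_proj (op_of (psi z))" using psi_tangential_projection by simp
      then have "psi z \<in> Orb" using near[of "psi z"] z orb_iff by simp
      then show "z \<in> phi ` (?U \<inter> Orb)" using psiV[of z] j[of z] z by (metis IntD1 IntI imageI)
    qed
  qed
  then show ?thesis by (intro exI) assumption
qed

end

lemma riemannian_submanifold_orbit:
  assumes A: "hs_proj (A::'a::complex_hilbert bop)"
  shows "riemannian_submanifold (unitary_orbit (1 + A))"
  unfolding riemannian_submanifold_def
proof (intro conjI ballI)
  show sub: "unitary_orbit (1 + A) \<subseteq> Sigma1"
    using hs_proj_in_Sigma1[OF in_orbit_hs_proj[OF A]] by (auto simp: orbit_iff[OF A])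
  show "embedded_submanifold (coord ` unitary_orbit (1 + A)) (coord ` Sigma1)"
    unfolding embedded_submanifold_def
  proof (intro conjI ballI)
    show "open (coord ` (Sigma1 :: 'a bop set))" by (rule open_coord_Sigma1)
    show "coord ` unitary_orbit (1 + A) \<subseteq> coord ` Sigma1" using sub by (rule image_mono)
    fix x assume "x \<in> coord ` unitary_orbit (1 + A)"
    then obtain P where P: "in_orbit A P" "x = coord (1 + P)" by (auto simp: orbit_iff[OF A])
    show "\<exists>U V E \<phi> \<psi>. x \<in> U \<and> U \<subseteq> coord ` Sigma1 \<and> smooth_on U \<phi> \<and> smooth_on V \<psi> \<and>
      \<phi> ` U = V \<and> \<psi> ` V = U \<and> (\<forall>y\<in>U. \<psi> (\<phi> y) = y) \<and> (\<forall>z\<in>V. \<phi> (\<psi> z) = z) \<and>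
      subspace E \<and> closed E \<and> \<phi> ` (U \<inter> coord ` unitary_orbit (1 + A)) = V \<inter> (E :: 'a hsh set)"
      unfolding P(2) by (rule orbit_chart[OF in_orbit_hs_proj[OF A P(1)] A P(1)])
  qed
  fix p assume "p \<in> unitary_orbit (1 + A)"
  then obtain P where p: "p = 1 + P" and P: "in_orbit A P" by (auto simp: orbit_iff[OF A])
  show "subspace (tangent_space (unitary_orbit (1 + A)) p)"
    unfolding p tangent_space_orbit[OF A P] by (rule subspace_tangential)
  show "closed (tangent_space (unitary_orbit (1 + A)) p)"
    unfolding p tangent_space_orbit[OF A P] by (rule closed_tangential)
  have "riem_metric p v v = (norm v)\<^sup>2 / 2" if "v \<in> tangent_space (unitary_orbit (1 + A)) p" for v
    using that riem_metric_tangential(1)[OF in_orbit_hs_proj[OF A P], of v v]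
    unfolding p tangent_space_orbit[OF A P] by (simp add: power2_norm_eq_inner)
  then show "\<exists>c>0. \<exists>C. \<forall>v\<in>tangent_space (unitary_orbit (1 + A)) p.
      c * (norm v)\<^sup>2 \<le> riem_metric p v v \<and> riem_metric p v v \<le> C * (norm v)\<^sup>2"
    by (intro exI[of _ "1/2"] conjI) auto
qed

section \<open>Commutator form of tangent vectors and generators\<close>

lemma tangential_i_commutator:
  assumes P: "P * P = P" shows "tangential P (\<i> *\<^sub>C commutator x (1 + P))"
proof -
  have "P * (P * S) = P * S" for S by (simp add: mult.assoc[symmetric] P)
  then have "tangential P (x * P - P * x)" by (simp add: tangential_def algebra_simps P)
  moreover have "commutator x (1 + P) = x * P - P * x" by (simp add: commutator_def algebra_simps)
  ultimately show ?thesis by (simp add: tangential_def flip: scaleC_add_right)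
qed

lemma commutator_scaleC:
  "commutator (c *\<^sub>C T) (1 + P) = c *\<^sub>C (T * P - P * (T::'a::complex_hilbert bop))"
  by (simp add: commutator_def distrib_left distrib_right bop_scaleC_diff scaleC_add_right)

text \<open>By the involution property \<open>v\<close> is the double commutator with
  \<open>P\<close>; the inner one times \<open>- \<i>\<close> is self-adjoint and Hilbert-Schmidt,
  and serves as \<open>x\<close>.\<close>

lemma tangent_space_orbit_commutators:
  assumes A: "hs_proj A" and P: "in_orbit A P"
  shows "op_of ` tangent_space (unitary_orbit (1 + A)) (1 + P) = {\<i> *\<^sub>C commutator (op_of x) (1 + P) | x :: 'a::complex_hilbert hsh. True}"
proof (intro set_eqI iffI)
  note hP = hs_projD[OF in_orbit_hs_proj[OF A P]]
  fix T assume "T \<in> op_of ` tangent_space (unitary_orbit (1 + A)) (1 + P)"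
  then obtain v where v: "tangential P (op_of v)" "T = op_of v" unfolding tangent_space_orbit[OF A P] by blast
  let ?X = "(- \<i>) *\<^sub>C (op_of v * P - P * op_of v)"
  have "op_of (sa_part ?X) = ?X"
    by (rule op_of_sa_part_self)
      (auto intro!: hs_intros hs_mult_left(1)[OF hP(4)] hs_mult_right(1)[OF hP(4)] simp: hP bop_scaleC_diff)
  moreover have "commutator ?X (1 + P) = (- \<i>) *\<^sub>C ((op_of v * P - P * op_of v) * P - P * (op_of v * P - P * op_of v))"
    by (rule commutator_scaleC)
  ultimately have "T = \<i> *\<^sub>C commutator (op_of (sa_part ?X)) (1 + P)"
    unfolding tangential_commutator(2)[OF hP(2) v(1)] by (simp add: v(2) scaleC_scaleC)
  then show "T \<in> {\<i> *\<^sub>C commutator (op_of x) (1 + P) | x. True}" by blast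
next
  note hP = hs_projD[OF in_orbit_hs_proj[OF A P]]
  fix T assume "T \<in> {\<i> *\<^sub>C commutator (op_of x) (1 + P) | x :: 'a hsh. True}"
  then obtain x :: "'a hsh" where T: "T = \<i> *\<^sub>C commutator (op_of x) (1 + P)" by blast
  have "commutator (op_of x) (1 + P) = op_of x * P - P * op_of x" by (simp add: commutator_def algebra_simps)
  then have op: "op_of (sa_part T) = T" unfolding T
    by (intro op_of_sa_part_self)
      (auto intro!: hs_intros hs_mult_left(1)[OF hP(4)] hs_mult_right(1)[OF hP(4)] simp: hP bop_scaleC_diff)
  have "tangential P (op_of (sa_part T))"
    unfolding op unfolding T by (rule tangential_i_commutator[OF hP(2)])
  then show "T \<in> op_of ` tangent_space (unitary_orbit (1 + A)) (1 + P)"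
    unfolding tangent_space_orbit[OF A P] by (intro image_eqI[of T op_of "sa_part T", OF op[symmetric]]) simp
qed

lemma scaleC_i_of_real: "(\<i> * complex_of_real t) *\<^sub>C T = t *\<^sub>R (\<i> *\<^sub>C (T::'a::complex_hilbert bop))"
  by (simp only: scaleC_of_real[symmetric] scaleC_scaleC mult.commute)

lemma tangential_scaleC: "tangential P T \<Longrightarrow> tangential P (c *\<^sub>C (T::'a::complex_hilbert bop))"
  by (simp add: tangential_def flip: scaleC_add_right)

lemma tangential_codiag:
  assumes A: "A * A = A" shows "tangential A (codiag A h)"
proof -
  have "A * (A * S) = A * S" for S by (simp add: mult.assoc[symmetric] A)
  then show ?thesis by (simp add: tangential_def codiag_def algebra_simps A)
qed

lemma tangential_unitary:
  assumes "unitary_op g" "tangential A h" shows "tangential (g * A * adj g) (g * h * adj g)"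
proof -
  have "g * (A * h + h * A) * adj g = g * h * adj g" using assms(2) by (simp only: tangential_def)
  then show ?thesis
    by (simp add: tangential_def distrib_left distrib_right mult.assoc unitary_op_simps[OF assms(1)])
qed

text \<open>The double commutator of \<open>x\<close> with \<open>P\<close> is the co-diagonal part
  of \<open>x\<close> with respect to \<open>P\<close>, and conjugation by \<open>g\<close> carries
  \<open>A\<close> to \<open>P\<close>. This identifies the generator of the geodesic with initial
  velocity \<open>V\<close>.\<close>

lemma double_commutator_codiag:
  fixes x :: "'a::complex_hilbert bop"
  assumes g: "unitary_op g" and A: "A * A = A" and P: "P = g * A * adj g"
  defines "V \<equiv> \<i> *\<^sub>C commutator x (1 + P)"
  shows "\<i> *\<^sub>C (g * codiag A (adj g * x * g) * adj g) = V * P - P * V"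
proof -
  note u = unitary_op_simps[OF g]
  have AA: "A * (A * S) = A * S" for S by (simp add: mult.assoc[symmetric] A)
  have "g * codiag A (adj g * x * g) * adj g = P * x * (1 - P) + (1 - P) * x * P"
    unfolding P codiag_def by (simp add: algebra_simps u)
  also have "\<dots> = commutator x (1 + P) * P - P * commutator x (1 + P)"
    unfolding P commutator_def by (simp add: algebra_simps u A AA)
  finally show ?thesis by (simp add: V_def bop_scaleC_diff)
qed

theorem theorem2p16:
  fixes a :: "'a::{complex_hilbert, second_countable_topology} hsh"
    and A :: "'a bop" and \<Omega> :: "'a bop set"
  assumes A: "orth_projector A" and exp_a: "bexp (op_of a) = 1 + A"
    and Omega: "\<Omega> = unitary_orbit (bexp (op_of a))"
  shows
    "riemannian_submanifold \<Omega> \<and>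

     (\<forall>p\<in>\<Omega>. op_of ` tangent_space \<Omega> p = {\<i> *\<^sub>C commutator (op_of x) p | x :: 'a hsh. True} \<and>
       tangent_perp \<Omega> p = {x. commutator (op_of x) p = 0}) \<and>

     (\<forall>p\<in>\<Omega>. \<forall>q\<in>\<Omega>. \<forall>u. unitary_op u \<longrightarrow>
       geod_dist \<Omega> (u * p * adj u) (u * q * adj u) = geod_dist \<Omega> p q) \<and>

     (\<forall>p\<in>\<Omega>. \<forall>g x v h. unitary_op g \<and> p = g * bexp (op_of a) * adj g \<and>
       op_of v = \<i> *\<^sub>C commutator (op_of x) p \<and> h = codiag A (adj g * op_of x * g) \<longrightarrow>
       v \<in> exp_domain \<Omega> p \<and>
       exp_map \<Omega> p v = bexp (\<i> *\<^sub>C (g * h * adj g)) * p * bexp (- (\<i> *\<^sub>C (g * h * adj g)))) \<and>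
     (\<forall>p\<in>\<Omega>. exp_domain \<Omega> p = tangent_space \<Omega> p) \<and>

     (\<forall>p q g w h \<gamma>. unitary_op g \<and> unitary_op w \<and>
       p = g * bexp (op_of a) * adj g \<and> q = w * bexp (op_of a) * adj w \<and>
       selfadjoint h \<and> codiag A h = h \<and>
       commutator (adj w * g * bexp (\<i> *\<^sub>C h)) (bexp (op_of a)) = 0 \<and>
       \<gamma> = (\<lambda>t. bexp ((\<i> * complex_of_real t) *\<^sub>C (g * h * adj g)) * p *
                bexp (- ((\<i> * complex_of_real t) *\<^sub>C (g * h * adj g)))) \<longrightarrow>
       geodesic \<Omega> \<gamma> \<and> \<gamma> 0 = p \<and> \<gamma> 1 = q \<and>
       (\<forall>k. op_of k = h \<longrightarrow> curve_length \<gamma> = sqrt 2 / 2 * norm k)) \<and>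

     (\<forall>p\<in>\<Omega>. exp_map \<Omega> p ` tangent_space \<Omega> p = \<Omega>)"
proof -
  \<comment> \<open>\<open>A\<close> is \<open>bexp (op_of a) - 1\<close> and hence
    Hilbert-Schmidt.\<close>
  have pA: "hs_proj A"
    using A hs_bexp_minus_1[OF hilbert_schmidt_op_of[of a]] by (simp add: hs_proj_def orth_projector_iff exp_a)
  note AA = hs_projD(2)[OF pA]
  have \<Omega>: "\<Omega> = unitary_orbit (1 + A)" by (simp add: Omega exp_a)
  have orb: "\<exists>P. p = 1 + P \<and> in_orbit A P" if "p \<in> \<Omega>" for p using that orbit_iff[OF pA] by (simp add: \<Omega>)
  have conj1: "g * (1 + A) * adj g = 1 + g * A * adj g" if "unitary_op g" for g
    by (simp add: algebra_simps unitary_op_simps[OF that])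
  have comm: "commutator x (1 + P) = 0 \<longleftrightarrow> P * x = x * P" for x P :: "'a bop"
    by (auto simp: commutator_def algebra_simps)
  have dom: "exp_domain \<Omega> p = tangent_space \<Omega> p" if p: "p \<in> \<Omega>" for p
  proof -
    obtain P where P: "p = 1 + P" "in_orbit A P" using orb[OF p] by blast
    have "v \<in> exp_domain \<Omega> p" if "v \<in> tangent_space \<Omega> p" for v
      using that exp_map_orbit(1)[OF pA P(2) _ refl, of v] unfolding \<Omega> P(1) tangent_space_orbit[OF pA P(2)] by simp
    then show ?thesis by (auto simp: exp_domain_def)
  qed
  have exp: "v \<in> exp_domain \<Omega> p \<and>
      exp_map \<Omega> p v = bexp (\<i> *\<^sub>C (g * h * adj g)) * p * bexp (- (\<i> *\<^sub>C (g * h * adj g)))"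
    if p: "p = g * bexp (op_of a) * adj g" and g: "unitary_op g"
      and v: "op_of v = \<i> *\<^sub>C commutator (op_of x) p" and h: "h = codiag A (adj g * op_of x * g)" for p g x v h
  proof -
    define P where "P = g * A * adj g"
    have pP: "p = 1 + P" unfolding p exp_a conj1[OF g] P_def ..
    have P: "in_orbit A P" using g by (auto simp: in_orbit_def[OF pA] P_def)
    have tv: "tangential P (op_of v)"
      unfolding v pP by (rule tangential_i_commutator[OF hs_projD(2)[OF in_orbit_hs_proj[OF pA P]]])
    have "\<i> *\<^sub>C (g * h * adj g) = op_of v * P - P * op_of v"
      unfolding h v pP by (rule double_commutator_codiag[OF g AA P_def])
    from exp_map_orbit[OF pA P tv this] show ?thesis unfolding \<Omega> pP by blast
  qed
  have geo: "geodesic \<Omega> \<gamma> \<and> \<gamma> 0 = p \<and> \<gamma> 1 = q \<and> (\<forall>k. op_of k = h \<longrightarrow> curve_length \<gamma> = sqrt 2 / 2 * norm k)"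
    if g: "unitary_op g" and w: "unitary_op w"
      and p: "p = g * bexp (op_of a) * adj g" and q: "q = w * bexp (op_of a) * adj w"
      and h: "selfadjoint h" "codiag A h = h"
      and c: "commutator (adj w * g * bexp (\<i> *\<^sub>C h)) (bexp (op_of a)) = 0"
      and \<gamma>: "\<gamma> = (\<lambda>t. bexp ((\<i> * complex_of_real t) *\<^sub>C (g * h * adj g)) * p *
                bexp (- ((\<i> * complex_of_real t) *\<^sub>C (g * h * adj g))))" for p q g w h \<gamma>
  proof -
    define P where "P = g * A * adj g"
    define K where "K = g * h * adj g"
    define T where "T = \<i> *\<^sub>C K"
    have pP: "p = 1 + P" unfolding p exp_a conj1[OF g] P_def ..
    have P: "in_orbit A P" using g by (auto simp: in_orbit_def[OF pA] P_def)
    note hP = hs_projD[OF in_orbit_hs_proj[OF pA P]]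
    have adjh: "adj h = h" using h(1) by (simp add: selfadjoint_iff)
    have adjT: "adj T = - T" unfolding T_def K_def by (simp add: adjh mult.assoc)
    have th: "tangential A h" using tangential_codiag[OF AA, of h] h(2) by simp
    have tK: "tangential P K" unfolding P_def K_def by (rule tangential_unitary[OF g th])
    then have tT: "tangential P T" unfolding T_def by (rule tangential_scaleC)
    have \<gamma>T: "\<gamma> = (\<lambda>t. bexp (t *\<^sub>R T) * (1 + P) * bexp (t *\<^sub>R (- T)))"
      unfolding \<gamma> scaleC_i_of_real T_def K_def pP by simp
    have "\<gamma> 0 = p" unfolding \<gamma>T pP by simp
    moreover have "\<gamma> 1 = q"
    proof -
      let ?E = "bexp (\<i> *\<^sub>C h)"
      have skew: "adj (\<i> *\<^sub>C h) = - (\<i> *\<^sub>C h)" by (simp add: adjh)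
      have E: "unitary_op ?E" by (rule unitary_bexp[OF skew])
      have "T = g * (\<i> *\<^sub>C h) * adj g" by (simp add: T_def K_def)
      then have ET: "bexp T = g * ?E * adj g" by (simp only: bexp_unitary_conj[OF g])
      have adjET: "adj (bexp T) = bexp (- T)" by (simp add: adj_bexp adjT)
      define C where "C = adj w * g * ?E"
      have C: "unitary_op C" unfolding C_def by (intro unitary_op_mult unitary_op_adj g w E)
      have Cc: "C * (1 + A) = (1 + A) * C" using c unfolding commutator_def exp_a C_def[symmetric] by simp
      \<comment> \<open>The unitary that moves the base point to \<open>\<gamma> 1\<close> differs
        from \<open>w\<close> only by \<open>C\<close>, which commutes with \<open>1 + A\<close> and
        therefore cancels in the conjugation.\<close>
      have gE: "g * ?E = w * C" unfolding C_def by (simp add: mult.assoc unitary_op_simps[OF w])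
      have "\<gamma> 1 = bexp T * p * adj (bexp T)" unfolding \<gamma>T pP adjET by simp
      also have "\<dots> = g * ?E * (adj g * g) * (1 + A) * (adj g * g) * adj (g * ?E)"
        unfolding ET p exp_a by (simp only: adj_simps mult.assoc)
      also have "\<dots> = (w * C) * (1 + A) * adj (w * C)"
        unfolding unitary_op_simps(1)[OF g] gE by simp
      also have "\<dots> = w * (C * (1 + A)) * adj C * adj w" by (simp only: adj_simps mult.assoc)
      also have "\<dots> = w * (1 + A) * (C * adj C) * adj w" unfolding Cc by (simp only: mult.assoc)
      also have "\<dots> = q" unfolding unitary_op_simps(2)[OF C] q exp_a by simp
      finally show ?thesis .
    qed
    moreover have "curve_length \<gamma> = sqrt 2 / 2 * norm k" if k: "op_of k = h" for k
    proof -
      have hsh: "hilbert_schmidt h" using hilbert_schmidt_op_of[of k] k by simp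
      then have hsK: "hilbert_schmidt K" unfolding K_def by (intro hs_mult_left hs_mult_right)
      have adjK: "adj K = K" unfolding K_def by (simp add: adjh mult.assoc)
      let ?W = "T * P - P * T"
      have W: "hilbert_schmidt ?W" "adj ?W = ?W"
        by (auto intro!: hs_diff hs_mult_left(1)[OF hP(4)] hs_mult_right(1)[OF hP(4)] simp: hP adjT)
      note tk = tangential_simps[OF hP(2) tK]
      have W': "?W = \<i> *\<^sub>C (K * P - P * K)" by (simp add: T_def bop_scaleC_diff)
      \<comment> \<open>The commutator with \<open>P\<close> flips the sign of one off-diagonal
        block, hence of the square; the factor \<open>\<i>\<close> in \<open>T\<close> flips it
        back. So \<open>?W\<close> and \<open>K\<close> have equal squares, and equal
        \<open>hs2\<close> because both are self-adjoint.\<close>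
      have "(K * P - P * K) * (K * P - P * K) = - (K * K)"
      proof -
        have PK: "P * K = K - K * P" using tk(4) by simp
        have 1: "(K * P - P * K) * (K * P - P * K) = K * (P * (K * P)) + P * (K * (P * K)) - K * P * K - P * K * K * P"
          by (simp add: algebra_simps mult_assoc_rules(1)[OF hP(2)])
        have "P * K * K * P = P * (K * K)"
        proof -
          have c: "K * (K * P) = P * (K * K)"
            using tangential_mult_commute[OF tK tK] by (simp add: mult.assoc)
          show ?thesis by (simp add: mult.assoc c hP)
        qed
        moreover have "K * P * K + P * (K * K) = K * K"
          using arg_cong[OF tK[unfolded tangential_def], of "\<lambda>S. S * K"] by (simp add: distrib_right mult.assoc add.commute)
        moreover have "P * (K * (P * K)) = 0" using tk(1) by (metis mult.assoc mult_zero_left)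
        ultimately show ?thesis unfolding 1 using tk(2) by (simp add: algebra_simps)
      qed
      then have "?W * ?W = K * K" unfolding W' by (simp add: scaleC_scaleC)
      then have "hs2 ?W = hs2 K" using rtr_self[OF W] rtr_self[OF hsK adjK] by simp
      also have "\<dots> = hs2 h" unfolding K_def by (rule hs2_unitary[OF hsh g])
      finally have "curve_length \<gamma> = sqrt (2 * hs2 h)"
        unfolding \<gamma>T using curve_length_conj[OF pA P adjT tT] by simp
      then show ?thesis by (simp add: norm_hsh_hs2 k real_sqrt_mult)
    qed
    ultimately show ?thesis using geodesic_conj[OF pA P adjT tT] unfolding \<Omega> \<gamma>T by blast
  qed
  have tan: "op_of ` tangent_space \<Omega> p = {\<i> *\<^sub>C commutator (op_of x) p | x :: 'a hsh. True} \<and>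
       tangent_perp \<Omega> p = {x. commutator (op_of x) p = 0}" if p: "p \<in> \<Omega>" for p
  proof -
    obtain P where P: "p = 1 + P" "in_orbit A P" using orb[OF p] by blast
    show ?thesis unfolding \<Omega> P(1) comm
      using tangent_space_orbit_commutators[OF pA P(2)] tangent_perp_orbit[OF pA P(2)] by blast
  qed
  have surj: "exp_map \<Omega> p ` tangent_space \<Omega> p = \<Omega>" if "p \<in> \<Omega>" for p
    using orb[OF that] exp_map_orbit_surj[OF pA] unfolding \<Omega> by blast
  have dist: "geod_dist \<Omega> (u * p * adj u) (u * q * adj u) = geod_dist \<Omega> p q" if "unitary_op u" for u p q
    unfolding \<Omega> by (rule geod_dist_conj[OF pA that])
  show ?thesis
  proof (intro conjI)
    show "riemannian_submanifold \<Omega>" unfolding \<Omega> by (rule riemannian_submanifold_orbit[OF pA])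
    show "\<forall>p\<in>\<Omega>. \<forall>g x v h. unitary_op g \<and> p = g * bexp (op_of a) * adj g \<and>
       op_of v = \<i> *\<^sub>C commutator (op_of x) p \<and> h = codiag A (adj g * op_of x * g) \<longrightarrow>
       v \<in> exp_domain \<Omega> p \<and>
       exp_map \<Omega> p v = bexp (\<i> *\<^sub>C (g * h * adj g)) * p * bexp (- (\<i> *\<^sub>C (g * h * adj g)))"
      by (intro ballI allI impI, elim conjE, rule exp; assumption)
    show "\<forall>p q g w h \<gamma>. unitary_op g \<and> unitary_op w \<and>
       p = g * bexp (op_of a) * adj g \<and> q = w * bexp (op_of a) * adj w \<and>
       selfadjoint h \<and> codiag A h = h \<and>
       commutator (adj w * g * bexp (\<i> *\<^sub>C h)) (bexp (op_of a)) = 0 \<and>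
       \<gamma> = (\<lambda>t. bexp ((\<i> * complex_of_real t) *\<^sub>C (g * h * adj g)) * p *
                bexp (- ((\<i> * complex_of_real t) *\<^sub>C (g * h * adj g)))) \<longrightarrow>
       geodesic \<Omega> \<gamma> \<and> \<gamma> 0 = p \<and> \<gamma> 1 = q \<and>
       (\<forall>k. op_of k = h \<longrightarrow> curve_length \<gamma> = sqrt 2 / 2 * norm k)"
      by (intro allI impI, elim conjE, rule geo; assumption)
  qed (use tan dist dom surj in simp_all)
qed

end
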